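(* Let $k$ be a field, $D=\operatorname{Hom}_k(-,k)$, $\mathcal{T}$ a $k$-linear Hom-finite triangulated category and $\mathcal{T}^{\mathrm{fd}}$ a thick subcategory of $\mathcal{T}$. Assume that $\mathcal{T}^{\mathrm{fd}}$ has an auto-equivalence $S$ such that there is a functorial isomorphism $D\operatorname{Hom}_{\mathcal{T}}(X,Y)\simeq\operatorname{Hom}_{\mathcal{T}}(Y,SX)$ for any $X\in\mathcal{T}^{\mathrm{fd}}$ and $Y\in\mathcal{T}$. Let $M$ be a silting object of $\mathcal{T}$. Then the following conditions are equivalent. (a) $M$ has a right adjacent t-structure $(M[<0]^{\perp},M[>0]^{\perp})$ with $M[>0]^{\perp}\subset\mathcal{T}^{\mathrm{fd}}$. (b) $M$ has a left adjacent t-structure $({}^{\perp}M[<0],{}^{\perp}M[>0])$ with ${}^{\perp}M[<0]\subset\mathcal{T}^{\mathrm{fd}}$. In this case, $S({}^{\perp}M[<0])\subset M[<0]^{\perp}$ and ${}^{\perp}M[>0]\supset S^{-1}(M[>0]^{\perp})$, and $S$ restricts to an equivalence of hearts $S:{}^{\perp}M[<0]\cap{}^{\perp}M[>0]\to M[<0]^{\perp}\cap M[>0]^{\perp}$.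
   Context: All subcategories are full; $[1]$ is the shift functor. A thick subcategory is a triangulated subcategory closed under direct summands. An object $M$ is silting if $\operatorname{Hom}_{\mathcal{T}}(M,M[i])=0$ for all $i>0$ and the smallest thick subcategory of $\mathcal{T}$ containing $M$ is $\mathcal{T}$. All perpendicular categories are taken in $\mathcal{T}$: ${}^{\perp}\mathcal{S}=\{X\in\mathcal{T}\mid\operatorname{Hom}_{\mathcal{T}}(X,\mathcal{S})=0\}$, $\mathcal{S}^{\perp}=\{X\in\mathcal{T}\mid\operatorname{Hom}_{\mathcal{T}}(\mathcal{S},X)=0\}$; $M[<0]$ (resp. $M[>0]$) stands for all $M[i]$ with $i<0$ (resp. $i>0$). A t-structure on $\mathcal{T}$ is a pair $(\mathcal{T}^{\le0},\mathcal{T}^{\ge0})$ of subcategories such that, with $\mathcal{T}^{\ge1}=\mathcal{T}^{\ge0}[-1]$, one has $\mathcal{T}^{\ge1}\subset\mathcal{T}^{\ge0}$, $\mathcal{T}^{\le0}={}^{\perp}\mathcal{T}^{\ge1}$, $\mathcal{T}^{\ge1}=(\mathcal{T}^{\le0})^{\perp}$, and every $X\in\mathcal{T}$ fits in a triangle $X'\to X\to X''\to X'[1]$ with $X'\in\mathcal{T}^{\le0}$, $X''\in\mathcal{T}^{\ge1}$; its heart is $\mathcal{T}^{\le0}\cap\mathcal{T}^{\ge0}$. $M$ has a right adjacent t-structure if $(M[<0]^{\perp},M[>0]^{\perp})$ is a t-structure on $\mathcal{T}$, and a left adjacent t-structure if $({}^{\perp}M[<0],{}^{\perp}M[>0])$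 is a t-structure on $\mathcal{T}$. *)

theory Defs
  imports "Jordan_Normal_Form.Missing_VectorSpace"
begin

section \<open>Linear categories\<close>

text \<open>
  Every morphism space is a module record over the scalars, so that a category carries all of its
  linear structure. The multiplicative part of these records is irrelevant and unconstrained.
\<close>

record ('o, 'm, 'a) lin_cat =
  Ob :: "'o set"
  HomSp :: "'o \<Rightarrow> 'o \<Rightarrow> ('a, 'm) module"
  Id :: "'o \<Rightarrow> 'm"
  Comp :: "'m \<Rightarrow> 'm \<Rightarrow> 'm" (infixl \<open>\<cdot>\<index>\<close> 70)

abbreviation Hom :: "('o, 'm, 'a, 'z) lin_cat_scheme \<Rightarrow> 'o \<Rightarrow> 'o \<Rightarrow> 'm set"
  where "Hom C X Y \<equiv> carrier (HomSp C X Y)"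

definition Hom_zero :: "('o, 'm, 'a, 'z) lin_cat_scheme \<Rightarrow> 'o \<Rightarrow> 'o \<Rightarrow> bool"
  where "Hom_zero C X Y \<longleftrightarrow> Hom C X Y = {\<zero>\<^bsub>HomSp C X Y\<^esub>}"

locale cat =
  fixes C :: "('o, 'm, 'a, 'z) lin_cat_scheme" (structure)
  assumes Id_in_Hom: "X \<in> Ob C \<Longrightarrow> Id C X \<in> Hom C X X"
    and Comp_in_Hom:
      "\<lbrakk>X \<in> Ob C; Y \<in> Ob C; Z \<in> Ob C; f \<in> Hom C X Y; g \<in> Hom C Y Z\<rbrakk> \<Longrightarrow> g \<cdot> f \<in> Hom C X Z"
    and Comp_Id_right: "\<lbrakk>X \<in> Ob C; Y \<in> Ob C; f \<in> Hom C X Y\<rbrakk> \<Longrightarrow> f \<cdot> Id C X = f"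
    and Comp_Id_left: "\<lbrakk>X \<in> Ob C; Y \<in> Ob C; f \<in> Hom C X Y\<rbrakk> \<Longrightarrow> Id C Y \<cdot> f = f"
    and Comp_assoc:
      "\<lbrakk>W \<in> Ob C; X \<in> Ob C; Y \<in> Ob C; Z \<in> Ob C; f \<in> Hom C W X; g \<in> Hom C X Y; h \<in> Hom C Y Z\<rbrakk>
        \<Longrightarrow> (h \<cdot> g) \<cdot> f = h \<cdot> (g \<cdot> f)"
    and Hom_disjoint:
      "\<lbrakk>X \<in> Ob C; Y \<in> Ob C; X' \<in> Ob C; Y' \<in> Ob C; f \<in> Hom C X Y; f \<in> Hom C X' Y'\<rbrakk>
        \<Longrightarrow> X = X' \<and> Y = Y'"

locale linear_cat = cat C + field K
  for K :: "'a ring" and C :: "('o, 'm, 'a, 'z) lin_cat_scheme" (structure) +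
  assumes Hom_vectorspace: "\<lbrakk>X \<in> Ob C; Y \<in> Ob C\<rbrakk> \<Longrightarrow> vectorspace K (HomSp C X Y)"
    and Comp_linear_right:
      "\<lbrakk>X \<in> Ob C; Y \<in> Ob C; Z \<in> Ob C; g \<in> Hom C Y Z\<rbrakk>
        \<Longrightarrow> (\<lambda>f. g \<cdot> f) \<in> module_hom K (HomSp C X Y) (HomSp C X Z)"
    and Comp_linear_left:
      "\<lbrakk>X \<in> Ob C; Y \<in> Ob C; Z \<in> Ob C; f \<in> Hom C X Y\<rbrakk>
        \<Longrightarrow> (\<lambda>g. g \<cdot> f) \<in> module_hom K (HomSp C Y Z) (HomSp C X Z)"

definition hom_finite :: "'a ring \<Rightarrow> ('o, 'm, 'a, 'z) lin_cat_scheme \<Rightarrow> bool"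
  where "hom_finite K C \<longleftrightarrow> (\<forall>X\<in>Ob C. \<forall>Y\<in>Ob C. vectorspace.fin_dim K (HomSp C X Y))"

text \<open>Subcategories are full throughout and are given by their classes of objects.\<close>

definition full_sub :: "('o, 'm, 'a, 'z) lin_cat_scheme \<Rightarrow> 'o set \<Rightarrow> ('o, 'm, 'a, 'z) lin_cat_scheme"
  where "full_sub C A = C\<lparr>Ob := A\<rparr>"

definition iso_in :: "('o, 'm, 'a, 'z) lin_cat_scheme \<Rightarrow> 'o \<Rightarrow> 'o \<Rightarrow> 'm \<Rightarrow> bool"
  where "iso_in C X Y f \<longleftrightarrow>
    f \<in> Hom C X Y \<and> (\<exists>g\<in>Hom C Y X. g \<cdot>\<^bsub>C\<^esub> f = Id C X \<and> f \<cdot>\<^bsub>C\<^esub> g = Id C Y)"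

definition zero_object :: "('o, 'm, 'a, 'z) lin_cat_scheme \<Rightarrow> 'o \<Rightarrow> bool"
  where "zero_object C Z \<longleftrightarrow> Z \<in> Ob C \<and> (\<forall>X\<in>Ob C. Hom_zero C X Z \<and> Hom_zero C Z X)"

definition direct_sum_of :: "('o, 'm, 'a, 'z) lin_cat_scheme \<Rightarrow> 'o \<Rightarrow> 'o \<Rightarrow> 'o \<Rightarrow> bool"
  where "direct_sum_of C X Y W \<longleftrightarrow> X \<in> Ob C \<and> Y \<in> Ob C \<and> W \<in> Ob C \<and>
    (\<exists>i\<in>Hom C X W. \<exists>j\<in>Hom C Y W. \<exists>p\<in>Hom C W X. \<exists>q\<in>Hom C W Y.
      p \<cdot>\<^bsub>C\<^esub> i = Id C X \<and> q \<cdot>\<^bsub>C\<^esub> j = Id C Y \<and>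
      p \<cdot>\<^bsub>C\<^esub> j = \<zero>\<^bsub>HomSp C Y X\<^esub> \<and> q \<cdot>\<^bsub>C\<^esub> i = \<zero>\<^bsub>HomSp C X Y\<^esub> \<and>
      (i \<cdot>\<^bsub>C\<^esub> p) \<oplus>\<^bsub>HomSp C W W\<^esub> (j \<cdot>\<^bsub>C\<^esub> q) = Id C W)"

section \<open>Functors and equivalences\<close>

record ('o, 'm, 'p, 'n) fctr =
  omap :: "'o \<Rightarrow> 'p"
  mmap :: "'m \<Rightarrow> 'n"

definition id_fctr :: "('o, 'm, 'o, 'm) fctr"
  where "id_fctr = \<lparr>omap = (\<lambda>X. X), mmap = (\<lambda>f. f)\<rparr>"

definition comp_fctr :: "('p, 'n, 'q, 'l) fctr \<Rightarrow> ('o, 'm, 'p, 'n) fctr \<Rightarrow> ('o, 'm, 'q, 'l) fctr"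
  where "comp_fctr G F = \<lparr>omap = omap G \<circ> omap F, mmap = mmap G \<circ> mmap F\<rparr>"

locale is_fctr =
  fixes C :: "('o, 'm, 'a, 'y) lin_cat_scheme" and D :: "('p, 'n, 'b, 'z) lin_cat_scheme"
    and F :: "('o, 'm, 'p, 'n) fctr"
  assumes omap_in_Ob: "X \<in> Ob C \<Longrightarrow> omap F X \<in> Ob D"
    and mmap_in_Hom:
      "\<lbrakk>X \<in> Ob C; Y \<in> Ob C; f \<in> Hom C X Y\<rbrakk> \<Longrightarrow> mmap F f \<in> Hom D (omap F X) (omap F Y)"
    and mmap_Id: "X \<in> Ob C \<Longrightarrow> mmap F (Id C X) = Id D (omap F X)"
    and mmap_Comp:
      "\<lbrakk>X \<in> Ob C; Y \<in> Ob C; Z \<in> Ob C; f \<in> Hom C X Y; g \<in> Hom C Y Z\<rbrakk>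
        \<Longrightarrow> mmap F (g \<cdot>\<^bsub>C\<^esub> f) = mmap F g \<cdot>\<^bsub>D\<^esub> mmap F f"

definition naturally_iso ::
    "('o, 'm, 'a, 'y) lin_cat_scheme \<Rightarrow> ('p, 'n, 'b, 'z) lin_cat_scheme \<Rightarrow>
     ('o, 'm, 'p, 'n) fctr \<Rightarrow> ('o, 'm, 'p, 'n) fctr \<Rightarrow> bool"
  where "naturally_iso C D F G \<longleftrightarrow>
    (\<exists>\<eta>. (\<forall>X\<in>Ob C. iso_in D (omap F X) (omap G X) (\<eta> X)) \<and>
         (\<forall>X\<in>Ob C. \<forall>Y\<in>Ob C. \<forall>f\<in>Hom C X Y. \<eta> Y \<cdot>\<^bsub>D\<^esub> mmap F f = mmap G f \<cdot>\<^bsub>D\<^esub> \<eta> X))"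

definition quasi_inverse ::
    "('o, 'm, 'a, 'y) lin_cat_scheme \<Rightarrow> ('p, 'n, 'b, 'z) lin_cat_scheme \<Rightarrow>
     ('o, 'm, 'p, 'n) fctr \<Rightarrow> ('p, 'n, 'o, 'm) fctr \<Rightarrow> bool"
  where "quasi_inverse C D F G \<longleftrightarrow> is_fctr C D F \<and> is_fctr D C G \<and>
    naturally_iso C C (comp_fctr G F) id_fctr \<and> naturally_iso D D (comp_fctr F G) id_fctr"

definition cat_equivalence ::
    "('o, 'm, 'a, 'y) lin_cat_scheme \<Rightarrow> ('p, 'n, 'b, 'z) lin_cat_scheme \<Rightarrow>
     ('o, 'm, 'p, 'n) fctr \<Rightarrow> bool"
  where "cat_equivalence C D F \<longleftrightarrow> (\<exists>G. quasi_inverse C D F G)"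

section \<open>Triangulated categories\<close>

text \<open>
  \<open>Dist T X Y Z f g h\<close> says that \<open>X \<rightarrow> Y \<rightarrow> Z \<rightarrow> X[1]\<close>, with maps \<open>f, g, h\<close>, is a distinguished
  triangle.
\<close>

record ('o, 'm, 'a) tri_cat = "('o, 'm, 'a) lin_cat" +
  Shift :: "('o, 'm, 'o, 'm) fctr"
  Dist :: "'o \<Rightarrow> 'o \<Rightarrow> 'o \<Rightarrow> 'm \<Rightarrow> 'm \<Rightarrow> 'm \<Rightarrow> bool"

abbreviation sh1 :: "('o, 'm, 'a) tri_cat \<Rightarrow> 'o \<Rightarrow> 'o"
  where "sh1 T \<equiv> omap (Shift T)"

abbreviation shm :: "('o, 'm, 'a) tri_cat \<Rightarrow> 'm \<Rightarrow> 'm"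
  where "shm T \<equiv> mmap (Shift T)"

text \<open>
  As usual, the shift is a linear automorphism (not just an auto-equivalence), so that all
  integral powers of it are defined on the nose. The last assumption is the octahedral axiom.
\<close>

locale triangulated_cat = linear_cat K T
  for K :: "'a ring" and T :: "('o, 'm, 'a) tri_cat" (structure) +
  assumes ex_zero_object: "\<exists>Z. zero_object T Z"
    and ex_direct_sum: "\<lbrakk>X \<in> Ob T; Y \<in> Ob T\<rbrakk> \<Longrightarrow> \<exists>W. direct_sum_of T X Y W"
    and Shift_fctr: "is_fctr T T (Shift T)"
    and Shift_bij_Ob: "bij_betw (sh1 T) (Ob T) (Ob T)"
    and Shift_bij_Hom:
      "\<lbrakk>X \<in> Ob T; Y \<in> Ob T\<rbrakk> \<Longrightarrow> bij_betw (shm T) (Hom T X Y) (Hom T (sh1 T X) (sh1 T Y))"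
    and Shift_linear:
      "\<lbrakk>X \<in> Ob T; Y \<in> Ob T\<rbrakk>
        \<Longrightarrow> shm T \<in> module_hom K (HomSp T X Y) (HomSp T (sh1 T X) (sh1 T Y))"
    and Dist_typed:
      "Dist T X Y Z f g h \<Longrightarrow> X \<in> Ob T \<and> Y \<in> Ob T \<and> Z \<in> Ob T \<and>
        f \<in> Hom T X Y \<and> g \<in> Hom T Y Z \<and> h \<in> Hom T Z (sh1 T X)"
    and Dist_iso:
      "\<lbrakk>Dist T X Y Z f g h; X' \<in> Ob T; Y' \<in> Ob T; Z' \<in> Ob T;
        f' \<in> Hom T X' Y'; g' \<in> Hom T Y' Z'; h' \<in> Hom T Z' (sh1 T X');
        iso_in T X X' a; iso_in T Y Y' b; iso_in T Z Z' c;
        b \<cdot> f = f' \<cdot> a; c \<cdot> g = g' \<cdot> b; shm T a \<cdot> h = h' \<cdot> c\<rbrakk>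
        \<Longrightarrow> Dist T X' Y' Z' f' g' h'"
    and Dist_Id:
      "\<lbrakk>X \<in> Ob T; zero_object T Z\<rbrakk>
        \<Longrightarrow> Dist T X X Z (Id T X) \<zero>\<^bsub>HomSp T X Z\<^esub> \<zero>\<^bsub>HomSp T Z (sh1 T X)\<^esub>"
    and Dist_cone:
      "\<lbrakk>X \<in> Ob T; Y \<in> Ob T; f \<in> Hom T X Y\<rbrakk> \<Longrightarrow> \<exists>Z g h. Dist T X Y Z f g h"
    and Dist_rotate:
      "\<lbrakk>X \<in> Ob T; Y \<in> Ob T; Z \<in> Ob T;
        f \<in> Hom T X Y; g \<in> Hom T Y Z; h \<in> Hom T Z (sh1 T X)\<rbrakk>
        \<Longrightarrow> Dist T X Y Z f g h \<longleftrightarrow>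
            Dist T Y Z (sh1 T X) g h (\<ominus>\<^bsub>HomSp T (sh1 T X) (sh1 T Y)\<^esub> shm T f)"
    and Dist_morphism:
      "\<lbrakk>Dist T X Y Z f g h; Dist T X' Y' Z' f' g' h';
        a \<in> Hom T X X'; b \<in> Hom T Y Y'; b \<cdot> f = f' \<cdot> a\<rbrakk>
        \<Longrightarrow> \<exists>c\<in>Hom T Z Z'. c \<cdot> g = g' \<cdot> b \<and> shm T a \<cdot> h = h' \<cdot> c"
    and Dist_octahedron:
      "\<lbrakk>Dist T X Y Z' f i i'; Dist T Y Z X' g j j'; Dist T X Z Y' (g \<cdot> f) k k'\<rbrakk>
        \<Longrightarrow> \<exists>u v. Dist T Z' Y' X' u v (shm T i \<cdot> j') \<and>
              u \<cdot> i = k \<cdot> g \<and> k' \<cdot> u = i' \<and> v \<cdot> k = j \<and> j' \<cdot> v = shm T f \<cdot> k'"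

definition shift :: "('o, 'm, 'a) tri_cat \<Rightarrow> int \<Rightarrow> 'o \<Rightarrow> 'o"
  where "shift T n X = (if 0 \<le> n then (sh1 T ^^ nat n) X
                        else (the_inv_into (Ob T) (sh1 T) ^^ nat (- n)) X)"

text \<open>Nonemptiness together with closure under cones forces a zero object into the subcategory.\<close>

definition triangulated_sub :: "('o, 'm, 'a) tri_cat \<Rightarrow> 'o set \<Rightarrow> bool"
  where "triangulated_sub T A \<longleftrightarrow> A \<subseteq> Ob T \<and> A \<noteq> {} \<and>
    (\<forall>X\<in>A. \<forall>Y\<in>Ob T. \<forall>f. iso_in T X Y f \<longrightarrow> Y \<in> A) \<and>
    (\<forall>X\<in>A. \<forall>n. shift T n X \<in> A) \<and>
    (\<forall>X Y Z f g h. Dist T X Y Z f g h \<longrightarrow> X \<in> A \<longrightarrow> Y \<in> A \<longrightarrow> Z \<in> A)"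

definition thick_sub :: "('o, 'm, 'a) tri_cat \<Rightarrow> 'o set \<Rightarrow> bool"
  where "thick_sub T A \<longleftrightarrow> triangulated_sub T A \<and>
    (\<forall>X Y W. direct_sum_of T X Y W \<longrightarrow> W \<in> A \<longrightarrow> X \<in> A \<and> Y \<in> A)"

definition thick_closure :: "('o, 'm, 'a) tri_cat \<Rightarrow> 'o \<Rightarrow> 'o set"
  where "thick_closure T M = \<Inter> {A. thick_sub T A \<and> M \<in> A}"

definition silting :: "('o, 'm, 'a) tri_cat \<Rightarrow> 'o \<Rightarrow> bool"
  where "silting T M \<longleftrightarrow> M \<in> Ob T \<and> (\<forall>i>0. Hom_zero T M (shift T i M)) \<and> thick_closure T M = Ob T"

section \<open>Perpendicular categories and t-structures\<close>

definition left_perp :: "('o, 'm, 'a) tri_cat \<Rightarrow> 'o set \<Rightarrow> 'o set"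
  where "left_perp T A = {X \<in> Ob T. \<forall>Y\<in>A. Hom_zero T X Y}"

definition right_perp :: "('o, 'm, 'a) tri_cat \<Rightarrow> 'o set \<Rightarrow> 'o set"
  where "right_perp T A = {X \<in> Ob T. \<forall>Y\<in>A. Hom_zero T Y X}"

definition neg_shifts :: "('o, 'm, 'a) tri_cat \<Rightarrow> 'o \<Rightarrow> 'o set"
  where "neg_shifts T M = {shift T i M | i. i < 0}"

definition pos_shifts :: "('o, 'm, 'a) tri_cat \<Rightarrow> 'o \<Rightarrow> 'o set"
  where "pos_shifts T M = {shift T i M | i. i > 0}"

text \<open>Here \<open>U\<close> is the aisle and \<open>V\<close> the part in degrees \<open>\<ge> 0\<close>.\<close>

definition t_structure :: "('o, 'm, 'a) tri_cat \<Rightarrow> 'o set \<Rightarrow> 'o set \<Rightarrow> bool"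
  where "t_structure T U V \<longleftrightarrow> U \<subseteq> Ob T \<and> V \<subseteq> Ob T \<and>
    (let V1 = shift T (- 1) ` V in
      V1 \<subseteq> V \<and> U = left_perp T V1 \<and> V1 = right_perp T U \<and>
      (\<forall>X\<in>Ob T. \<exists>X'\<in>U. \<exists>X''\<in>V1. \<exists>f g h. Dist T X' X X'' f g h))"

definition heart :: "'o set \<Rightarrow> 'o set \<Rightarrow> 'o set"
  where "heart U V = U \<inter> V"

definition right_adjacent_t_structure :: "('o, 'm, 'a) tri_cat \<Rightarrow> 'o \<Rightarrow> bool"
  where "right_adjacent_t_structure T M \<longleftrightarrow>
    t_structure T (right_perp T (neg_shifts T M)) (right_perp T (pos_shifts T M))"

definition left_adjacent_t_structure :: "('o, 'm, 'a) tri_cat \<Rightarrow> 'o \<Rightarrow> bool"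
  where "left_adjacent_t_structure T M \<longleftrightarrow>
    t_structure T (left_perp T (neg_shifts T M)) (left_perp T (pos_shifts T M))"

section \<open>Relative Serre duality\<close>

definition scalars :: "'a ring \<Rightarrow> ('a, 'a) module"
  where "scalars K = \<lparr>carrier = carrier K, mult = mult K, one = one K, zero = zero K,
                      add = add K, smult = mult K\<rparr>"

text \<open>
  The dual space \<open>Hom\<^sub>K(V, K)\<close>; functionals are undefined outside \<open>V\<close>, which makes them unique as
  functions.
\<close>

definition dual_space :: "'a ring \<Rightarrow> ('a, 'v) module \<Rightarrow> ('a, 'v \<Rightarrow> 'a) module"
  where "dual_space K V =
    (ring.func_space K (carrier V))
      \<lparr>carrier := module_hom K V (scalars K) \<inter> extensional (carrier V)\<rparr>"

text \<open>
  A linear isomorphism \<open>D Hom(X, Y) \<simeq> Hom(Y, S X)\<close> that is natural in \<open>X\<close> from the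
  subcategory \<open>A\<close> and in \<open>Y\<close> from the whole category.
\<close>

definition serre_duality ::
    "'a ring \<Rightarrow> ('o, 'm, 'a) tri_cat \<Rightarrow> 'o set \<Rightarrow> ('o, 'm, 'o, 'm) fctr \<Rightarrow> bool"
  where "serre_duality K T A S \<longleftrightarrow> (\<exists>\<phi>.
    (\<forall>X\<in>A. \<forall>Y\<in>Ob T.
      \<phi> X Y \<in> module_hom K (dual_space K (HomSp T X Y)) (HomSp T Y (omap S X)) \<and>
      bij_betw (\<phi> X Y) (carrier (dual_space K (HomSp T X Y))) (Hom T Y (omap S X))) \<and>
    (\<forall>X\<in>A. \<forall>X'\<in>A. \<forall>Y\<in>Ob T. \<forall>a\<in>Hom T X X'. \<forall>\<xi>\<in>carrier (dual_space K (HomSp T X Y)).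
      \<phi> X' Y (\<lambda>f\<in>Hom T X' Y. \<xi> (f \<cdot>\<^bsub>T\<^esub> a)) = mmap S a \<cdot>\<^bsub>T\<^esub> \<phi> X Y \<xi>) \<and>
    (\<forall>X\<in>A. \<forall>Y\<in>Ob T. \<forall>Y'\<in>Ob T. \<forall>b\<in>Hom T Y' Y. \<forall>\<xi>\<in>carrier (dual_space K (HomSp T X Y)).
      \<phi> X Y' (\<lambda>f\<in>Hom T X Y'. \<xi> (b \<cdot>\<^bsub>T\<^esub> f)) = \<phi> X Y \<xi> \<cdot>\<^bsub>T\<^esub> b))"

end

theory Submission
  imports Defs
begin

text \<open>
  Orthogonality comes first: every \<open>X\<close> with \<open>Hom(X, M[>0]) = 0\<close> is left orthogonal to every \<open>Y\<close> with
  \<open>Hom(M[\<le>0], Y) = 0\<close>. By thick induction this holds for all \<open>X\<close> with \<open>Hom(X, M[>-n]) = 0\<close> and some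
  \<open>n\<close>, and \<open>n\<close> is lowered by taking fibres of maps \<open>X \<rightarrow> M[-n]\<close>, each of which decreases
  \<open>dim Hom(X, M[-n])\<close>.

  Assume (a). To truncate \<open>X\<close> with \<open>Hom(X, M[>0]) = 0\<close> in the left adjacent way, one needs a map
  \<open>\<eta> : H \<rightarrow> X\<close> with \<open>Hom(H, M[i]) = 0\<close> for \<open>i \<noteq> 0\<close> that induces a bijection \<open>Hom(X, M) \<rightarrow> Hom(H, M)\<close>:
  its cone lies in \<open>\<^sup>\<bottom>M[\<ge>0]\<close>. Build an object \<open>C\<close> from copies of \<open>M\<close> with a functional \<open>\<xi>\<close> on
  \<open>Hom(X, C)\<close> such that \<open>(f, z) \<mapsto> \<xi>(z f)\<close> is a perfect pairing of \<open>Hom(X, M)\<close> and \<open>Hom(M, C)\<close>: add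
  copies of \<open>M\<close> until the pairing separates \<open>Hom(X, M)\<close>, then take cones of the maps \<open>M \<rightarrow> C\<close> in its
  kernel. By (a) the truncation \<open>Z\<close> of \<open>C\<close> in degrees \<open>\<ge> 0\<close> lies in \<open>\<T>\<^sup>f\<^sup>d\<close>, and \<open>\<xi>\<close> factors through
  \<open>Hom(X, Z)\<close> by orthogonality. With \<open>H = S\<^sup>-\<^sup>1 Z\<close>, relative Serre duality turns \<open>\<xi>\<close> into \<open>\<eta>\<close>. The
  other implication is the same argument in the opposite category.
\<close>

section \<open>Duality for finite-dimensional spaces\<close>

text \<open>Throughout, a functional is any member of \<open>module_hom K V (scalars K)\<close>; its
  values outside \<open>carrier V\<close> are free, so plain lambda terms qualify without
  \<open>restrict\<close>.\<close>

lemma dual_iff: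
  "\<xi> \<in> module_hom K V (scalars K) \<longleftrightarrow> \<xi> \<in> carrier V \<rightarrow> carrier K \<and>
    (\<forall>v\<in>carrier V. \<forall>w\<in>carrier V. \<xi> (v \<oplus>\<^bsub>V\<^esub> w) = \<xi> v \<oplus>\<^bsub>K\<^esub> \<xi> w) \<and>
    (\<forall>c\<in>carrier K. \<forall>v\<in>carrier V. \<xi> (c \<odot>\<^bsub>V\<^esub> v) = c \<otimes>\<^bsub>K\<^esub> \<xi> v)"
  by (auto simp: module_hom_def scalars_def)

lemma dual_closed:
  "\<xi> \<in> module_hom K V (scalars K) \<Longrightarrow> v \<in> carrier V \<Longrightarrow> \<xi> v \<in> carrier K"
  by (auto simp: dual_iff)

lemma dual_zero:
  assumes "vectorspace K V" "\<xi> \<in> module_hom K V (scalars K)"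
  shows "\<xi> \<zero>\<^bsub>V\<^esub> = \<zero>\<^bsub>K\<^esub>"
proof -
  interpret vectorspace K V by fact
  show ?thesis
    using lmult_0[of "\<zero>\<^bsub>V\<^esub>"] dual_closed[of \<xi> K V "\<zero>\<^bsub>V\<^esub>"] assms(2)
    unfolding dual_iff by (metis M.zero_closed R.zero_closed R.l_null)
qed

text \<open>The coordinate functionals of a finite basis separate points.\<close>

lemma ex_separating_functionals:
  assumes "vectorspace K V" "vectorspace.fin_dim K V"
  shows "\<exists>\<Lambda>. finite \<Lambda> \<and> \<Lambda> \<subseteq> module_hom K V (scalars K) \<and>
    (\<forall>v\<in>carrier V. (\<forall>l\<in>\<Lambda>. l v = \<zero>\<^bsub>K\<^esub>) \<longrightarrow> v = \<zero>\<^bsub>V\<^esub>)"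
proof -
  interpret vectorspace K V by fact
  obtain B where B: "finite B" "basis B" using finite_basis_exists assms(2) by blast
  then have BV: "B \<subseteq> carrier V" by (simp add: basis_def)
  have ex: "\<exists>!a. a \<in> B \<rightarrow>\<^sub>E carrier K \<and> lincomb a B = v" if "v \<in> carrier V" for v
    using B basis_criterion[OF B(1) BV] that by auto
  \<comment> \<open>The coordinate vector of \<open>v\<close>, extensional on \<open>B\<close> so
    that it is unique; \<open>c_eq\<close> then reads coordinates off any expansion, which gives
    linearity.\<close>
  define c where "c v = (THE a. a \<in> B \<rightarrow>\<^sub>E carrier K \<and> lincomb a B = v)" for v
  have c: "c v \<in> B \<rightarrow>\<^sub>E carrier K" "lincomb (c v) B = v" if "v \<in> carrier V" for v
    using theI'[OF ex[OF that]] by (auto simp: c_def)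
  have c_eq: "c v = restrict a B" if "a \<in> B \<rightarrow> carrier K" "lincomb a B = v" for a v
  proof -
    have "lincomb (restrict a B) B = v"
      using that lincomb_cong[OF refl BV, of "restrict a B" a] by auto
    moreover have "v \<in> carrier V" using that BV by auto
    ultimately show ?thesis using ex[of v] c[of v] that(1) by (metis restrict_PiE_iff PiE_mem Pi_mem)
  qed
  define l where "l b v = c v b" for b v
  have "l b \<in> module_hom K V (scalars K)" if b: "b \<in> B" for b
    unfolding dual_iff
  proof (intro conjI ballI)
    show "l b \<in> carrier V \<rightarrow> carrier K" using c(1) b by (fastforce simp: l_def)
    fix v w assume vw: "v \<in> carrier V" "w \<in> carrier V"
    have "lincomb (\<lambda>b. c v b \<oplus>\<^bsub>K\<^esub> c w b) B = v \<oplus>\<^bsub>V\<^esub> w"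
      using lincomb_sum[OF B(1) BV, of "c v" "c w"] c[OF vw(1)] c[OF vw(2)] by auto
    with c[OF vw(1)] c[OF vw(2)] have "c (v \<oplus>\<^bsub>V\<^esub> w) = (\<lambda>b\<in>B. c v b \<oplus>\<^bsub>K\<^esub> c w b)"
      by (intro c_eq) auto
    then show "l b (v \<oplus>\<^bsub>V\<^esub> w) = l b v \<oplus>\<^bsub>K\<^esub> l b w" by (simp add: l_def b)
  next
    fix x v assume xv: "x \<in> carrier K" "v \<in> carrier V"
    have "lincomb (\<lambda>b. x \<otimes>\<^bsub>K\<^esub> c v b) B = x \<odot>\<^bsub>V\<^esub> v"
      using lincomb_smult[OF BV, of "c v" x] c[OF xv(2)] xv by auto
    with c[OF xv(2)] xv have "c (x \<odot>\<^bsub>V\<^esub> v) = (\<lambda>b\<in>B. x \<otimes>\<^bsub>K\<^esub> c v b)"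
      by (intro c_eq) auto
    then show "l b (x \<odot>\<^bsub>V\<^esub> v) = x \<otimes>\<^bsub>K\<^esub> l b v" by (simp add: l_def b)
  qed
  moreover have "v = \<zero>\<^bsub>V\<^esub>" if v: "v \<in> carrier V" and "\<forall>b\<in>B. l b v = \<zero>\<^bsub>K\<^esub>" for v
  proof -
    have "lincomb (c v) B = \<zero>\<^bsub>V\<^esub>"
      by (rule lincomb_zero[OF BV]) (use that in \<open>auto simp: l_def\<close>)
    then show ?thesis using c(2)[OF v] by simp
  qed
  ultimately show ?thesis using B(1) by (intro exI[of _ "l ` B"]) auto
qed

lemma ex_functional_nonzero:
  assumes "vectorspace K V" "vectorspace.fin_dim K V" "v \<in> carrier V" "v \<noteq> \<zero>\<^bsub>V\<^esub>"
  obtains l where "l \<in> module_hom K V (scalars K)" "l v \<noteq> \<zero>\<^bsub>K\<^esub>"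
  using ex_separating_functionals[OF assms(1,2)] assms(3,4) by blast

text \<open>The vectors satisfying \<open>P\<close> form a submodule containing \<open>B\<close>,
  hence its span.\<close>

lemma (in vectorspace) gen_set_induct:
  assumes "gen_set B" "B \<subseteq> carrier V" "v \<in> carrier V" "\<And>b. b \<in> B \<Longrightarrow> P b" "P \<zero>\<^bsub>V\<^esub>"
    "\<And>v w. v \<in> carrier V \<Longrightarrow> w \<in> carrier V \<Longrightarrow> P v \<Longrightarrow> P w \<Longrightarrow> P (v \<oplus>\<^bsub>V\<^esub> w)"
    "\<And>c v. c \<in> carrier K \<Longrightarrow> v \<in> carrier V \<Longrightarrow> P v \<Longrightarrow> P (c \<odot>\<^bsub>V\<^esub> v)"
  shows "P v"
proof -
  have "submodule K {v \<in> carrier V. P v} V"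
    by (unfold_locales) (use assms in auto)
  then have "span B \<subseteq> {v \<in> carrier V. P v}"
    using assms by (intro span_is_subset) auto
  then show ?thesis using assms by auto
qed

lemma (in cring) pairing_identities:
  assumes "a \<in> carrier R" "b \<in> carrier R" "c \<in> carrier R" "d \<in> carrier R" "x \<in> carrier R"
  shows "a \<oplus> b \<ominus> x \<otimes> (c \<oplus> d) = (a \<ominus> x \<otimes> c) \<oplus> (b \<ominus> x \<otimes> d)"
    and "x \<otimes> a \<ominus> b \<otimes> (x \<otimes> c) = x \<otimes> (a \<ominus> b \<otimes> c)"
    and "a \<oplus> \<ominus> (a \<otimes> b) \<otimes> c = a \<otimes> (\<one> \<ominus> b \<otimes> c)"
    and "a \<ominus> (b \<otimes> c) \<otimes> d = a \<oplus> \<ominus> (d \<otimes> c) \<otimes> b"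
    and "a = (a \<ominus> b) \<oplus> b"
  using assms by algebra+

text \<open>A functional that vanishes on the common kernel of finitely many functionals is a linear
  combination of them. This is applied to \<open>\<beta> b\<close> for generators \<open>b\<close>
  of \<open>V\<close>, whose common kernel is zero by nondegeneracy.\<close>

lemma functional_representable:
  fixes \<beta> :: "'v \<Rightarrow> 'w \<Rightarrow> 'a"
  assumes V: "vectorspace K V" and W: "vectorspace K W" and findim: "vectorspace.fin_dim K V"
    and left: "\<And>w. w \<in> carrier W \<Longrightarrow> (\<lambda>v. \<beta> v w) \<in> module_hom K V (scalars K)"
    and right: "\<And>v. v \<in> carrier V \<Longrightarrow> \<beta> v \<in> module_hom K W (scalars K)"
    and nondeg: "\<And>w. w \<in> carrier W \<Longrightarrow> (\<And>v. v \<in> carrier V \<Longrightarrow> \<beta> v w = \<zero>\<^bsub>K\<^esub>) \<Longrightarrow> w = \<zero>\<^bsub>W\<^esub>"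
    and th: "\<theta> \<in> module_hom K W (scalars K)"
  shows "\<exists>v\<in>carrier V. \<forall>w\<in>carrier W. \<theta> w = \<beta> v w"
proof -
  interpret V: vectorspace K V by fact
  interpret W: vectorspace K W by fact
  have closed: "\<beta> v w \<in> carrier K" if "v \<in> carrier V" "w \<in> carrier W" for v w
    by (rule dual_closed[OF right]) (fact that)+
  have th_closed: "\<theta> w \<in> carrier K" if "w \<in> carrier W" for w
    by (rule dual_closed[OF th]) (fact that)
  have addr: "\<beta> v (w \<oplus>\<^bsub>W\<^esub> w') = \<beta> v w \<oplus>\<^bsub>K\<^esub> \<beta> v w'"
    if "v \<in> carrier V" "w \<in> carrier W" "w' \<in> carrier W" for v w w'
    using right[OF that(1)] that unfolding dual_iff by auto
  have smr: "\<beta> v (c \<odot>\<^bsub>W\<^esub> w) = c \<otimes>\<^bsub>K\<^esub> \<beta> v w"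
    if "v \<in> carrier V" "w \<in> carrier W" "c \<in> carrier K" for v w c
    using right[OF that(1)] that unfolding dual_iff by auto
  have addl: "\<beta> (v \<oplus>\<^bsub>V\<^esub> v') w = \<beta> v w \<oplus>\<^bsub>K\<^esub> \<beta> v' w"
    if "v \<in> carrier V" "w \<in> carrier W" "v' \<in> carrier V" for v w v'
    using left[OF that(2)] that unfolding dual_iff by auto
  have sml: "\<beta> (c \<odot>\<^bsub>V\<^esub> v) w = c \<otimes>\<^bsub>K\<^esub> \<beta> v w"
    if "v \<in> carrier V" "w \<in> carrier W" "c \<in> carrier K" for v w c
    using left[OF that(2)] that unfolding dual_iff by auto
  obtain B where B: "finite B" "B \<subseteq> carrier V" "V.gen_set B" using findim V.fin_dim_def by auto
  \<comment> \<open>The induction varies the functional along with \<open>A\<close>, since the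
    inductive step replaces \<open>\<theta>\<close> by \<open>\<theta>'\<close>.\<close>
  have step: "\<exists>v\<in>carrier V. \<forall>w\<in>carrier W. \<theta> w = \<beta> v w"
    if "finite A" "A \<subseteq> carrier V" "\<theta> \<in> module_hom K W (scalars K)"
      "\<And>w. w \<in> carrier W \<Longrightarrow> (\<forall>b\<in>A. \<beta> b w = \<zero>\<^bsub>K\<^esub>) \<Longrightarrow> \<theta> w = \<zero>\<^bsub>K\<^esub>" for A \<theta>
    using that
  proof (induction A arbitrary: \<theta> rule: finite_induct)
    case empty
    have "\<beta> \<zero>\<^bsub>V\<^esub> w = \<zero>\<^bsub>K\<^esub>" if "w \<in> carrier W" for w
      by (rule dual_zero[OF V left[OF that]])
    with empty show ?case by (intro bexI[of _ "\<zero>\<^bsub>V\<^esub>"]) auto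
  next
    case (insert b A)
    have b: "b \<in> carrier V" using insert by auto
    note th = insert.prems(2)[unfolded dual_iff]
    have th_cl: "\<theta> w \<in> carrier K" if "w \<in> carrier W" for w using th that by auto
    show ?case
    proof (cases "\<exists>u\<in>carrier W. (\<forall>a\<in>A. \<beta> a u = \<zero>\<^bsub>K\<^esub>) \<and> \<beta> b u \<noteq> \<zero>\<^bsub>K\<^esub>")
      \<comment> \<open>Here \<open>\<beta> b\<close> vanishes on the common kernel for
        \<open>A\<close>, so \<open>b\<close> may be dropped.\<close>
      case False
      then show ?thesis by (intro insert.IH) (use insert.prems in auto)
    next
      case True
      then obtain u where u: "u \<in> carrier W" "\<And>a. a \<in> A \<Longrightarrow> \<beta> a u = \<zero>\<^bsub>K\<^esub>" "\<beta> b u \<noteq> \<zero>\<^bsub>K\<^esub>" by blast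
      define i where "i = inv\<^bsub>K\<^esub> (\<beta> b u)"
      have i: "i \<in> carrier K" "i \<otimes>\<^bsub>K\<^esub> \<beta> b u = \<one>\<^bsub>K\<^esub>"
        using u closed[OF b u(1)] V.field.inverse_exists by (auto simp: i_def V.field.field_Units)
      \<comment> \<open>The multiple of \<open>\<beta> b\<close> to subtract is chosen so that
        \<open>\<theta>'\<close> vanishes on \<open>u\<close>.\<close>
      define c where "c = \<theta> u \<otimes>\<^bsub>K\<^esub> i"
      have c: "c \<in> carrier K" using i th_cl u by (simp add: c_def)
      define \<theta>' where "\<theta>' w = \<theta> w \<ominus>\<^bsub>K\<^esub> c \<otimes>\<^bsub>K\<^esub> \<beta> b w" for w
      have "\<theta>' \<in> module_hom K W (scalars K)"
        unfolding dual_iff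
      proof (intro conjI ballI)
        show "\<theta>' \<in> carrier W \<rightarrow> carrier K" using th_cl closed b c by (auto simp: \<theta>'_def)
        fix v w assume vw: "v \<in> carrier W" "w \<in> carrier W"
        note [simp] = th_cl[OF vw(1)] th_cl[OF vw(2)] closed[OF b vw(1)] closed[OF b vw(2)]
        show "\<theta>' (v \<oplus>\<^bsub>W\<^esub> w) = \<theta>' v \<oplus>\<^bsub>K\<^esub> \<theta>' w"
          using th vw b c V.pairing_identities(1) by (simp add: \<theta>'_def addr)
      next
        fix x w assume xw: "x \<in> carrier K" "w \<in> carrier W"
        note [simp] = th_cl[OF xw(2)] closed[OF b xw(2)]
        show "\<theta>' (x \<odot>\<^bsub>W\<^esub> w) = x \<otimes>\<^bsub>K\<^esub> \<theta>' w"
          using th xw b c V.pairing_identities(2) by (simp add: \<theta>'_def smr)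
      qed
      moreover have "\<theta>' w = \<zero>\<^bsub>K\<^esub>" if w: "w \<in> carrier W" "\<forall>a\<in>A. \<beta> a w = \<zero>\<^bsub>K\<^esub>" for w
      proof -
        \<comment> \<open>Moving \<open>w\<close> along \<open>u\<close> stays in the common kernel
          for \<open>A\<close>; this multiple also makes \<open>\<beta> b\<close> vanish, so the
          hypothesis on \<open>\<theta>\<close> applies to the moved vector.\<close>
        define d where "d = \<ominus>\<^bsub>K\<^esub> (\<beta> b w \<otimes>\<^bsub>K\<^esub> i)"
        note cl = th_cl[OF w(1)] closed[OF b w(1)] th_cl[OF u(1)] closed[OF b u(1)] i(1)
        have d: "d \<in> carrier K" using cl by (simp add: d_def)
        let ?w = "w \<oplus>\<^bsub>W\<^esub> d \<odot>\<^bsub>W\<^esub> u"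
        have w': "?w \<in> carrier W" using w u d by auto
        have "\<beta> a ?w = \<zero>\<^bsub>K\<^esub>" if a: "a \<in> A" for a
          using that w u d insert.prems(1) by (simp add: addr smr subset_iff)
        moreover have "\<beta> b ?w = \<zero>\<^bsub>K\<^esub>"
        proof -
          have "\<beta> b ?w = \<beta> b w \<oplus>\<^bsub>K\<^esub> \<ominus>\<^bsub>K\<^esub> (\<beta> b w \<otimes>\<^bsub>K\<^esub> i) \<otimes>\<^bsub>K\<^esub> \<beta> b u"
            using w(1) u(1) d b cl by (simp add: addr smr d_def)
          also have "\<dots> = \<zero>\<^bsub>K\<^esub>"
            using cl i(2) by (simp add: V.pairing_identities(3) a_minus_def V.R.r_neg)
          finally show ?thesis .
        qed
        ultimately have "\<theta> ?w = \<zero>\<^bsub>K\<^esub>" using insert.prems(3) w' by auto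
        then have "\<theta> w \<oplus>\<^bsub>K\<^esub> d \<otimes>\<^bsub>K\<^esub> \<theta> u = \<zero>\<^bsub>K\<^esub>" using th w u d by simp
        then show ?thesis using cl unfolding \<theta>'_def c_def d_def
            by (simp only: V.pairing_identities(4))
      qed
      ultimately obtain v where v: "v \<in> carrier V" "\<forall>w\<in>carrier W. \<theta>' w = \<beta> v w"
        using insert.IH[of \<theta>'] insert.prems(1) by auto
      have "\<theta> w = \<beta> (v \<oplus>\<^bsub>V\<^esub> c \<odot>\<^bsub>V\<^esub> b) w" if w: "w \<in> carrier W" for w
      proof -
        have "\<theta> w = \<theta>' w \<oplus>\<^bsub>K\<^esub> c \<otimes>\<^bsub>K\<^esub> \<beta> b w"
          unfolding \<theta>'_def using th_cl[OF w] closed[OF b w] c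
            by (intro V.pairing_identities(5)) auto
        then show ?thesis using v w b c by (simp add: addl sml)
      qed
      then show ?thesis using v b c by (intro bexI[of _ "v \<oplus>\<^bsub>V\<^esub> c \<odot>\<^bsub>V\<^esub> b"]) auto
    qed
  qed
  show ?thesis
  proof (rule step[OF B(1,2) th])
    fix w assume w: "w \<in> carrier W" "\<forall>b\<in>B. \<beta> b w = \<zero>\<^bsub>K\<^esub>"
    have "\<beta> v w = \<zero>\<^bsub>K\<^esub>" if "v \<in> carrier V" for v
      by (rule V.gen_set_induct[OF B(3,2) that])
        (use w dual_zero[OF V left[OF w(1)]] in \<open>auto simp: addl sml\<close>)
    then have "w = \<zero>\<^bsub>W\<^esub>" by (rule nondeg[OF w(1)])
    then show "\<theta> w = \<zero>\<^bsub>K\<^esub>" using dual_zero[OF W] th by simp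
  qed
qed

text \<open>One basis vector can be exchanged for the kernel vector \<open>v\<close>, and the images
  of the others still span \<open>W\<close>.\<close>

lemma dim_less_if_surj_not_inj:
  assumes V: "vectorspace K V" and W: "vectorspace K W" and findim: "vectorspace.fin_dim K V"
    and T: "t \<in> module_hom K V W" and surj: "carrier W \<subseteq> t ` carrier V"
    and v: "v \<in> carrier V" "v \<noteq> \<zero>\<^bsub>V\<^esub>" "t v = \<zero>\<^bsub>W\<^esub>"
  shows "vectorspace.dim K W < vectorspace.dim K V"
proof -
  interpret linear_map K V W t
    using V W T by (simp add: linear_map_def mod_hom_def mod_hom_axioms_def vectorspace_def)
  obtain B where B: "finite B" "V.basis B" using V.finite_basis_exists[OF findim] by blast
  then have BV: "B \<subseteq> carrier V" "V.module.gen_set B" by (auto simp: V.basis_def)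
  have "V.module.lin_indpt {v}"
    using V.lindep_span[of "{v}"] v by (auto simp: V.span_empty)
  then obtain C where C: "finite C" "C \<subseteq> carrier V" "int (card C) \<le> int (card B) - 1"
    "V.module.span ({v} \<union> C) = V.module.span B"
    using V.replacement[of "{v}" B] B BV v by auto
  have tv: "t u \<in> carrier W" if "u \<in> carrier V" for u using that by simp
  then have tC: "t ` C \<subseteq> carrier W" using C by blast
  interpret span: submodule K "W.module.span (t ` C)" W by (rule W.module.span_is_submodule[OF tC])
  have "t u \<in> W.module.span (t ` C)" if u: "u \<in> carrier V" for u
  proof (rule V.gen_set_induct[of "{v} \<union> C" u "\<lambda>u. t u \<in> W.module.span (t ` C)"])
    show "t b \<in> W.module.span (t ` C)" if "b \<in> {v} \<union> C" for b
      using that v W.module.in_own_span[OF tC] by auto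
  qed (use C BV v u in auto)
  then have "W.module.gen_set (t ` C)" using surj W.span_closed[OF tC] by blast
  then have "W.dim \<le> card C"
    using W.gen_ge_dim[of "t ` C"] tC C(1) card_image_le[OF C(1), of t] by fastforce
  then show ?thesis using C(3) V.dim_basis[OF B] by linarith
qed

text \<open>Evaluate \<open>\<xi>\<close> on a set-theoretic section of \<open>t\<close>. The choice
  is immaterial because \<open>\<xi>\<close> vanishes on the kernel, and this also makes the result
  linear.\<close>

lemma functional_descends:
  assumes V: "vectorspace K V" and W: "vectorspace K W"
    and T: "t \<in> module_hom K V W" and surj: "carrier W \<subseteq> t ` carrier V"
    and xi: "\<xi> \<in> module_hom K V (scalars K)"
    and ker: "\<And>v. v \<in> carrier V \<Longrightarrow> t v = \<zero>\<^bsub>W\<^esub> \<Longrightarrow> \<xi> v = \<zero>\<^bsub>K\<^esub>"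
  shows "\<exists>\<xi>'\<in>module_hom K W (scalars K). \<forall>v\<in>carrier V. \<xi>' (t v) = \<xi> v"
proof -
  interpret linear_map K V W t
    using V W T by (simp add: linear_map_def mod_hom_def mod_hom_axioms_def vectorspace_def)
  define s where "s w = (SOME v. v \<in> carrier V \<and> t v = w)" for w
  have s: "s w \<in> carrier V" "t (s w) = w" if "w \<in> carrier W" for w
    using someI_ex[of "\<lambda>v. v \<in> carrier V \<and> t v = w"] surj that by (auto simp: s_def)
  have cl: "\<xi> v \<in> carrier K" if "v \<in> carrier V" for v using dual_closed[OF xi that] .
  have add: "\<xi> (v \<oplus>\<^bsub>V\<^esub> w) = \<xi> v \<oplus>\<^bsub>K\<^esub> \<xi> w" if "v \<in> carrier V" "w \<in> carrier V" for v w
    using xi that by (simp add: dual_iff)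
  have eq: "\<xi> v = \<xi> w" if v: "v \<in> carrier V" "w \<in> carrier V" "t v = t w" for v w
  proof -
    have "\<xi> (v \<ominus>\<^bsub>V\<^esub> w) = \<zero>\<^bsub>K\<^esub>" using v by (intro ker) auto
    moreover have "v = (v \<ominus>\<^bsub>V\<^esub> w) \<oplus>\<^bsub>V\<^esub> w"
      using v by (simp add: a_minus_def V.module.M.a_assoc V.module.M.l_neg)
    ultimately show ?thesis using add[of "v \<ominus>\<^bsub>V\<^esub> w" w] v cl by (metis V.module.M.minus_closed V.module.R.l_zero)
  qed
  have "(\<lambda>w. \<xi> (s w)) \<in> module_hom K W (scalars K)"
    unfolding dual_iff
  proof (intro conjI ballI)
    fix v w assume vw: "v \<in> carrier W" "w \<in> carrier W"
    then show "\<xi> (s (v \<oplus>\<^bsub>W\<^esub> w)) = \<xi> (s v) \<oplus>\<^bsub>K\<^esub> \<xi> (s w)"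
      by (subst add[symmetric]) (auto intro!: eq simp: s)
  next
    fix c w assume cw: "c \<in> carrier K" "w \<in> carrier W"
    then have "\<xi> (s (c \<odot>\<^bsub>W\<^esub> w)) = \<xi> (c \<odot>\<^bsub>V\<^esub> s w)" by (intro eq) (auto simp: s)
    then show "\<xi> (s (c \<odot>\<^bsub>W\<^esub> w)) = c \<otimes>\<^bsub>K\<^esub> \<xi> (s w)" using xi cw s by (simp add: dual_iff)
  qed (auto simp: cl s)
  moreover have "\<xi> (s (t v)) = \<xi> v" if "v \<in> carrier V" for v
    using that by (intro eq) (auto simp: s)
  ultimately show ?thesis by (intro bexI[of _ "\<lambda>w. \<xi> (s w)"]) auto
qed

lemma dual_comp:
  "t \<in> module_hom K V W \<Longrightarrow> l \<in> module_hom K W (scalars K) \<Longrightarrow>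
    (\<lambda>v. l (t v)) \<in> module_hom K V (scalars K)"
  unfolding module_hom_def by (simp add: Pi_iff)

lemma dual_add:
  assumes "field K" "l \<in> module_hom K V (scalars K)" "m \<in> module_hom K V (scalars K)"
  shows "(\<lambda>v. l v \<oplus>\<^bsub>K\<^esub> m v) \<in> module_hom K V (scalars K)"
proof -
  interpret field K by fact
  show ?thesis using assms(2,3)
    unfolding dual_iff by (auto simp: Pi_iff a_ac r_distr)
qed

lemma eq_if_functionals_eq:
  assumes V: "vectorspace K V" "vectorspace.fin_dim K V" and v: "v \<in> carrier V" "w \<in> carrier V"
    and eq: "\<And>l. l \<in> module_hom K V (scalars K) \<Longrightarrow> l v = l w"
  shows "v = w"
proof (rule ccontr)
  interpret vectorspace K V by fact
  assume "v \<noteq> w"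
  then have "v \<ominus>\<^bsub>V\<^esub> w \<noteq> \<zero>\<^bsub>V\<^esub>" using v by simp
  then obtain l where l: "l \<in> module_hom K V (scalars K)" "l (v \<ominus>\<^bsub>V\<^esub> w) \<noteq> \<zero>\<^bsub>K\<^esub>"
    using ex_functional_nonzero[OF V] v M.minus_closed by metis
  have "v = (v \<ominus>\<^bsub>V\<^esub> w) \<oplus>\<^bsub>V\<^esub> w" using v by (simp add: a_minus_def M.a_assoc M.l_neg)
  then have "l v = l (v \<ominus>\<^bsub>V\<^esub> w) \<oplus>\<^bsub>K\<^esub> l w" using l(1) v unfolding dual_iff by (metis M.minus_closed)
  then have "l w = l (v \<ominus>\<^bsub>V\<^esub> w) \<oplus>\<^bsub>K\<^esub> l w" using eq[OF l(1)] by simp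
  then have "l (v \<ominus>\<^bsub>V\<^esub> w) = \<zero>\<^bsub>K\<^esub>"
    using v dual_closed[OF l(1)] R.add.r_cancel_one' by (metis M.minus_closed)
  then show False using l by simp
qed

section \<open>Triangles up to the connecting map\<close>

definition zero_space :: "('a, 'v) module \<Rightarrow> bool"
  where "zero_space V \<longleftrightarrow> carrier V = {\<zero>\<^bsub>V\<^esub>}"

text \<open>
  The axioms below keep only what the argument uses of a triangulated structure, in a form that is
  invariant under passing to the opposite category: triangles forget their connecting map (hence
  all signs), and the octahedral axiom appears both for cones and for fibres. The predicate
  \<open>tri X Y Z f g\<close> says that \<open>X \<rightarrow> Y \<rightarrow> Z\<close> can be completed to a triangle.
\<close>

locale tri_hom = field K for K :: "'a ring" +
  fixes ob :: "'o set"
    and hm :: "'o \<Rightarrow> 'o \<Rightarrow> ('a, 'm) module"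
    and cp :: "'m \<Rightarrow> 'm \<Rightarrow> 'm" (infixl \<open>\<bullet>\<close> 70)
    and un :: "'o \<Rightarrow> 'm"
    and sh :: "int \<Rightarrow> 'o \<Rightarrow> 'o"
    and tri :: "'o \<Rightarrow> 'o \<Rightarrow> 'o \<Rightarrow> 'm \<Rightarrow> 'm \<Rightarrow> bool"
  assumes un_in: "X \<in> ob \<Longrightarrow> un X \<in> carrier (hm X X)"
    and cp_un_right: "\<lbrakk>X \<in> ob; Y \<in> ob; f \<in> carrier (hm X Y)\<rbrakk> \<Longrightarrow> f \<bullet> un X = f"
    and cp_un_left: "\<lbrakk>X \<in> ob; Y \<in> ob; f \<in> carrier (hm X Y)\<rbrakk> \<Longrightarrow> un Y \<bullet> f = f"
    and cp_assoc: "\<lbrakk>W \<in> ob; X \<in> ob; Y \<in> ob; Z \<in> ob; f \<in> carrier (hm W X); g \<in> carrier (hm X Y);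
      h \<in> carrier (hm Y Z)\<rbrakk> \<Longrightarrow> (h \<bullet> g) \<bullet> f = h \<bullet> (g \<bullet> f)"
    and hm_vs: "\<lbrakk>X \<in> ob; Y \<in> ob\<rbrakk> \<Longrightarrow> vectorspace K (hm X Y)"
    and hm_fd: "\<lbrakk>X \<in> ob; Y \<in> ob\<rbrakk> \<Longrightarrow> vectorspace.fin_dim K (hm X Y)"
    and cp_lin_right: "\<lbrakk>X \<in> ob; Y \<in> ob; Z \<in> ob; g \<in> carrier (hm Y Z)\<rbrakk>
      \<Longrightarrow> (\<lambda>f. g \<bullet> f) \<in> module_hom K (hm X Y) (hm X Z)"
    and cp_lin_left: "\<lbrakk>X \<in> ob; Y \<in> ob; Z \<in> ob; f \<in> carrier (hm X Y)\<rbrakk>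
      \<Longrightarrow> (\<lambda>g. g \<bullet> f) \<in> module_hom K (hm Y Z) (hm X Z)"
    and sh_ob: "X \<in> ob \<Longrightarrow> sh n X \<in> ob"
    and sh_0: "X \<in> ob \<Longrightarrow> sh 0 X = X"
    and sh_sh: "X \<in> ob \<Longrightarrow> sh m (sh n X) = sh (m + n) X"
    and sh_zero: "\<lbrakk>X \<in> ob; Y \<in> ob\<rbrakk> \<Longrightarrow> zero_space (hm (sh n X) (sh n Y)) = zero_space (hm X Y)"
    and ex_zero: "\<exists>Z\<in>ob. \<forall>X\<in>ob. zero_space (hm X Z) \<and> zero_space (hm Z X)"
    and ex_sum: "\<lbrakk>X \<in> ob; Y \<in> ob\<rbrakk> \<Longrightarrow> \<exists>W\<in>ob. \<exists>i\<in>carrier (hm X W). \<exists>j\<in>carrier (hm Y W).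
      \<exists>p\<in>carrier (hm W X). \<exists>q\<in>carrier (hm W Y). p \<bullet> i = un X \<and> q \<bullet> j = un Y \<and>
      p \<bullet> j = \<zero>\<^bsub>hm Y X\<^esub> \<and> q \<bullet> i = \<zero>\<^bsub>hm X Y\<^esub> \<and> (i \<bullet> p) \<oplus>\<^bsub>hm W W\<^esub> (j \<bullet> q) = un W"
    and tri_ob: "tri X Y Z f g \<Longrightarrow>
      X \<in> ob \<and> Y \<in> ob \<and> Z \<in> ob \<and> f \<in> carrier (hm X Y) \<and> g \<in> carrier (hm Y Z)"
    and tri_cp: "tri X Y Z f g \<Longrightarrow> g \<bullet> f = \<zero>\<^bsub>hm X Z\<^esub>"
    and tri_rot: "tri X Y Z f g \<Longrightarrow> \<exists>h. tri Y Z (sh 1 X) g h"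
    and tri_rot': "tri X Y Z f g \<Longrightarrow> \<exists>h. tri (sh (- 1) Z) X Y h f"
    and tri_exact: "\<lbrakk>tri X Y Z f g; W \<in> ob; u \<in> carrier (hm W Y); g \<bullet> u = \<zero>\<^bsub>hm W Z\<^esub>\<rbrakk>
      \<Longrightarrow> \<exists>v\<in>carrier (hm W X). u = f \<bullet> v"
    and tri_exact': "\<lbrakk>tri X Y Z f g; W \<in> ob; u \<in> carrier (hm Y W); u \<bullet> f = \<zero>\<^bsub>hm X W\<^esub>\<rbrakk>
      \<Longrightarrow> \<exists>v\<in>carrier (hm Z W). u = v \<bullet> g"
    and tri_cone: "\<lbrakk>X \<in> ob; Y \<in> ob; f \<in> carrier (hm X Y)\<rbrakk> \<Longrightarrow> \<exists>Z g. tri X Y Z f g"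
    and tri_fibre: "\<lbrakk>Y \<in> ob; Z \<in> ob; g \<in> carrier (hm Y Z)\<rbrakk> \<Longrightarrow> \<exists>X f. tri X Y Z f g"
    and tri_oct: "\<lbrakk>tri X Y C f c; tri Y Z D g d\<rbrakk>
      \<Longrightarrow> \<exists>E e u v. tri X Z E (g \<bullet> f) e \<and> tri C E D u v"
    and tri_oct': "\<lbrakk>tri A X Y a f; tri B Y Z b g\<rbrakk>
      \<Longrightarrow> \<exists>D d u v. tri D X Z d (g \<bullet> f) \<and> tri A D B u v"
begin

text \<open>The opposite category: Hom spaces and composition are transposed, the shift is inverted,
  triangles are reversed. Most dual statements below are instances of their counterparts through
  this lemma.\<close>

lemma dual: "tri_hom K ob (\<lambda>X Y. hm Y X) (\<lambda>g f. f \<bullet> g) un (\<lambda>n. sh (- n))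
    (\<lambda>X Y Z f g. tri Z Y X g f)"
proof (intro tri_hom.intro tri_hom_axioms.intro field_axioms, goal_cases)
  case 13
  then show ?case using ex_zero by blast
next
  case (14 X Y)
  then show ?case using ex_sum[of X Y] by fast
next
  case (15 X Y Z f g)
  then show ?case using tri_ob by blast
next
  case (17 X Y Z f g)
  then show ?case using tri_rot' by auto
next
  case (18 X Y Z f g)
  then show ?case using tri_rot by auto
next
  case (23 X Y C f c Z D g d)
  then show ?case using tri_oct' by blast
next
  case (24 A X Y a f B Z b g)
  then show ?case using tri_oct by blast
qed (use un_in cp_un_right cp_un_left hm_vs hm_fd sh_ob sh_0 sh_zero tri_cp
      in \<open>simp_all add: cp_lin_left cp_lin_right cp_assoc sh_sh tri_exact tri_exact' tri_cone tri_fibre\<close>)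

lemma cp_in:
  "\<lbrakk>X \<in> ob; Y \<in> ob; Z \<in> ob; f \<in> carrier (hm X Y); g \<in> carrier (hm Y Z)\<rbrakk>
    \<Longrightarrow> g \<bullet> f \<in> carrier (hm X Z)"
  using module_hom_closed[OF cp_lin_right] by blast

lemma zero_in: "\<lbrakk>X \<in> ob; Y \<in> ob\<rbrakk> \<Longrightarrow> \<zero>\<^bsub>hm X Y\<^esub> \<in> carrier (hm X Y)"
  by (meson abelian_groupE(2) hm_vs module.axioms(2) vectorspace.axioms(1))

lemma cp_zero_right:
  assumes "X \<in> ob" "Y \<in> ob" "Z \<in> ob" "g \<in> carrier (hm Y Z)"
  shows "g \<bullet> \<zero>\<^bsub>hm X Y\<^esub> = \<zero>\<^bsub>hm X Z\<^esub>"
proof -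
  interpret mod_hom K "hm X Y" "hm X Z" "\<lambda>f. g \<bullet> f"
    using assms hm_vs cp_lin_right
    by (simp add: mod_hom_def mod_hom_axioms_def vectorspace.axioms)
  show ?thesis by (rule f0_is_0)
qed

lemma cp_zero_left:
  "\<lbrakk>X \<in> ob; Y \<in> ob; Z \<in> ob; f \<in> carrier (hm X Y)\<rbrakk> \<Longrightarrow> \<zero>\<^bsub>hm Y Z\<^esub> \<bullet> f = \<zero>\<^bsub>hm X Z\<^esub>"
  by (rule tri_hom.cp_zero_right[OF dual])

lemma zero_spaceI:
  "\<lbrakk>X \<in> ob; Y \<in> ob; \<And>f. f \<in> carrier (hm X Y) \<Longrightarrow> f = \<zero>\<^bsub>hm X Y\<^esub>\<rbrakk> \<Longrightarrow> zero_space (hm X Y)"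
  using zero_in by (auto simp: zero_space_def)

text \<open>A map \<open>W \<rightarrow> Y\<close> dies in \<open>Z\<close>, so by exactness it
  comes from \<open>X\<close>. The opposite category gives the version for maps out of
  \<open>Y\<close>.\<close>

lemma zero_mid:
  assumes t: "tri X Y Z f g" and W: "W \<in> ob" "zero_space (hm W X)" "zero_space (hm W Z)"
  shows "zero_space (hm W Y)"
proof (rule zero_spaceI)
  note o = tri_ob[OF t]
  fix u assume u: "u \<in> carrier (hm W Y)"
  then have "g \<bullet> u = \<zero>\<^bsub>hm W Z\<^esub>" using W o cp_in[of W Y Z u g] by (simp add: zero_space_def)
  then obtain v where "v \<in> carrier (hm W X)" "u = f \<bullet> v" using tri_exact[OF t W(1) u] by blast
  then show "u = \<zero>\<^bsub>hm W Y\<^esub>" using W o cp_zero_right by (simp add: zero_space_def)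
qed (use tri_ob[OF t] W in auto)

lemmas zero_mid' = tri_hom.zero_mid[OF dual]

lemma tri_lift:
  assumes t: "tri X Y Z f g" and W: "W \<in> ob" "zero_space (hm W Z)" and u: "u \<in> carrier (hm W Y)"
  shows "\<exists>v\<in>carrier (hm W X). u = f \<bullet> v"
  using assms tri_ob[OF t] cp_in[of W Y Z u g] by (intro tri_exact[OF t W(1) u]) (simp add: zero_space_def)

lemmas tri_extend = tri_hom.tri_lift[OF dual]

lemma zero_retract:
  assumes "X \<in> ob" "Y \<in> ob" "W \<in> ob" "i \<in> carrier (hm X Y)" "p \<in> carrier (hm Y X)" "p \<bullet> i = un X"
    "zero_space (hm W Y)"
  shows "zero_space (hm W X)"
proof (rule zero_spaceI)
  fix u assume u: "u \<in> carrier (hm W X)"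
  have "u = p \<bullet> (i \<bullet> u)" using assms u cp_un_left[of W X u] cp_assoc[of W X Y X u i p] by simp
  moreover have "i \<bullet> u = \<zero>\<^bsub>hm W Y\<^esub>" using assms u cp_in[of W X Y u i] by (simp add: zero_space_def)
  ultimately show "u = \<zero>\<^bsub>hm W X\<^esub>" using assms cp_zero_right by simp
qed (use assms in auto)

lemma zero_retract':
  "\<lbrakk>X \<in> ob; Y \<in> ob; W \<in> ob; i \<in> carrier (hm X Y); p \<in> carrier (hm Y X); p \<bullet> i = un X;
    zero_space (hm Y W)\<rbrakk> \<Longrightarrow> zero_space (hm X W)"
  by (rule tri_hom.zero_retract[OF dual])

text \<open>Three rotations; the signs they introduce are absorbed by the existential maps.\<close>

lemma tri_shift1:
  assumes "tri X Y Z f g"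
  shows "\<exists>f' g'. tri (sh 1 X) (sh 1 Y) (sh 1 Z) f' g'"
  using tri_rot assms by metis

lemmas tri_shift1' = tri_hom.tri_shift1[OF dual]

lemma tri_shift:
  assumes "tri X Y Z f g"
  shows "\<exists>f' g'. tri (sh n X) (sh n Y) (sh n Z) f' g'"
proof (induction n rule: int_induct[where k = 0])
  case base
  then show ?case using assms tri_ob[OF assms] sh_0 by auto
next
  case (step1 n)
  then obtain f' g' where "tri (sh n X) (sh n Y) (sh n Z) f' g'" by blast
  from tri_shift1[OF this] show ?case using tri_ob[OF assms] by (simp add: sh_sh add.commute)
next
  case (step2 n)
  then obtain f' g' where "tri (sh n X) (sh n Y) (sh n Z) f' g'" by blast
  from tri_shift1'[OF this] show ?case using tri_ob[OF assms] by (auto simp add: sh_sh)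
qed

lemma sh_zero_iff:
  "\<lbrakk>X \<in> ob; Y \<in> ob\<rbrakk> \<Longrightarrow> zero_space (hm (sh m X) (sh n Y)) = zero_space (hm X (sh (n - m) Y))"
  using sh_zero[of X "sh (n - m) Y" m] by (simp add: sh_ob sh_sh)

lemma sh_zero_iff_left:
  "\<lbrakk>X \<in> ob; Y \<in> ob\<rbrakk> \<Longrightarrow> zero_space (hm (sh m X) Y) = zero_space (hm X (sh (- m) Y))"
  using sh_zero_iff[of X Y m 0] by (simp add: sh_0)

text \<open>The identity of \<open>Y\<close> is killed by \<open>g\<close>, so it lifts along
  \<open>f\<close>.\<close>

lemma retract_if_zero:
  assumes t: "tri X Y Z f g" and g: "g = \<zero>\<^bsub>hm Y Z\<^esub>"
  shows "\<exists>i\<in>carrier (hm Y X). f \<bullet> i = un Y"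
proof -
  note o = tri_ob[OF t]
  have "g \<bullet> un Y = \<zero>\<^bsub>hm Y Z\<^esub>" using o g cp_un_right by auto
  then show ?thesis using tri_exact[OF t _ un_in] o by metis
qed

lemma retract_if_zero':
  "tri X Y Z f g \<Longrightarrow> f = \<zero>\<^bsub>hm X Y\<^esub> \<Longrightarrow> \<exists>p\<in>carrier (hm Z Y). p \<bullet> g = un Y"
  by (rule tri_hom.retract_if_zero[OF dual])

text \<open>
  Serre duality \<open>Z = S H\<close> expressed through the trace form \<open>t\<close> on \<open>Hom(H, S H)\<close>; unlike a natural
  isomorphism, this description is symmetric in \<open>H\<close> and \<open>Z\<close> under passing to the opposite category.
\<close>

definition serre_pair :: "'o \<Rightarrow> 'o \<Rightarrow> ('m \<Rightarrow> 'a) \<Rightarrow> bool"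
  where "serre_pair H Z t \<longleftrightarrow> t \<in> module_hom K (hm H Z) (scalars K) \<and> (\<forall>Y\<in>ob.
    (\<forall>l\<in>module_hom K (hm Y Z) (scalars K).
      \<exists>h\<in>carrier (hm H Y). \<forall>g\<in>carrier (hm Y Z). l g = t (g \<bullet> h)) \<and>
    (\<forall>l\<in>module_hom K (hm H Y) (scalars K).
      \<exists>z\<in>carrier (hm Y Z). \<forall>f\<in>carrier (hm H Y). l f = t (z \<bullet> f)))"

text \<open>The two representability clauses trade places, so \<open>H\<close> and \<open>Z\<close>
  swap roles.\<close>

lemma serre_pair_dual:
  "tri_hom.serre_pair K ob (\<lambda>X Y. hm Y X) (\<lambda>g f. f \<bullet> g) Z H t = serre_pair H Z t"
  unfolding tri_hom.serre_pair_def[OF dual] serre_pair_def by blast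

text \<open>A nonzero \<open>f\<close> would be seen by some functional on Hom(H, Y), but each of
  these has the form \<open>t (g \<bullet> f)\<close> with \<open>g\<close> in the zero space Hom(Y,
  Z).\<close>

lemma serre_zero:
  assumes s: "serre_pair H Z t" and o: "H \<in> ob" "Z \<in> ob" "Y \<in> ob" and z: "zero_space (hm Y Z)"
  shows "zero_space (hm H Y)"
proof (rule ccontr)
  assume "\<not> zero_space (hm H Y)"
  then obtain f where f: "f \<in> carrier (hm H Y)" "f \<noteq> \<zero>\<^bsub>hm H Y\<^esub>" using zero_spaceI o by blast
  then obtain l where l: "l \<in> module_hom K (hm H Y) (scalars K)" "l f \<noteq> \<zero>\<^bsub>K\<^esub>"
    using ex_functional_nonzero[OF hm_vs hm_fd] o by blast
  then obtain g where g: "g \<in> carrier (hm Y Z)" "l f = t (g \<bullet> f)"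
    using s o f unfolding serre_pair_def by blast
  then have "g = \<zero>\<^bsub>hm Y Z\<^esub>" using z by (simp add: zero_space_def)
  then have "g \<bullet> f = \<zero>\<^bsub>hm H Z\<^esub>" using cp_zero_left o f by simp
  then have "t (g \<bullet> f) = \<zero>\<^bsub>K\<^esub>" using s dual_zero[OF hm_vs] o by (simp add: serre_pair_def)
  then show False using g l by simp
qed

lemma serre_zero':
  "serre_pair H Z t \<Longrightarrow> H \<in> ob \<Longrightarrow> Z \<in> ob \<Longrightarrow> Y \<in> ob \<Longrightarrow> zero_space (hm H Y) \<Longrightarrow>
    zero_space (hm Y Z)"
  by (rule tri_hom.serre_zero[OF dual, unfolded serre_pair_dual])

text \<open>Pairing with Hom(Y, Z) realises every functional on Hom(H, Y), and functionals separate
  points.\<close>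

lemma eq_if_pairing_eq:
  assumes s: "serre_pair H Z t" and o: "H \<in> ob" "Y \<in> ob"
    and f: "f \<in> carrier (hm H Y)" "f' \<in> carrier (hm H Y)"
    and eq: "\<And>g. g \<in> carrier (hm Y Z) \<Longrightarrow> t (g \<bullet> f) = t (g \<bullet> f')"
  shows "f = f'"
proof (rule eq_if_functionals_eq[OF hm_vs hm_fd])
  fix l assume "l \<in> module_hom K (hm H Y) (scalars K)"
  then obtain g where "g \<in> carrier (hm Y Z)" "\<forall>f\<in>carrier (hm H Y). l f = t (g \<bullet> f)"
    using s o unfolding serre_pair_def by blast
  then show "l f = l f'" using eq f by simp
qed (fact o f)+

text \<open>Serves for a quasi-inverse \<open>S'\<close> of \<open>S\<close>, where
  \<open>S (S' Z)\<close> is only isomorphic to \<open>Z\<close>.\<close>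

lemma serre_pair_iso:
  assumes s: "serre_pair H Z t" and o: "H \<in> ob" "Z \<in> ob" "Z' \<in> ob"
    and a: "a \<in> carrier (hm Z Z')" and b: "b \<in> carrier (hm Z' Z)"
    and eqs: "b \<bullet> a = un Z" "a \<bullet> b = un Z'"
  shows "serre_pair H Z' (\<lambda>g. t (b \<bullet> g))"
  unfolding serre_pair_def
proof (intro conjI ballI)
  have t: "t \<in> module_hom K (hm H Z) (scalars K)" using s by (simp add: serre_pair_def)
  show "(\<lambda>g. t (b \<bullet> g)) \<in> module_hom K (hm H Z') (scalars K)"
    by (rule dual_comp[OF cp_lin_right[OF o(1,3,2) b] t])
  fix Y assume Y: "Y \<in> ob"
  show "\<exists>h\<in>carrier (hm H Y). \<forall>g\<in>carrier (hm Y Z'). l g = t (b \<bullet> (g \<bullet> h))"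
    if l: "l \<in> module_hom K (hm Y Z') (scalars K)" for l
  proof -
    have "(\<lambda>g. l (a \<bullet> g)) \<in> module_hom K (hm Y Z) (scalars K)"
      by (rule dual_comp[OF cp_lin_right[OF Y o(2,3) a] l])
    moreover have "\<forall>l\<in>module_hom K (hm Y Z) (scalars K).
        \<exists>h\<in>carrier (hm H Y). \<forall>g\<in>carrier (hm Y Z). l g = t (g \<bullet> h)"
      using s Y unfolding serre_pair_def by blast
    ultimately obtain h where h: "h \<in> carrier (hm H Y)" "\<forall>g\<in>carrier (hm Y Z). l (a \<bullet> g) = t (g \<bullet> h)"
      by fast
    have "l g = t (b \<bullet> (g \<bullet> h))" if g: "g \<in> carrier (hm Y Z')" for g
    proof -
      have "a \<bullet> (b \<bullet> g) = g"
        using cp_assoc[OF Y o(3,2,3) g b a] eqs(2) cp_un_left[OF Y o(3) g] by simp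
      then show ?thesis
        using h(2) cp_in[OF Y o(3,2) g b] cp_assoc[OF o(1) Y o(3,2) h(1) g b] by metis
    qed
    then show ?thesis using h(1) by blast
  qed
  show "\<exists>z\<in>carrier (hm Y Z'). \<forall>f\<in>carrier (hm H Y). l f = t (b \<bullet> (z \<bullet> f))"
    if l: "l \<in> module_hom K (hm H Y) (scalars K)" for l
  proof -
    obtain z where z: "z \<in> carrier (hm Y Z)" "\<forall>f\<in>carrier (hm H Y). l f = t (z \<bullet> f)"
      using s Y l unfolding serre_pair_def by blast
    have "b \<bullet> ((a \<bullet> z) \<bullet> f) = z \<bullet> f" if f: "f \<in> carrier (hm H Y)" for f
    proof -
      have zf: "z \<bullet> f \<in> carrier (hm H Z)" by (rule cp_in[OF o(1) Y o(2) f z(1)])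
      have "b \<bullet> ((a \<bullet> z) \<bullet> f) = (b \<bullet> a) \<bullet> (z \<bullet> f)"
        using cp_assoc[OF o(1) Y o(2,3) f z(1) a] cp_assoc[OF o(1,2,3,2) zf a b] by simp
      then show ?thesis using eqs(1) cp_un_left[OF o(1,2) zf] by simp
    qed
    then show ?thesis using z cp_in[OF Y o(2,3) z(1) a] by (intro bexI[of _ "a \<bullet> z"]) auto
  qed
qed

end

section \<open>Silting objects: thick induction and orthogonality\<close>

text \<open>\<open>M_gen\<close> is thick generation as an induction principle. It speaks of
  extensions and retracts in place of cones and direct summands because those notions are visibly
  self-dual.\<close>

locale tri_silting = tri_hom K ob hm cp un sh tri
  for K :: "'a ring" and ob :: "'o set" and hm :: "'o \<Rightarrow> 'o \<Rightarrow> ('a, 'm) module"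
    and cp (infixl \<open>\<bullet>\<close> 70) and un sh tri +
  fixes M :: 'o
  assumes M_ob: "M \<in> ob"
    and M_rigid: "i > 0 \<Longrightarrow> zero_space (hm M (sh i M))"
    and M_gen: "\<lbrakk>P \<subseteq> ob; M \<in> P; \<And>n X. X \<in> P \<Longrightarrow> sh n X \<in> P;
      \<And>X Y Z f g. tri X Y Z f g \<Longrightarrow> X \<in> P \<Longrightarrow> Z \<in> P \<Longrightarrow> Y \<in> P;
      \<And>X Y i p. \<lbrakk>X \<in> ob; Y \<in> P; i \<in> carrier (hm X Y); p \<in> carrier (hm Y X); p \<bullet> i = un X\<rbrakk>
        \<Longrightarrow> X \<in> P\<rbrakk> \<Longrightarrow> P = ob"
begin

lemma silting_dual: "tri_silting K ob (\<lambda>X Y. hm Y X) (\<lambda>g f. f \<bullet> g) un (\<lambda>n. sh (- n))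
    (\<lambda>X Y Z f g. tri Z Y X g f) M"
proof (intro tri_silting.intro tri_silting_axioms.intro dual M_ob, goal_cases)
  case (1 i)
  then show ?case using M_rigid[of i] sh_zero_iff_left[of M M "- i"] M_ob by simp
next
  case (2 P)
  have "sh n X \<in> P" if "X \<in> P" for n X using 2(3)[OF that, of "- n"] by simp
  then show ?case using 2 by (intro M_gen) blast+
qed

text \<open>At \<open>0\<close> the four families are the right perpendicular categories of
  \<open>M[<0]\<close> and \<open>M[>0]\<close>, then the left ones, in this order. Shifting by
  \<open>k\<close> moves the index from \<open>n\<close> to \<open>n + k\<close>.\<close>

definition Rlt :: "int \<Rightarrow> 'o set" where "Rlt n = {X \<in> ob. \<forall>i<n. zero_space (hm (sh i M) X)}"
definition Rgt :: "int \<Rightarrow> 'o set" where "Rgt n = {X \<in> ob. \<forall>i>n. zero_space (hm (sh i M) X)}"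
definition Llt :: "int \<Rightarrow> 'o set" where "Llt n = {X \<in> ob. \<forall>i<n. zero_space (hm X (sh i M))}"
definition Lgt :: "int \<Rightarrow> 'o set" where "Lgt n = {X \<in> ob. \<forall>i>n. zero_space (hm X (sh i M))}"

lemma all_less_uminus: "(\<forall>i<n. P (- i)) \<longleftrightarrow> (\<forall>i>- n. P i)" for n :: int
proof safe
  fix i assume "\<forall>i<n. P (- i)" "- n < i"
  then show "P i" using spec[of "\<lambda>i. i < n \<longrightarrow> P (- i)" "- i"] by simp
qed simp

lemma all_greater_uminus: "(\<forall>i>n. P (- i)) \<longleftrightarrow> (\<forall>i<(- n). P i)" for n :: int
proof safe
  fix i assume "\<forall>i>n. P (- i)" "i < - n"
  then show "P i" using spec[of "\<lambda>i. n < i \<longrightarrow> P (- i)" "- i"] by simp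
qed simp

text \<open>The opposite category swaps left and right and negates shifts, so \<open>lt\<close> and
  \<open>gt\<close> swap as well.\<close>

lemma dual_perp:
  "tri_silting.Rlt ob (\<lambda>X Y. hm Y X) (\<lambda>n. sh (- n)) M n = Lgt (- n)"
  "tri_silting.Rgt ob (\<lambda>X Y. hm Y X) (\<lambda>n. sh (- n)) M n = Llt (- n)"
  "tri_silting.Llt ob (\<lambda>X Y. hm Y X) (\<lambda>n. sh (- n)) M n = Rgt (- n)"
  "tri_silting.Lgt ob (\<lambda>X Y. hm Y X) (\<lambda>n. sh (- n)) M n = Rlt (- n)"
  unfolding tri_silting.Rlt_def[OF silting_dual] tri_silting.Rgt_def[OF silting_dual]
    tri_silting.Llt_def[OF silting_dual] tri_silting.Lgt_def[OF silting_dual]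
    Rlt_def Rgt_def Llt_def Lgt_def
  by (simp_all add: all_less_uminus[where P = "\<lambda>i. zero_space (hm X (sh i M))" for X]
      all_less_uminus[where P = "\<lambda>i. zero_space (hm (sh i M) X)" for X]
      all_greater_uminus[where P = "\<lambda>i. zero_space (hm X (sh i M))" for X]
      all_greater_uminus[where P = "\<lambda>i. zero_space (hm (sh i M) X)" for X])

lemma sh_Lgt:
  assumes "X \<in> Lgt n"
  shows "sh k X \<in> Lgt (n + k)"
  using assms by (auto simp: Lgt_def sh_ob sh_zero_iff M_ob)

lemma sh_Llt:
  assumes "X \<in> Llt n"
  shows "sh k X \<in> Llt (n + k)"
  using assms by (auto simp: Llt_def sh_ob sh_zero_iff M_ob)

lemma sh_Rlt:
  assumes "X \<in> Rlt n"
  shows "sh k X \<in> Rlt (n + k)"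
  using tri_silting.sh_Lgt[OF silting_dual, of X "- n" "- k"] assms by (simp add: dual_perp add.commute)

lemma sh_Rgt:
  assumes "X \<in> Rgt n"
  shows "sh k X \<in> Rgt (n + k)"
  using tri_silting.sh_Llt[OF silting_dual, of X "- n" "- k"] assms by (simp add: dual_perp add.commute)

text \<open>Thick induction for an increasing family compatible with the shift: the objects
  receiving no nonzero map from some \<open>A n\<close> are closed under shifts, extensions and
  retracts. It is used for \<open>Lgt\<close> and for the family of all \<open>M[j]\<close> with
  \<open>j < n\<close>.\<close>

lemma bounded:
  fixes A :: "int \<Rightarrow> 'o set"
  assumes A: "\<And>m n. m \<le> n \<Longrightarrow> A m \<subseteq> A n" "\<And>n k X. X \<in> A n \<Longrightarrow> sh k X \<in> A (n + k)" "\<And>n. A n \<subseteq> ob"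
    and M: "\<exists>n. \<forall>B\<in>A n. zero_space (hm B M)" and Y: "Y \<in> ob"
  shows "\<exists>n. \<forall>B\<in>A n. zero_space (hm B Y)"
proof -
  define P where "P = {Y \<in> ob. \<exists>n. \<forall>B\<in>A n. zero_space (hm B Y)}"
  have Ao: "B \<in> ob" if "B \<in> A n" for B n using A(3) that by blast
  have "P = ob"
  proof (rule M_gen)
    fix k X assume X: "X \<in> P"
    then obtain n where n: "\<forall>B\<in>A n. zero_space (hm B X)" and o: "X \<in> ob" by (auto simp: P_def)
    have "zero_space (hm B (sh k X))" if B: "B \<in> A (n + k)" for B
      using n A(2)[OF B, of "- k"] sh_zero_iff_left[of B X "- k"] Ao[OF B] o by simp
    then show "sh k X \<in> P" using o sh_ob by (auto simp: P_def)
  next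
    fix X Y Z f g assume t: "tri X Y Z f g" and XZ: "X \<in> P" "Z \<in> P"
    then obtain m n where mn: "\<forall>B\<in>A m. zero_space (hm B X)" "\<forall>B\<in>A n. zero_space (hm B Z)"
      by (auto simp: P_def)
    \<comment> \<open>For an extension the smaller of the two bounds works, since \<open>A\<close>
      increases.\<close>
    have "zero_space (hm B Y)" if B: "B \<in> A (min m n)" for B
      using zero_mid[OF t Ao[OF B]] mn A(1)[of "min m n" m] A(1)[of "min m n" n] B by auto
    then show "Y \<in> P" using tri_ob[OF t] by (auto simp: P_def)
  next
    fix X Y i p assume r: "X \<in> ob" "Y \<in> P" "i \<in> carrier (hm X Y)" "p \<in> carrier (hm Y X)" "p \<bullet> i = un X"
    then obtain n where n: "\<forall>B\<in>A n. zero_space (hm B Y)" and Y: "Y \<in> ob" by (auto simp: P_def)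
    have "zero_space (hm B X)" if "B \<in> A n" for B
      using zero_retract[OF r(1) Y Ao[OF that] r(3-5)] n that by blast
    then show "X \<in> P" using r(1) by (auto simp: P_def)
  qed (use M M_ob in \<open>auto simp: P_def\<close>)
  then show ?thesis using Y by (auto simp: P_def)
qed

lemma ex_zero_from_Lgt:
  assumes "Y \<in> ob"
  shows "\<exists>n. \<forall>B\<in>Lgt n. zero_space (hm B Y)"
proof (rule bounded[OF _ _ _ _ assms])
  show "\<exists>n. \<forall>B\<in>Lgt n. zero_space (hm B M)"
  proof (intro exI ballI)
    fix B assume "B \<in> Lgt (- 1)"
    then show "zero_space (hm B M)" using sh_0[OF M_ob] by (auto simp: Lgt_def dest: spec[of _ 0])
  qed
qed (use sh_Lgt in \<open>auto simp: Lgt_def\<close>)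

lemma ex_mem_Rlt:
  assumes "X \<in> ob"
  shows "\<exists>n. X \<in> Rlt n"
proof -
  have "\<exists>n. \<forall>B\<in>{sh j M | j. j < n}. zero_space (hm B X)"
  proof (rule bounded[OF _ _ _ _ assms])
    show "\<exists>n. \<forall>B\<in>{sh j M | j. j < n}. zero_space (hm B M)"
      using M_rigid sh_zero_iff_left M_ob by (intro exI[of _ 0]) auto
    show "sh k B \<in> {sh j M | j. j < n + k}" if B: "B \<in> {sh j M | j. j < n}" for n k B
    proof -
      obtain j where "B = sh j M" "j < n" using B by blast
      then show ?thesis using sh_sh[OF M_ob] by (intro CollectI exI[of _ "k + j"]) auto
    qed
  qed (auto simp: sh_ob M_ob)
  then show ?thesis using assms by (auto simp: Rlt_def)
qed

lemma ex_mem_Lgt: "X \<in> ob \<Longrightarrow> \<exists>n. X \<in> Lgt n"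
  using tri_silting.ex_mem_Rlt[OF silting_dual] unfolding dual_perp by blast

text \<open>Induction on the dimension of Hom(X, M[-n]). If it is zero, \<open>X\<close> lies in the
  next smaller class, where \<open>Q\<close> applies. Otherwise the fibre \<open>X'\<close> of a
  nonzero map to \<open>M[-n]\<close> has smaller dimension, and \<open>M[-n]\<close> has no maps to
  \<open>Y\<close>.\<close>

lemma orthogonal_step:
  assumes Y: "Y \<in> Rlt 1" and Q: "\<And>X. X \<in> Lgt (- int (Suc n)) \<Longrightarrow> zero_space (hm X Y)"
    and X: "X \<in> Lgt (- int n)"
  shows "zero_space (hm X Y)"
  using X
proof (induction "vectorspace.dim K (hm X (sh (- int n) M))" arbitrary: X rule: less_induct)
  case less
  define N where "N = sh (- int n) M"
  have N: "N \<in> ob" by (simp add: N_def sh_ob M_ob)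
  have X: "X \<in> ob" using less.prems by (simp add: Lgt_def)
  have Yo: "Y \<in> ob" using Y by (simp add: Rlt_def)
  show ?case
  proof (cases "zero_space (hm X N)")
    case True
    have "zero_space (hm X (sh i M))" if "i > - int (Suc n)" for i
      using that True less.prems by (cases "i = - int n") (auto simp: N_def Lgt_def)
    then show ?thesis using X by (intro Q) (auto simp: Lgt_def)
  next
    case False
    then obtain x where x: "x \<in> carrier (hm X N)" "x \<noteq> \<zero>\<^bsub>hm X N\<^esub>" using zero_spaceI X N by blast
    then obtain X' a where t: "tri X' X N a x" using tri_fibre X N by blast
    then have X': "X' \<in> ob" and a: "a \<in> carrier (hm X' X)" using tri_ob by blast+
    obtain h where t': "tri (sh (- 1) N) X' X h a" using tri_rot'[OF t] by blast
    \<comment> \<open>Rigidity, as \<open>N[-1]\<close> is \<open>M[-n-1]\<close>. It keeps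
      \<open>X'\<close> in the same class and, at \<open>i = -n\<close>, lets every map
      \<open>X' \<rightarrow> N\<close> extend to \<open>X\<close>.\<close>
    have N1: "zero_space (hm (sh (- 1) N) (sh i M))" if "i \<ge> - int n" for i
      using that M_rigid[of "i + int n + 1"] M_ob
      by (simp add: N_def sh_sh sh_zero_iff algebra_simps)
    have "X' \<in> Lgt (- int n)"
      using zero_mid'[OF t' sh_ob[OF M_ob]] N1 less.prems X' by (auto simp: Lgt_def)
    \<comment> \<open>Composition with \<open>a\<close> maps Hom(X, N) onto Hom(X', N) and kills
      \<open>x\<close>.\<close>
    moreover have "vectorspace.dim K (hm X' N) < vectorspace.dim K (hm X N)"
    proof (rule dim_less_if_surj_not_inj[where t = "\<lambda>u. u \<bullet> a" and v = x])
      show "carrier (hm X' N) \<subseteq> (\<lambda>u. u \<bullet> a) ` carrier (hm X N)"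
        using tri_extend[OF t' N] N1[of "- int n"] by (fastforce simp: N_def)
    qed (use x X N X' a cp_lin_left hm_vs hm_fd tri_cp[OF t] in auto)
    ultimately have "zero_space (hm X' Y)" using less.hyps by (simp add: N_def)
    moreover have "zero_space (hm N Y)" using Y by (simp add: N_def Rlt_def)
    ultimately show ?thesis using zero_mid'[OF t Yo] by simp
  qed
qed

text \<open>\<open>ex_zero_from_Lgt\<close> provides a sufficiently low starting degree, and
  \<open>orthogonal_step\<close> raises the bound back to 0 one degree at a time.\<close>

lemma orthogonal_1:
  assumes X: "X \<in> Lgt 0" and Y: "Y \<in> Rlt 1"
  shows "zero_space (hm X Y)"
proof -
  obtain n where n: "\<forall>B\<in>Lgt n. zero_space (hm B Y)"
    using ex_zero_from_Lgt[of Y] Y unfolding Rlt_def by blast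
  have "\<forall>X\<in>Lgt (- int 0). zero_space (hm X Y)"
  proof (rule inc_induct[of 0 "nat (- n)"])
    show "\<forall>X\<in>Lgt (- int (nat (- n))). zero_space (hm X Y)"
      using n by (auto simp: Lgt_def)
    show "\<forall>X\<in>Lgt (- int k). zero_space (hm X Y)" if "\<forall>X\<in>Lgt (- int (Suc k)). zero_space (hm X Y)" for k
      using orthogonal_step[OF Y] that by blast
  qed simp
  then show ?thesis using X by simp
qed

lemma orthogonal:
  assumes X: "X \<in> Lgt m" and Y: "Y \<in> Rlt n" and "m < n"
  shows "zero_space (hm X Y)"
proof -
  have o: "X \<in> ob" "Y \<in> ob" using X Y by (auto simp: Lgt_def Rlt_def)
  have "sh (- m) X \<in> Lgt 0" using sh_Lgt[OF X, of "- m"] by simp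
  moreover have "sh (- m) Y \<in> Rlt 1"
    using sh_Rlt[OF Y, of "- m"] \<open>m < n\<close> by (auto simp: Rlt_def)
  ultimately have "zero_space (hm (sh (- m) X) (sh (- m) Y))" by (rule orthogonal_1)
  then show ?thesis using sh_zero o by simp
qed

section \<open>The perfect pairing built from copies of \<open>M\<close>\<close>

text \<open>Starting from a zero object, one copy of \<open>M\<close> is added for each functional
  in \<open>L\<close>. On the direct sum \<open>W\<close> of \<open>C\<close> and \<open>M\<close>,
  the new functional uses \<open>\<xi>\<close> on the first component and \<open>l\<close> on the
  second, so the inclusion \<open>j\<close> realises \<open>l\<close>.\<close>

lemma ex_pairing_spanning:
  assumes X: "X \<in> ob" and L: "finite L" "L \<subseteq> module_hom K (hm X M) (scalars K)"
  shows "\<exists>C\<in>Rlt 0. \<exists>\<xi>\<in>module_hom K (hm X C) (scalars K).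
    \<forall>l\<in>L. \<exists>z\<in>carrier (hm M C). \<forall>f\<in>carrier (hm X M). \<xi> (z \<bullet> f) = l f"
  using L
proof (induction L rule: finite_induct)
  case empty
  obtain Z where Z: "Z \<in> ob" "\<forall>X\<in>ob. zero_space (hm X Z) \<and> zero_space (hm Z X)"
    using ex_zero by blast
  then have "Z \<in> Rlt 0" by (auto simp: Rlt_def sh_ob M_ob)
  moreover have "(\<lambda>_. \<zero>\<^bsub>K\<^esub>) \<in> module_hom K (hm X Z) (scalars K)" by (simp add: dual_iff)
  ultimately show ?case by blast
next
  case (insert l L)
  then obtain C \<xi> where C: "C \<in> Rlt 0" and xi: "\<xi> \<in> module_hom K (hm X C) (scalars K)"
    and L: "\<forall>l\<in>L. \<exists>z\<in>carrier (hm M C). \<forall>f\<in>carrier (hm X M). \<xi> (z \<bullet> f) = l f" by auto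
  have l: "l \<in> module_hom K (hm X M) (scalars K)" using insert.prems by simp
  have Co: "C \<in> ob" using C by (simp add: Rlt_def)
  obtain W i j p q where W: "W \<in> ob" and i: "i \<in> carrier (hm C W)" and j: "j \<in> carrier (hm M W)"
    and p: "p \<in> carrier (hm W C)" and q: "q \<in> carrier (hm W M)"
    and eqs: "p \<bullet> i = un C" "q \<bullet> j = un M" "p \<bullet> j = \<zero>\<^bsub>hm M C\<^esub>" "q \<bullet> i = \<zero>\<^bsub>hm C M\<^esub>"
      "(i \<bullet> p) \<oplus>\<^bsub>hm W W\<^esub> (j \<bullet> q) = un W"
    using ex_sum[OF Co M_ob] by blast
  \<comment> \<open>The identity of \<open>W\<close> splits through \<open>C\<close> and
    \<open>M\<close>, so a map into \<open>W\<close> is zero when both components are.\<close>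
  have "W \<in> Rlt 0"
    unfolding Rlt_def
  proof (intro CollectI conjI allI impI W)
    fix k :: int assume k: "k < 0"
    define V where "V = sh k M"
    have V: "V \<in> ob" by (simp add: V_def sh_ob M_ob)
    have z: "zero_space (hm V C)" using k C by (simp add: V_def Rlt_def)
    have z': "zero_space (hm V M)"
      using k M_rigid[of "- k"] M_ob by (simp add: V_def sh_zero_iff_left)
    have "zero_space (hm V W)"
    proof (rule zero_spaceI[OF V W])
      fix u assume u: "u \<in> carrier (hm V W)"
      have pu: "p \<bullet> u = \<zero>\<^bsub>hm V C\<^esub>"
        using z cp_in[OF V W Co u p] unfolding zero_space_def by blast
      have qu: "q \<bullet> u = \<zero>\<^bsub>hm V M\<^esub>"
        using z' cp_in[OF V W M_ob u q] unfolding zero_space_def by blast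
      have "u = ((i \<bullet> p) \<oplus>\<^bsub>hm W W\<^esub> (j \<bullet> q)) \<bullet> u" using cp_un_left[OF V W u] eqs(5) by simp
      also have "\<dots> = ((i \<bullet> p) \<bullet> u) \<oplus>\<^bsub>hm V W\<^esub> ((j \<bullet> q) \<bullet> u)"
        by (rule module_hom_add[OF cp_lin_left[OF V W W u] cp_in[OF W Co W p i] cp_in[OF W M_ob W q j]])
      also have "(i \<bullet> p) \<bullet> u = \<zero>\<^bsub>hm V W\<^esub>"
        using cp_assoc[OF V W Co W u p i] pu cp_zero_right[OF V Co W i] by simp
      also have "(j \<bullet> q) \<bullet> u = \<zero>\<^bsub>hm V W\<^esub>"
        using cp_assoc[OF V W M_ob W u q j] qu cp_zero_right[OF V M_ob W j] by simp
      also have "\<zero>\<^bsub>hm V W\<^esub> \<oplus>\<^bsub>hm V W\<^esub> \<zero>\<^bsub>hm V W\<^esub> = \<zero>\<^bsub>hm V W\<^esub>"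
        using hm_vs[OF V W] zero_in[OF V W]
        by (meson abelian_groupE(5) module.axioms(2) vectorspace.axioms(1))
      finally show "u = \<zero>\<^bsub>hm V W\<^esub>" .
    qed
    then show "zero_space (hm (sh k M) W)" by (simp add: V_def)
  qed
  moreover define \<xi>' where "\<xi>' g = \<xi> (p \<bullet> g) \<oplus>\<^bsub>K\<^esub> l (q \<bullet> g)" for g
  have "\<xi>' \<in> module_hom K (hm X W) (scalars K)"
    unfolding \<xi>'_def
    by (rule dual_add[OF field_axioms dual_comp[OF cp_lin_right xi] dual_comp[OF cp_lin_right l]])
      (fact X W Co M_ob p q)+
  moreover have "\<exists>z\<in>carrier (hm M W). \<forall>f\<in>carrier (hm X M). \<xi>' (z \<bullet> f) = m f" if m: "m \<in> insert l L" for m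
  proof (cases "m = l")
    case True
    have "\<xi>' (j \<bullet> f) = l f" if f: "f \<in> carrier (hm X M)" for f
    proof -
      have "p \<bullet> (j \<bullet> f) = \<zero>\<^bsub>hm X C\<^esub>"
        using cp_assoc[OF X M_ob W Co f j p] eqs(3) cp_zero_left[OF X M_ob Co f] by simp
      moreover have "q \<bullet> (j \<bullet> f) = f"
        using cp_assoc[OF X M_ob W M_ob f j q] eqs(2) cp_un_left[OF X M_ob f] by simp
      ultimately show ?thesis using dual_zero[OF hm_vs[OF X Co] xi] dual_closed[OF l f] by (simp add: \<xi>'_def)
    qed
    then show ?thesis using j True by blast
  next
    case False
    then obtain z where z: "z \<in> carrier (hm M C)" "\<forall>f\<in>carrier (hm X M). \<xi> (z \<bullet> f) = m f"
      using L m by blast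
    \<comment> \<open>Functionals realised earlier survive along \<open>i\<close>, whose component
      in the new copy of \<open>M\<close> is zero.\<close>
    have "\<xi>' ((i \<bullet> z) \<bullet> f) = m f" if f: "f \<in> carrier (hm X M)" for f
    proof -
      have zf: "z \<bullet> f \<in> carrier (hm X C)" by (rule cp_in[OF X M_ob Co f z(1)])
      have "(i \<bullet> z) \<bullet> f = i \<bullet> (z \<bullet> f)" by (rule cp_assoc[OF X M_ob Co W f z(1) i])
      moreover have "p \<bullet> (i \<bullet> (z \<bullet> f)) = z \<bullet> f"
        using cp_assoc[OF X Co W Co zf i p] eqs(1) cp_un_left[OF X Co zf] by simp
      moreover have "q \<bullet> (i \<bullet> (z \<bullet> f)) = \<zero>\<^bsub>hm X M\<^esub>"
        using cp_assoc[OF X Co W M_ob zf i q] eqs(4) cp_zero_left[OF X Co M_ob zf] by simp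
      ultimately show ?thesis
        using dual_zero[OF hm_vs[OF X M_ob] l] dual_closed[OF xi zf] z(2) f by (simp add: \<xi>'_def)
    qed
    then show ?thesis using cp_in[OF M_ob Co W z(1) i] by blast
  qed
  ultimately show ?case by blast
qed

text \<open>The cone of a nonzero map \<open>z : M \<rightarrow> C\<close> in the kernel of the
  pairing has a smaller Hom(M, C), and the elements of Hom(X, M) are still separated.\<close>

lemma ex_pairing_reduce:
  assumes X: "X \<in> Lgt 0" and C: "C \<in> Rlt 0" "\<xi> \<in> module_hom K (hm X C) (scalars K)"
    and nd: "\<And>f. \<lbrakk>f \<in> carrier (hm X M); f \<noteq> \<zero>\<^bsub>hm X M\<^esub>\<rbrakk> \<Longrightarrow> \<exists>z\<in>carrier (hm M C). \<xi> (z \<bullet> f) \<noteq> \<zero>\<^bsub>K\<^esub>"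
  shows "\<exists>C\<in>Rlt 0. \<exists>\<xi>\<in>module_hom K (hm X C) (scalars K).
    (\<forall>f\<in>carrier (hm X M). f \<noteq> \<zero>\<^bsub>hm X M\<^esub> \<longrightarrow> (\<exists>z\<in>carrier (hm M C). \<xi> (z \<bullet> f) \<noteq> \<zero>\<^bsub>K\<^esub>)) \<and>
    (\<forall>z\<in>carrier (hm M C). z \<noteq> \<zero>\<^bsub>hm M C\<^esub> \<longrightarrow> (\<exists>f\<in>carrier (hm X M). \<xi> (z \<bullet> f) \<noteq> \<zero>\<^bsub>K\<^esub>))"
  using C nd
proof (induction "vectorspace.dim K (hm M C)" arbitrary: C \<xi> rule: less_induct)
  case less
  have Xo: "X \<in> ob" and Co: "C \<in> ob" using X less.prems(1) by (auto simp: Lgt_def Rlt_def)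
  note xi = less.prems(2)
  show ?case
  proof (cases "\<forall>z\<in>carrier (hm M C). z \<noteq> \<zero>\<^bsub>hm M C\<^esub> \<longrightarrow> (\<exists>f\<in>carrier (hm X M). \<xi> (z \<bullet> f) \<noteq> \<zero>\<^bsub>K\<^esub>)")
    case True
    then show ?thesis using less.prems by blast
  next
    case False
    then obtain z where z: "z \<in> carrier (hm M C)" "z \<noteq> \<zero>\<^bsub>hm M C\<^esub>"
      and ker: "\<And>f. f \<in> carrier (hm X M) \<Longrightarrow> \<xi> (z \<bullet> f) = \<zero>\<^bsub>K\<^esub>" by blast
    obtain D c where t: "tri M C D z c" using tri_cone[OF M_ob Co z(1)] by blast
    then have Do: "D \<in> ob" and c: "c \<in> carrier (hm C D)" using tri_ob by blast+
    obtain h where t': "tri C D (sh 1 M) c h" using tri_rot[OF t] by blast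
    \<comment> \<open>The cone is an extension of \<open>M[1]\<close> by \<open>C\<close>, and
      Hom(M[i], M[1]) vanishes for \<open>i < 0\<close> by rigidity.\<close>
    have "zero_space (hm (sh i M) D)" if "i < 0" for i
      using that zero_mid[OF t' sh_ob[OF M_ob], of i] less.prems(1) M_rigid[of "1 - i"]
      by (simp add: Rlt_def sh_zero_iff M_ob)
    then have "D \<in> Rlt 0" using Do by (simp add: Rlt_def)
    moreover
    \<comment> \<open>Composition with \<open>c\<close> is onto since \<open>X\<close> has no maps
      to \<open>M[1]\<close>; its kernel consists of maps factoring through \<open>z\<close>, where
      \<open>\<xi>\<close> vanishes.\<close>
    have "\<exists>\<xi>'\<in>module_hom K (hm X D) (scalars K). \<forall>g\<in>carrier (hm X C). \<xi>' (c \<bullet> g) = \<xi> g"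
    proof (rule functional_descends[OF hm_vs hm_vs cp_lin_right _ xi])
      show "carrier (hm X D) \<subseteq> (\<bullet>) c ` carrier (hm X C)"
        using tri_lift[OF t' Xo] X by (fastforce simp: Lgt_def)
      fix g assume g: "g \<in> carrier (hm X C)" "c \<bullet> g = \<zero>\<^bsub>hm X D\<^esub>"
      then show "\<xi> g = \<zero>\<^bsub>K\<^esub>" using tri_exact[OF t Xo] ker by metis
    qed (fact Xo Co Do c)+
    then obtain \<xi>' where xi': "\<xi>' \<in> module_hom K (hm X D) (scalars K)"
      and eq: "\<forall>g\<in>carrier (hm X C). \<xi>' (c \<bullet> g) = \<xi> g" by blast
    \<comment> \<open>Composing with \<open>c\<close> preserves the values of the pairing, so
      witnesses for \<open>C\<close> give witnesses for \<open>D\<close>.\<close>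
    moreover have "\<exists>w\<in>carrier (hm M D). \<xi>' (w \<bullet> f) \<noteq> \<zero>\<^bsub>K\<^esub>"
      if f: "f \<in> carrier (hm X M)" "f \<noteq> \<zero>\<^bsub>hm X M\<^esub>" for f
    proof -
      obtain w where w: "w \<in> carrier (hm M C)" "\<xi> (w \<bullet> f) \<noteq> \<zero>\<^bsub>K\<^esub>" using less.prems(3) f by blast
      then have "\<xi>' ((c \<bullet> w) \<bullet> f) \<noteq> \<zero>\<^bsub>K\<^esub>"
        using eq cp_assoc[of X M C D f w c] cp_in[of X M C f w] Xo M_ob Co Do f c by simp
      then show ?thesis using cp_in[of M C D w c] M_ob Co Do w c by blast
    qed
    moreover have "vectorspace.dim K (hm M D) < vectorspace.dim K (hm M C)"
    proof (rule dim_less_if_surj_not_inj[where t = "(\<bullet>) c" and v = z])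
      show "carrier (hm M D) \<subseteq> (\<bullet>) c ` carrier (hm M C)"
        using tri_lift[OF t' M_ob M_rigid] by fastforce
    qed (use z M_ob Co Do c cp_lin_right hm_vs hm_fd tri_cp[OF t] in auto)
    ultimately show ?thesis using less.hyps by blast
  qed
qed

lemma ex_perfect_pairing:
  assumes X: "X \<in> Lgt 0"
  shows "\<exists>C\<in>Rlt 0. \<exists>\<xi>\<in>module_hom K (hm X C) (scalars K).
    (\<forall>f\<in>carrier (hm X M). f \<noteq> \<zero>\<^bsub>hm X M\<^esub> \<longrightarrow> (\<exists>z\<in>carrier (hm M C). \<xi> (z \<bullet> f) \<noteq> \<zero>\<^bsub>K\<^esub>)) \<and>
    (\<forall>z\<in>carrier (hm M C). z \<noteq> \<zero>\<^bsub>hm M C\<^esub> \<longrightarrow> (\<exists>f\<in>carrier (hm X M). \<xi> (z \<bullet> f) \<noteq> \<zero>\<^bsub>K\<^esub>))"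
proof -
  have Xo: "X \<in> ob" using X by (simp add: Lgt_def)
  obtain L where L: "finite L" "L \<subseteq> module_hom K (hm X M) (scalars K)"
    "\<forall>f\<in>carrier (hm X M). (\<forall>l\<in>L. l f = \<zero>\<^bsub>K\<^esub>) \<longrightarrow> f = \<zero>\<^bsub>hm X M\<^esub>"
    using ex_separating_functionals[OF hm_vs hm_fd] Xo M_ob by metis
  obtain C \<xi> where C: "C \<in> Rlt 0" "\<xi> \<in> module_hom K (hm X C) (scalars K)"
    "\<forall>l\<in>L. \<exists>z\<in>carrier (hm M C). \<forall>f\<in>carrier (hm X M). \<xi> (z \<bullet> f) = l f"
    using ex_pairing_spanning[OF Xo L(1,2)] by blast
  have "\<exists>z\<in>carrier (hm M C). \<xi> (z \<bullet> f) \<noteq> \<zero>\<^bsub>K\<^esub>"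
    if f: "f \<in> carrier (hm X M)" "f \<noteq> \<zero>\<^bsub>hm X M\<^esub>" for f
  proof -
    obtain l where "l \<in> L" "l f \<noteq> \<zero>\<^bsub>K\<^esub>" using L(3) f by blast
    then show ?thesis using C(3) f(1) by metis
  qed
  then show ?thesis by (rule ex_pairing_reduce[OF X C(1,2)])
qed

end

section \<open>Relative Serre duality and truncations\<close>

text \<open>The Serre functor and its inverse enter as the existence of partners in
  \<open>fd\<close>, which keeps the locale self-dual.\<close>

locale tri_serre = tri_silting K ob hm cp un sh tri M
  for K :: "'a ring" and ob :: "'o set" and hm :: "'o \<Rightarrow> 'o \<Rightarrow> ('a, 'm) module"
    and cp (infixl \<open>\<bullet>\<close> 70) and un sh tri M +
  fixes fd :: "'o set"
  assumes fd_ob: "fd \<subseteq> ob" and fd_ne: "fd \<noteq> {}"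
    and fd_sh: "X \<in> fd \<Longrightarrow> sh n X \<in> fd"
    and fd_ext: "\<lbrakk>tri X Y Z f g; X \<in> fd; Z \<in> fd\<rbrakk> \<Longrightarrow> Y \<in> fd"
    and fd_retract: "\<lbrakk>X \<in> ob; Y \<in> fd; i \<in> carrier (hm X Y); p \<in> carrier (hm Y X); p \<bullet> i = un X\<rbrakk>
      \<Longrightarrow> X \<in> fd"
    and serre_right: "H \<in> fd \<Longrightarrow> \<exists>Z\<in>fd. \<exists>t. serre_pair H Z t"
    and serre_left: "Z \<in> fd \<Longrightarrow> \<exists>H\<in>fd. \<exists>t. serre_pair H Z t"
begin

lemma serre_dual: "tri_serre K ob (\<lambda>X Y. hm Y X) (\<lambda>g f. f \<bullet> g) un (\<lambda>n. sh (- n))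
    (\<lambda>X Y Z f g. tri Z Y X g f) M fd"
proof (intro tri_serre.intro tri_serre_axioms.intro silting_dual, unfold serre_pair_dual, goal_cases)
  case (5 X Y i p)
  then show ?case using fd_retract[of X Y p i] by blast
qed (use fd_ob fd_ne fd_sh fd_ext serre_left serre_right in blast)+

text \<open>Condition (a) in terms of truncation triangles. The offset in \<open>Rgt (n - 1)\<close>
  comes from the shift by -1 in the definition of a t-structure; the orthogonality clauses are
  recovered in \<open>right_perp_eq\<close>.\<close>

definition right_cond :: bool
  where "right_cond \<longleftrightarrow> Rgt 0 \<subseteq> fd \<and>
    (\<forall>n. \<forall>X\<in>ob. \<exists>X'\<in>Rlt n. \<exists>X''\<in>Rgt (n - 1). \<exists>f g. tri X' X X'' f g)"

definition left_cond :: bool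
  where "left_cond \<longleftrightarrow> Llt 0 \<subseteq> fd \<and>
    (\<forall>n. \<forall>X\<in>ob. \<exists>X'\<in>Llt n. \<exists>X''\<in>Lgt (n - 1). \<exists>f g. tri X' X X'' f g)"

section \<open>Approximation in the top degree\<close>

text \<open>Vanishing of Hom(Y, M[i]) is read off the long exact sequence: injectivity of
  composition with \<open>h\<close> on Hom(X, M) settles \<open>i = 0\<close>, surjectivity onto
  Hom(H, M) settles \<open>i = 1\<close>, and larger \<open>i\<close> follow from the vanishing for
  \<open>X\<close> and \<open>H\<close>.\<close>

lemma ex_heart_approximation:
  assumes R: "right_cond" and X: "X \<in> Lgt 0"
  shows "\<exists>H\<in>fd. \<exists>Y\<in>Lgt (- 1). \<exists>h c. tri H X Y h c \<and> (\<forall>i. i \<noteq> 0 \<longrightarrow> zero_space (hm H (sh i M)))"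
proof -
  have Xo: "X \<in> ob" using X by (simp add: Lgt_def)
  obtain C \<xi> where C: "C \<in> Rlt 0" and xi: "\<xi> \<in> module_hom K (hm X C) (scalars K)"
    and nd: "\<And>f. f \<in> carrier (hm X M) \<Longrightarrow> f \<noteq> \<zero>\<^bsub>hm X M\<^esub> \<Longrightarrow> \<exists>z\<in>carrier (hm M C). \<xi> (z \<bullet> f) \<noteq> \<zero>\<^bsub>K\<^esub>"
      "\<And>z. z \<in> carrier (hm M C) \<Longrightarrow> z \<noteq> \<zero>\<^bsub>hm M C\<^esub> \<Longrightarrow> \<exists>f\<in>carrier (hm X M). \<xi> (z \<bullet> f) \<noteq> \<zero>\<^bsub>K\<^esub>"
    using ex_perfect_pairing[OF X] by blast
  have Co: "C \<in> ob" using C by (simp add: Rlt_def)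
  \<comment> \<open>Truncation at \<open>n = 1\<close>, so that the right-hand piece lies in
    \<open>Rgt 0\<close> and hence in \<open>fd\<close>.\<close>
  obtain C' Z a q where C': "C' \<in> Rlt 1" and Z: "Z \<in> Rgt 0" and t: "tri C' C Z a q"
    using R Co unfolding right_cond_def by (metis diff_self)
  have Zfd: "Z \<in> fd" using R Z unfolding right_cond_def by blast
  have C'o: "C' \<in> ob" and Zo: "Z \<in> ob" and q: "q \<in> carrier (hm C Z)" and a: "a \<in> carrier (hm C' C)"
    using tri_ob[OF t] by blast+
  obtain r where t': "tri C Z (sh 1 C') q r" using tri_rot[OF t] by blast
  have C'1: "sh 1 C' \<in> Rlt 2" using sh_Rlt[OF C', of 1] by simp
  \<comment> \<open>Positive \<open>i\<close> are excluded by \<open>Rgt 0\<close>; for negative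
    \<open>i\<close>, \<open>Z\<close> is an extension of \<open>C'[1]\<close> by
    \<open>C\<close>.\<close>
  have ZM: "zero_space (hm (sh i M) Z)" if "i \<noteq> 0" for i
  proof (cases "i > 0")
    case False
    then show ?thesis
      using zero_mid[OF t' sh_ob[OF M_ob], of i] C C'1 that by (auto simp: Rlt_def)
  qed (use Z in \<open>simp add: Rgt_def\<close>)
  \<comment> \<open>Orthogonality makes composition with \<open>q\<close> a bijection from Hom(X, C)
    to Hom(X, Z), so \<open>\<xi>\<close> can be moved to \<open>Z\<close>.\<close>
  have XC': "zero_space (hm X C')" "zero_space (hm X (sh 1 C'))"
    using orthogonal[OF X C'] orthogonal[OF X C'1] by simp_all
  have MC': "zero_space (hm M C')" "zero_space (hm M (sh 1 C'))"
    using C' C'1 sh_0[OF M_ob] by (auto simp: Rlt_def dest!: spec[of _ "0 :: int"])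
  have "\<exists>\<xi>'\<in>module_hom K (hm X Z) (scalars K). \<forall>g\<in>carrier (hm X C). \<xi>' (q \<bullet> g) = \<xi> g"
  proof (rule functional_descends[OF hm_vs hm_vs cp_lin_right _ xi])
    show "carrier (hm X Z) \<subseteq> (\<bullet>) q ` carrier (hm X C)"
      using tri_lift[OF t' Xo XC'(2)] by fastforce
    fix g assume g: "g \<in> carrier (hm X C)" "q \<bullet> g = \<zero>\<^bsub>hm X Z\<^esub>"
    then obtain v where "v \<in> carrier (hm X C')" "g = a \<bullet> v" using tri_exact[OF t Xo] by blast
    then have "g = \<zero>\<^bsub>hm X C\<^esub>"
      using XC'(1) cp_zero_right[OF Xo C'o Co a] by (simp add: zero_space_def)
    then show "\<xi> g = \<zero>\<^bsub>K\<^esub>" using dual_zero[OF hm_vs[OF Xo Co] xi] by simp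
  qed (fact Xo Co Zo q)+
  then obtain \<xi>' where xi': "\<xi>' \<in> module_hom K (hm X Z) (scalars K)"
    and eq: "\<And>g. g \<in> carrier (hm X C) \<Longrightarrow> \<xi>' (q \<bullet> g) = \<xi> g" by blast
  have eq': "\<xi>' ((q \<bullet> z) \<bullet> f) = \<xi> (z \<bullet> f)" if "z \<in> carrier (hm M C)" "f \<in> carrier (hm X M)" for z f
    using eq[OF cp_in[OF Xo M_ob Co that(2,1)]] cp_assoc[OF Xo M_ob Co Zo that(2,1) q] by simp
  have nd1: "\<exists>w\<in>carrier (hm M Z). \<xi>' (w \<bullet> f) \<noteq> \<zero>\<^bsub>K\<^esub>"
    if f: "f \<in> carrier (hm X M)" "f \<noteq> \<zero>\<^bsub>hm X M\<^esub>" for f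
    using nd(1)[OF f] eq' f(1) cp_in[OF M_ob Co Zo _ q] by metis
  have nd2: "\<exists>f\<in>carrier (hm X M). \<xi>' (w \<bullet> f) \<noteq> \<zero>\<^bsub>K\<^esub>"
    if w: "w \<in> carrier (hm M Z)" "w \<noteq> \<zero>\<^bsub>hm M Z\<^esub>" for w
  proof -
    obtain z where z: "z \<in> carrier (hm M C)" "w = q \<bullet> z"
      using tri_lift[OF t' M_ob MC'(2) w(1)] by blast
    then have "z \<noteq> \<zero>\<^bsub>hm M C\<^esub>" using w(2) cp_zero_right[OF M_ob Co Zo q] by blast
    then show ?thesis using nd(2)[OF z(1)] eq' z by metis
  qed
  \<comment> \<open>\<open>H\<close> is the inverse Serre functor applied to \<open>Z\<close>; the
    map \<open>h\<close> below represents \<open>\<xi>'\<close> through the trace form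
    \<open>t\<close>.\<close>
  obtain H t where Hfd: "H \<in> fd" and s: "serre_pair H Z t" using serre_left[OF Zfd] by blast
  have Ho: "H \<in> ob" using Hfd fd_ob by blast
  have tl: "t \<in> module_hom K (hm H Z) (scalars K)" using s by (simp add: serre_pair_def)
  obtain h where h: "h \<in> carrier (hm H X)" and xi_t: "\<forall>g\<in>carrier (hm X Z). \<xi>' g = t (g \<bullet> h)"
    using s Xo xi' unfolding serre_pair_def by blast
  have HM: "zero_space (hm H (sh i M))" if "i \<noteq> 0" for i
    using serre_zero[OF s Ho Zo sh_ob[OF M_ob] ZM[OF that]] .
  have xi_th: "\<xi>' (z \<bullet> f) = t (z \<bullet> (f \<bullet> h))" if "z \<in> carrier (hm M Z)" "f \<in> carrier (hm X M)" for z f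
    using xi_t cp_in[OF Xo M_ob Zo that(2,1)] cp_assoc[OF Ho Xo M_ob Zo h that(2,1)] by simp
  \<comment> \<open>A nonzero \<open>f\<close> is detected by
    \<open>\<xi>' (w \<bullet> f) = t (w \<bullet> (f \<bullet> h))\<close>, so
    \<open>f \<bullet> h\<close> cannot vanish.\<close>
  have inj: "f = \<zero>\<^bsub>hm X M\<^esub>" if f: "f \<in> carrier (hm X M)" "f \<bullet> h = \<zero>\<^bsub>hm H M\<^esub>" for f
  proof (rule ccontr)
    assume "f \<noteq> \<zero>\<^bsub>hm X M\<^esub>"
    then obtain w where w: "w \<in> carrier (hm M Z)" "\<xi>' (w \<bullet> f) \<noteq> \<zero>\<^bsub>K\<^esub>" using nd1 f by blast
    then show False
      using xi_th[OF w(1) f(1)] f(2) cp_zero_right[OF Ho M_ob Zo w(1)] dual_zero[OF hm_vs[OF Ho Zo] tl]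
      by simp
  qed
  \<comment> \<open>Through \<open>t\<close>, \<open>u\<close> yields a functional on Hom(M, Z). The
    perfect pairing represents it by some \<open>f\<close>, and the trace form then identifies
    \<open>u\<close> with \<open>f \<bullet> h\<close>.\<close>
  have surj: "\<exists>f\<in>carrier (hm X M). u = f \<bullet> h" if u: "u \<in> carrier (hm H M)" for u
  proof -
    have "\<exists>f\<in>carrier (hm X M). \<forall>z\<in>carrier (hm M Z). t (z \<bullet> u) = \<xi>' (z \<bullet> f)"
    proof (rule functional_representable[OF hm_vs[OF Xo M_ob] hm_vs[OF M_ob Zo] hm_fd[OF Xo M_ob]])
      show "(\<lambda>f. \<xi>' (z \<bullet> f)) \<in> module_hom K (hm X M) (scalars K)" if "z \<in> carrier (hm M Z)" for z
        by (rule dual_comp[OF cp_lin_right[OF Xo M_ob Zo that] xi'])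
      show "(\<lambda>z. \<xi>' (z \<bullet> f)) \<in> module_hom K (hm M Z) (scalars K)" if "f \<in> carrier (hm X M)" for f
        by (rule dual_comp[OF cp_lin_left[OF Xo M_ob Zo that] xi'])
      show "(\<lambda>z. t (z \<bullet> u)) \<in> module_hom K (hm M Z) (scalars K)"
        by (rule dual_comp[OF cp_lin_left[OF Ho M_ob Zo u] tl])
    qed (use nd2 in blast)
    then obtain f where f: "f \<in> carrier (hm X M)" "\<forall>z\<in>carrier (hm M Z). t (z \<bullet> u) = \<xi>' (z \<bullet> f)"
      by blast
    have "u = f \<bullet> h"
      by (rule eq_if_pairing_eq[OF s Ho M_ob u cp_in[OF Ho Xo M_ob h f(1)]]) (use f xi_th in simp)
    then show ?thesis using f(1) by blast
  qed
  obtain Y c where T: "tri H X Y h c" using tri_cone[OF Ho Xo h] by blast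
  then have Yo: "Y \<in> ob" and c: "c \<in> carrier (hm X Y)" using tri_ob by blast+
  obtain d where T1: "tri X Y (sh 1 H) c d" using tri_rot[OF T] by blast
  obtain e where T2: "tri (sh (- 1) Y) H X e h" using tri_rot'[OF T] by blast
  obtain e' where T3: "tri (sh (- 1) X) (sh (- 1) Y) H e' e" using tri_rot'[OF T2] by blast
  have Y1o: "sh (- 1) Y \<in> ob" and e: "e \<in> carrier (hm (sh (- 1) Y) H)" using tri_ob[OF T2] by blast+
  have "zero_space (hm Y (sh i M))" if i: "i > - 1" for i
  proof -
    consider "i > 1" | "i = 1" | "i = 0" using i by linarith
    then show ?thesis
    proof cases
      case 1
      then show ?thesis
        using zero_mid'[OF T1 sh_ob[OF M_ob], of i] X HM[of "i - 1"] Ho M_ob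
        by (simp add: Lgt_def sh_zero_iff)
    next
      case 2
      \<comment> \<open>Hom(X[-1], M) vanishes with Hom(X, M[1]), so a map
        \<open>Y[-1] \<rightarrow> M\<close> factors through \<open>e\<close>; by surjectivity it
        then factors through \<open>h \<bullet> e\<close>, which is zero.\<close>
      have "zero_space (hm (sh (- 1) Y) M)"
      proof (rule zero_spaceI[OF Y1o M_ob])
        fix v assume v: "v \<in> carrier (hm (sh (- 1) Y) M)"
        have "zero_space (hm (sh (- 1) X) M)"
          using X Xo M_ob by (simp add: sh_zero_iff_left Lgt_def)
        then obtain w where w: "w \<in> carrier (hm H M)" "v = w \<bullet> e"
          using tri_extend[OF T3 M_ob _ v] by blast
        then obtain f where f: "f \<in> carrier (hm X M)" "w = f \<bullet> h" using surj by blast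
        then have "v = f \<bullet> (h \<bullet> e)" using w cp_assoc[OF Y1o Ho Xo M_ob e h f(1)] by simp
        then show "v = \<zero>\<^bsub>hm (sh (- 1) Y) M\<^esub>"
          using tri_cp[OF T2] cp_zero_right[OF Y1o Xo M_ob f(1)] by simp
      qed
      then show ?thesis using 2 Yo M_ob by (simp add: sh_zero_iff_left)
    next
      case 3
      \<comment> \<open>By injectivity a map \<open>Y \<rightarrow> M\<close> dies on
        \<open>X\<close>, so it comes from \<open>H[1]\<close>, which has no maps to
        \<open>M\<close>.\<close>
      have "zero_space (hm Y M)"
      proof (rule zero_spaceI[OF Yo M_ob])
        fix v assume v: "v \<in> carrier (hm Y M)"
        have vc: "v \<bullet> c \<in> carrier (hm X M)" by (rule cp_in[OF Xo Yo M_ob c v])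
        have "(v \<bullet> c) \<bullet> h = \<zero>\<^bsub>hm H M\<^esub>"
          using cp_assoc[OF Ho Xo Yo M_ob h c v] tri_cp[OF T] cp_zero_right[OF Ho Yo M_ob v] by simp
        then have "v \<bullet> c = \<zero>\<^bsub>hm X M\<^esub>" by (rule inj[OF vc])
        then obtain w where w: "w \<in> carrier (hm (sh 1 H) M)" "v = w \<bullet> d"
          using tri_exact'[OF T1 M_ob v] by blast
        have "zero_space (hm (sh 1 H) M)" using HM[of "- 1"] Ho M_ob by (simp add: sh_zero_iff_left)
        then have "w = \<zero>\<^bsub>hm (sh 1 H) M\<^esub>" using w by (simp add: zero_space_def)
        then show "v = \<zero>\<^bsub>hm Y M\<^esub>"
          using w cp_zero_left[OF Yo sh_ob[OF Ho] M_ob] tri_ob[OF T1] by simp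
      qed
      then show ?thesis using 3 sh_0[OF M_ob] by simp
    qed
  qed
  then have "Y \<in> Lgt (- 1)" using Yo by (simp add: Lgt_def)
  then show ?thesis using Hfd T HM by blast
qed

text \<open>A zero object is a retract of any object, in particular of one in
  \<open>fd\<close>.\<close>

lemma zero_in_fd:
  assumes Z: "Z \<in> ob" "\<forall>X\<in>ob. zero_space (hm X Z) \<and> zero_space (hm Z X)"
  shows "Z \<in> fd"
proof -
  obtain Y where Y: "Y \<in> fd" using fd_ne by blast
  have Yo: "Y \<in> ob" using Y fd_ob by blast
  have i: "\<zero>\<^bsub>hm Z Y\<^esub> \<in> carrier (hm Z Y)" "\<zero>\<^bsub>hm Y Z\<^esub> \<in> carrier (hm Y Z)"
    using zero_in Z Yo by blast+
  have "\<zero>\<^bsub>hm Y Z\<^esub> \<bullet> \<zero>\<^bsub>hm Z Y\<^esub> = un Z"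
    using cp_in[OF Z(1) Yo Z(1) i] un_in[OF Z(1)] bspec[OF Z(2) Z(1)] by (simp add: zero_space_def)
  then show ?thesis by (rule fd_retract[OF Z(1) Y i])
qed

section \<open>Left truncations and the equivalence of the two conditions\<close>

text \<open>Each approximation in the top degree lowers the bound by one, and the pieces are glued
  by the octahedral axiom. With the offset in \<open>int n - 1\<close>, the case
  \<open>n = 0\<close> is that of \<open>X\<close> in \<open>Lgt (- 1)\<close>, whose left piece is
  a zero object.\<close>

lemma ex_left_truncation_bounded:
  assumes R: "right_cond"
  shows "X \<in> Lgt (int n - 1) \<Longrightarrow>
    \<exists>X'\<in>Llt 0 \<inter> fd. \<exists>X''\<in>Lgt (- 1). \<exists>f g. tri X' X X'' f g"
proof (induction n arbitrary: X)
  case 0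
  have Xo: "X \<in> ob" using 0 by (simp add: Lgt_def)
  obtain Z where Z: "Z \<in> ob" "\<forall>X\<in>ob. zero_space (hm X Z) \<and> zero_space (hm Z X)"
    using ex_zero by blast
  obtain Y g where t: "tri Z X Y \<zero>\<^bsub>hm Z X\<^esub> g" using tri_cone[OF Z(1) Xo zero_in[OF Z(1) Xo]] by blast
  obtain d where t': "tri X Y (sh 1 Z) g d" using tri_rot[OF t] by blast
  have "zero_space (hm Y (sh i M))" if "i > - 1" for i
    using that zero_mid'[OF t' sh_ob[OF M_ob], of i] 0 Z sh_ob[OF M_ob]
    by (simp add: Lgt_def sh_zero_iff M_ob)
  then have "Y \<in> Lgt (- 1)" using tri_ob[OF t] by (simp add: Lgt_def)
  moreover have "Z \<in> Llt 0 \<inter> fd" using Z zero_in_fd sh_ob[OF M_ob] by (simp add: Llt_def)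
  ultimately show ?case using t by blast
next
  case (Suc n)
  have Xo: "X \<in> ob" using Suc.prems by (simp add: Lgt_def)
  have "sh (- int n) X \<in> Lgt 0" using sh_Lgt[OF Suc.prems, of "- int n"] by simp
  then obtain H Y h c where H: "H \<in> fd" and Y: "Y \<in> Lgt (- 1)" and t: "tri H (sh (- int n) X) Y h c"
    and HM: "\<forall>i. i \<noteq> 0 \<longrightarrow> zero_space (hm H (sh i M))"
    using ex_heart_approximation[OF R] by blast
  have Ho: "H \<in> ob" using H fd_ob by blast
  obtain h' c' where t1: "tri (sh (int n) H) X (sh (int n) Y) h' c'"
    using tri_shift[OF t, of "int n"] Xo by (auto simp: sh_sh sh_0)
  have "sh (int n) Y \<in> Lgt (int n - 1)" using sh_Lgt[OF Y, of "int n"] by simp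
  then obtain A B f g where A: "A \<in> Llt 0 \<inter> fd" and B: "B \<in> Lgt (- 1)" and t2: "tri A (sh (int n) Y) B f g"
    using Suc.IH by blast
  \<comment> \<open>The fibre \<open>D\<close> of the composite
    \<open>X \<rightarrow> Y[n] \<rightarrow> B\<close> is an extension of \<open>A\<close> by
    \<open>H[n]\<close>.\<close>
  obtain D d u v where D: "tri D X B d (g \<bullet> c')" and t3: "tri (sh (int n) H) D A u v"
    using tri_oct'[OF t1 t2] by blast
  have "D \<in> fd" using fd_ext[OF t3] fd_sh[OF H] A by blast
  \<comment> \<open>\<open>H[n]\<close> can map to \<open>M[i]\<close> only for
    \<open>i = n\<close>, which is not negative.\<close>
  moreover have "zero_space (hm D (sh i M))" if "i < 0" for i
    using that zero_mid'[OF t3 sh_ob[OF M_ob], of i] A HM Ho M_ob by (simp add: Llt_def sh_zero_iff)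
  then have "D \<in> Llt 0" using tri_ob[OF D] by (simp add: Llt_def)
  ultimately show ?case using B D by blast
qed

lemma ex_left_truncation:
  assumes R: "right_cond" and X: "X \<in> ob"
  shows "\<exists>X'\<in>Llt 0 \<inter> fd. \<exists>X''\<in>Lgt (- 1). \<exists>f g. tri X' X X'' f g"
proof -
  obtain n where "X \<in> Lgt n" using ex_mem_Lgt[OF X] by blast
  then have "X \<in> Lgt (int (nat (n + 1)) - 1)" by (auto simp: Lgt_def)
  then show ?thesis by (rule ex_left_truncation_bounded[OF R])
qed

text \<open>The objects receiving no nonzero map from any shift of \<open>X\<close> form a thick
  subcategory containing \<open>M\<close>. Testing all shifts of \<open>X\<close> makes this class
  closed under the shift.\<close>

lemma zero_if_perp:
  assumes X: "X \<in> ob" and z: "\<And>i. zero_space (hm X (sh i M))" and Y: "Y \<in> ob"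
  shows "zero_space (hm X Y)"
proof -
  define P where "P = {Y \<in> ob. \<forall>n. zero_space (hm (sh n X) Y)}"
  have "P = ob"
  proof (rule M_gen)
    show "P \<subseteq> ob" by (auto simp: P_def)
    have "zero_space (hm (sh n X) M)" for n
      using z[of "- n"] sh_zero_iff_left[OF X M_ob] by simp
    then show "M \<in> P" by (simp add: P_def M_ob)
    show "sh n Y \<in> P" if Y: "Y \<in> P" for n Y
    proof -
      have "zero_space (hm (sh m X) (sh n Y))" for m
        using Y sh_zero[of "sh (m - n) X" Y n] X by (simp add: P_def sh_ob sh_sh)
      then show ?thesis using Y by (simp add: P_def sh_ob)
    qed
    show "Y \<in> P" if t: "tri A Y B f g" and AB: "A \<in> P" "B \<in> P" for A Y B f g
      using zero_mid[OF t sh_ob[OF X]] AB tri_ob[OF t] by (auto simp: P_def)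
    show "A \<in> P" if r: "A \<in> ob" "Y \<in> P" "i \<in> carrier (hm A Y)" "p \<in> carrier (hm Y A)" "p \<bullet> i = un A" for A Y i p
      using zero_retract[OF r(1) _ sh_ob[OF X] r(3-5)] r(1,2) by (auto simp: P_def)
  qed
  then have "zero_space (hm (sh 0 X) Y)" using Y unfolding P_def by blast
  then show ?thesis using X by (simp add: sh_0)
qed

lemma left_cond_if_right_cond:
  assumes R: "right_cond"
  shows "left_cond"
  unfolding left_cond_def
proof (intro conjI subsetI allI ballI)
  fix X assume X: "X \<in> Llt 0"
  have Xo: "X \<in> ob" using X by (simp add: Llt_def)
  obtain X' X'' f g where X': "X' \<in> Llt 0 \<inter> fd" and X'': "X'' \<in> Lgt (- 1)" and t: "tri X' X X'' f g"
    using ex_left_truncation[OF R Xo] by blast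
  have o: "X' \<in> ob" "X'' \<in> ob" using tri_ob[OF t] by blast+
  obtain h where t': "tri X X'' (sh 1 X') g h" using tri_rot[OF t] by blast
  \<comment> \<open>Nonnegative \<open>i\<close> come from \<open>Lgt (- 1)\<close>, negative ones
    from the rotated triangle. So \<open>X''\<close> is a zero object and \<open>X\<close> is a
    retract of \<open>X'\<close>.\<close>
  have "zero_space (hm X'' (sh i M))" for i
  proof (cases "i < 0")
    case True
    then show ?thesis
      using zero_mid'[OF t' sh_ob[OF M_ob], of i] X X' o M_ob by (simp add: Llt_def sh_zero_iff)
  qed (use X'' in \<open>simp add: Lgt_def\<close>)
  then have "zero_space (hm X'' X'')" by (rule zero_if_perp[OF o(2) _ o(2)])
  then have "un X'' = \<zero>\<^bsub>hm X'' X''\<^esub>" using un_in[OF o(2)] by (simp add: zero_space_def)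
  then have "g = \<zero>\<^bsub>hm X X''\<^esub>"
    using cp_un_left[OF Xo o(2), of g] cp_zero_left[OF Xo o(2,2), of g] tri_ob[OF t] by simp
  then obtain i where "i \<in> carrier (hm X X')" "f \<bullet> i = un X" using retract_if_zero[OF t] by blast
  then show "X \<in> fd" using X' tri_ob[OF t] by (intro fd_retract[of X X' i f]) auto
next
  fix n X assume X: "X \<in> ob"
  obtain A B f g where "A \<in> Llt 0 \<inter> fd" "B \<in> Lgt (- 1)" "tri A (sh (- n) X) B f g"
    using ex_left_truncation[OF R sh_ob[OF X]] by blast
  moreover from this have "sh n A \<in> Llt n" "sh n B \<in> Lgt (n - 1)"
    using sh_Llt[of A 0 n] sh_Lgt[of B "- 1" n] by simp_all
  moreover obtain f' g' where "tri (sh n A) X (sh n B) f' g'"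
    using tri_shift[OF calculation(3), of n] X by (auto simp: sh_sh sh_0)
  ultimately show "\<exists>X'\<in>Llt n. \<exists>X''\<in>Lgt (n - 1). \<exists>f g. tri X' X X'' f g" by blast
qed

text \<open>Duality turns the truncation at \<open>n\<close> into the one at \<open>1 - n\<close>,
  which accounts for the reindexing in \<open>*\<close>.\<close>

lemma dual_cond:
  "tri_serre.right_cond ob (\<lambda>X Y. hm Y X) (\<lambda>n. sh (- n)) (\<lambda>X Y Z f g. tri Z Y X g f) M fd \<longleftrightarrow> left_cond"
  "tri_serre.left_cond ob (\<lambda>X Y. hm Y X) (\<lambda>n. sh (- n)) (\<lambda>X Y Z f g. tri Z Y X g f) M fd \<longleftrightarrow> right_cond"
proof -
  have *: "(\<forall>n. P (- n) (- (n - 1))) \<longleftrightarrow> (\<forall>n. P (n - 1) n)" for P :: "int \<Rightarrow> int \<Rightarrow> bool"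
  proof (intro iffI allI)
    fix n assume "\<forall>n. P (- n) (- (n - 1))"
    from this[rule_format, of "1 - n"] show "P (n - 1) n" by simp
  next
    fix n assume "\<forall>n. P (n - 1) n"
    from this[rule_format, of "1 - n"] show "P (- n) (- (n - 1))" by simp
  qed
  have swap: "(\<exists>X'\<in>A. \<exists>X''\<in>B. \<exists>f g. tri X'' X X' g f) \<longleftrightarrow> (\<exists>X''\<in>B. \<exists>X'\<in>A. \<exists>f g. tri X'' X X' f g)"
    for A B X by blast
  show "tri_serre.right_cond ob (\<lambda>X Y. hm Y X) (\<lambda>n. sh (- n)) (\<lambda>X Y Z f g. tri Z Y X g f) M fd \<longleftrightarrow> left_cond"
    unfolding tri_serre.right_cond_def[OF serre_dual] left_cond_def dual_perp group_add_class.minus_zero swap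
    by (simp only: *[of "\<lambda>m n. \<forall>X\<in>ob. \<exists>X''\<in>Llt n. \<exists>X'\<in>Lgt m. \<exists>f g. tri X'' X X' f g"])
  show "tri_serre.left_cond ob (\<lambda>X Y. hm Y X) (\<lambda>n. sh (- n)) (\<lambda>X Y Z f g. tri Z Y X g f) M fd \<longleftrightarrow> right_cond"
    unfolding tri_serre.left_cond_def[OF serre_dual] right_cond_def dual_perp group_add_class.minus_zero swap
    by (simp only: *[of "\<lambda>m n. \<forall>X\<in>ob. \<exists>X''\<in>Rlt n. \<exists>X'\<in>Rgt m. \<exists>f g. tri X'' X X' f g"])
qed

lemma right_cond_iff_left_cond: "right_cond \<longleftrightarrow> left_cond"
  by (rule iffI[OF left_cond_if_right_cond
      tri_serre.left_cond_if_right_cond[OF serre_dual, unfolded dual_cond]])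

section \<open>Recovering the t-structures from truncation triangles\<close>

text \<open>\<open>orthogonal\<close> concerns maps in the other direction; Serre duality converts
  it. After shifting, the partner \<open>Z\<close> of \<open>Y0\<close> lies in
  \<open>Rlt 0\<close>, so Hom(X0, Z) vanishes, and with it Hom(Y0, X0).\<close>

lemma left_orthogonal:
  assumes L: "Llt 0 \<subseteq> fd" and Y: "Y \<in> Llt n" and X: "X \<in> Lgt (n - 1)"
  shows "zero_space (hm Y X)"
proof -
  define Y0 where "Y0 = sh (- n) Y"
  define X0 where "X0 = sh (- n) X"
  have o: "Y \<in> ob" "X \<in> ob" using X Y by (auto simp: Llt_def Lgt_def)
  have Y0: "Y0 \<in> Llt 0" and X0: "X0 \<in> Lgt (- 1)"
    using sh_Llt[OF Y, of "- n"] sh_Lgt[OF X, of "- n"] by (simp_all add: Y0_def X0_def)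
  have o0: "Y0 \<in> ob" "X0 \<in> ob" using X0 Y0 by (auto simp: Llt_def Lgt_def)
  obtain Z t where Z: "Z \<in> fd" and s: "serre_pair Y0 Z t" using serre_right L Y0 by blast
  have Zo: "Z \<in> ob" using Z fd_ob by blast
  have "zero_space (hm (sh i M) Z)" if "i < 0" for i
    using serre_zero'[OF s o0(1) Zo sh_ob[OF M_ob]] Y0 that by (simp add: Llt_def)
  then have "Z \<in> Rlt 0" using Zo by (simp add: Rlt_def)
  then have "zero_space (hm X0 Z)" using orthogonal[OF X0] by simp
  then have "zero_space (hm Y0 X0)" by (rule serre_zero[OF s o0(1) Zo o0(2)])
  then show ?thesis using o by (simp add: Y0_def X0_def sh_zero)
qed

text \<open>An object orthogonal to one class has a truncation triangle with a zero map, hence is a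
  retract of the other piece, and both classes are closed under retracts.\<close>

lemma left_perp_eq:
  assumes L: "left_cond"
  shows "Llt n = {X \<in> ob. \<forall>Y\<in>Lgt (n - 1). zero_space (hm X Y)}"
    and "Lgt (n - 1) = {Y \<in> ob. \<forall>X\<in>Llt n. zero_space (hm X Y)}"
proof -
  have o: "zero_space (hm X Y)" if "X \<in> Llt n" "Y \<in> Lgt (n - 1)" for X Y
    using L left_orthogonal that unfolding left_cond_def by blast
  have "X \<in> Llt n" if X: "X \<in> ob" "\<And>Y. Y \<in> Lgt (n - 1) \<Longrightarrow> zero_space (hm X Y)" for X
  proof -
    obtain A B f g where A: "A \<in> Llt n" and B: "B \<in> Lgt (n - 1)" and t: "tri A X B f g"
      using L X(1) unfolding left_cond_def by blast
    have "g = \<zero>\<^bsub>hm X B\<^esub>" using X(2)[OF B] tri_ob[OF t] by (simp add: zero_space_def)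
    then obtain i where i: "i \<in> carrier (hm X A)" "f \<bullet> i = un X" using retract_if_zero[OF t] by blast
    have A': "A \<in> ob" "f \<in> carrier (hm A X)" using tri_ob[OF t] by blast+
    have "zero_space (hm X (sh k M))" if "k < n" for k
      using A that by (intro zero_retract'[OF X(1) A'(1) sh_ob[OF M_ob] i(1) A'(2) i(2)]) (simp add: Llt_def)
    then show ?thesis using X(1) by (simp add: Llt_def)
  qed
  then show "Llt n = {X \<in> ob. \<forall>Y\<in>Lgt (n - 1). zero_space (hm X Y)}"
    using o unfolding Llt_def by blast
  have "X \<in> Lgt (n - 1)" if X: "X \<in> ob" "\<And>Y. Y \<in> Llt n \<Longrightarrow> zero_space (hm Y X)" for X
  proof -
    obtain A B f g where A: "A \<in> Llt n" and B: "B \<in> Lgt (n - 1)" and t: "tri A X B f g"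
      using L X(1) unfolding left_cond_def by blast
    have "f = \<zero>\<^bsub>hm A X\<^esub>" using X(2)[OF A] tri_ob[OF t] by (simp add: zero_space_def)
    then obtain p where p: "p \<in> carrier (hm B X)" "p \<bullet> g = un X" using retract_if_zero'[OF t] by blast
    have B': "B \<in> ob" "g \<in> carrier (hm X B)" using tri_ob[OF t] by blast+
    have "zero_space (hm X (sh k M))" if "k > n - 1" for k
      using B that by (intro zero_retract'[OF X(1) B'(1) sh_ob[OF M_ob] B'(2) p]) (simp add: Lgt_def)
    then show ?thesis using X(1) by (simp add: Lgt_def)
  qed
  then show "Lgt (n - 1) = {Y \<in> ob. \<forall>X\<in>Llt n. zero_space (hm X Y)}"
    using o unfolding Lgt_def by blast
qed

lemma right_perp_eq:
  assumes R: "right_cond"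
  shows "Rlt n = {X \<in> ob. \<forall>Y\<in>Rgt (n - 1). zero_space (hm X Y)}"
    and "Rgt (n - 1) = {Y \<in> ob. \<forall>X\<in>Rlt n. zero_space (hm X Y)}"
  using tri_serre.left_perp_eq[OF serre_dual, unfolded dual_cond dual_perp, OF R, of "1 - n"] by simp_all

text \<open>Truncations in one degree give all others by shifting. \<open>m\<close> is arbitrary
  because the dual use takes place at \<open>m = 1\<close>.\<close>

lemma right_condI:
  assumes fd: "Rgt 0 \<subseteq> fd" and ex: "\<forall>X\<in>ob. \<exists>X'\<in>Rlt m. \<exists>X''\<in>Rgt (m - 1). \<exists>f g. tri X' X X'' f g"
  shows "right_cond"
  unfolding right_cond_def
proof (intro conjI allI ballI fd)
  fix n X assume X: "X \<in> ob"
  obtain A B f g where A: "A \<in> Rlt m" and B: "B \<in> Rgt (m - 1)" and t: "tri A (sh (m - n) X) B f g"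
    using bspec[OF ex sh_ob[OF X, of "m - n"]] by blast
  have "sh (n - m) A \<in> Rlt n" "sh (n - m) B \<in> Rgt (n - 1)"
    using sh_Rlt[OF A, of "n - m"] sh_Rgt[OF B, of "n - m"] by simp_all
  moreover obtain f' g' where "tri (sh (n - m) A) X (sh (n - m) B) f' g'"
    using tri_shift[OF t, of "n - m"] X by (auto simp: sh_sh sh_0)
  ultimately show "\<exists>X'\<in>Rlt n. \<exists>X''\<in>Rgt (n - 1). \<exists>f g. tri X' X X'' f g" by blast
qed

lemma left_condI:
  assumes fd: "Llt 0 \<subseteq> fd" and ex: "\<forall>X\<in>ob. \<exists>X'\<in>Llt 0. \<exists>X''\<in>Lgt (- 1). \<exists>f g. tri X' X X'' f g"
  shows "left_cond"
proof -
  have "\<forall>X\<in>ob. \<exists>X''\<in>Lgt (- 1). \<exists>X'\<in>Llt (- (1 - 1)). \<exists>g f. tri X' X X'' f g"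
    using ex by (simp, blast)
  moreover have "Llt (- 0) \<subseteq> fd" using fd by simp
  ultimately show ?thesis
    using tri_serre.right_condI[OF serre_dual, of 1, unfolded dual_cond dual_perp] by blast
qed

lemma image_shift:
  assumes "\<And>X k. X \<in> A n \<Longrightarrow> sh k X \<in> A (n + k)" "\<And>X k. X \<in> A (n + k) \<Longrightarrow> sh (- k) X \<in> A n" "A (n + k) \<subseteq> ob"
  shows "sh k ` A n = A (n + k)"
proof (intro equalityI subsetI)
  fix X assume X: "X \<in> A (n + k)"
  then have "X = sh k (sh (- k) X)" using assms(3) by (simp add: sh_sh sh_0 subset_iff)
  then show "X \<in> sh k ` A n" using assms(2)[OF X] by blast
qed (use assms(1) in blast)

lemma sh_image_Rgt: "sh (- 1) ` Rgt 0 = Rgt (- 1)"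
  using image_shift[of Rgt 0 "- 1"] sh_Rgt by (fastforce simp: Rgt_def)

lemma sh_image_Lgt: "sh (- 1) ` Lgt 0 = Lgt (- 1)"
  using image_shift[of Lgt 0 "- 1"] sh_Lgt by (fastforce simp: Lgt_def)

end

section \<open>Restricting equivalences\<close>

lemma full_sub_simps [simp]:
  "Ob (full_sub C A) = A" "HomSp (full_sub C A) = HomSp C" "Comp (full_sub C A) = Comp C"
  "Id (full_sub C A) = Id C" "iso_in (full_sub C A) = iso_in C"
  by (simp_all add: full_sub_def iso_in_def[abs_def])

lemma is_fctr_restrict:
  assumes F: "is_fctr (full_sub C A) (full_sub C A) F"
    and sub: "B \<subseteq> A" and maps: "\<And>X. X \<in> B \<Longrightarrow> omap F X \<in> D"
  shows "is_fctr (full_sub C B) (full_sub C D) F"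
proof (intro is_fctr.intro, unfold full_sub_simps, goal_cases)
  case (1 X)
  then show ?case by (rule maps)
next
  case (2 X Y f)
  then show ?case using is_fctr.mmap_in_Hom[OF F, unfolded full_sub_simps, of X Y f] sub by blast
next
  case (3 X)
  then show ?case using is_fctr.mmap_Id[OF F, unfolded full_sub_simps, of X] sub by blast
next
  case (4 X Y Z f g)
  then show ?case using is_fctr.mmap_Comp[OF F, unfolded full_sub_simps, of X Y Z f g] sub by blast
qed

lemma naturally_iso_restrict:
  assumes N: "naturally_iso (full_sub C A) (full_sub C A) F G" and sub: "B \<subseteq> A"
  shows "naturally_iso (full_sub C B) (full_sub C B) F G"
proof -
  obtain \<eta> where "\<forall>X\<in>A. iso_in C (omap F X) (omap G X) (\<eta> X)"
    "\<forall>X\<in>A. \<forall>Y\<in>A. \<forall>f\<in>Hom C X Y. \<eta> Y \<cdot>\<^bsub>C\<^esub> mmap F f = mmap G f \<cdot>\<^bsub>C\<^esub> \<eta> X"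
    using N unfolding naturally_iso_def full_sub_simps by blast
  then show ?thesis
    using sub unfolding naturally_iso_def full_sub_simps by (intro exI[of _ \<eta>]) blast
qed

text \<open>For full subcategories functors and natural isomorphisms restrict unchanged once objects
  are sent to the right place.\<close>

lemma quasi_inverse_restrict:
  assumes q: "quasi_inverse (full_sub C A) (full_sub C A) S S'"
    and sub: "B \<subseteq> A" "D \<subseteq> A"
    and maps: "\<And>X. X \<in> B \<Longrightarrow> omap S X \<in> D" "\<And>X. X \<in> D \<Longrightarrow> omap S' X \<in> B"
  shows "quasi_inverse (full_sub C B) (full_sub C D) S S'"
proof -
  note q = q[unfolded quasi_inverse_def]
  show ?thesis
    unfolding quasi_inverse_def
    using is_fctr_restrict[OF _ sub(1) maps(1)] is_fctr_restrict[OF _ sub(2) maps(2)]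
      naturally_iso_restrict[OF _ sub(1)] naturally_iso_restrict[OF _ sub(2)] q by metis
qed

section \<open>Triangulated categories\<close>

context triangulated_cat
begin

lemma zero_in_Hom: "\<lbrakk>X \<in> Ob T; Y \<in> Ob T\<rbrakk> \<Longrightarrow> \<zero>\<^bsub>HomSp T X Y\<^esub> \<in> Hom T X Y"
  by (meson Hom_vectorspace abelian_groupE(2) module.axioms(2) vectorspace.axioms(1))

lemma hom_mod_hom:
  assumes "X \<in> Ob T" "Y \<in> Ob T" "X' \<in> Ob T" "Y' \<in> Ob T"
    "t \<in> module_hom K (HomSp T X Y) (HomSp T X' Y')"
  shows "mod_hom K (HomSp T X Y) (HomSp T X' Y') t"
  using assms Hom_vectorspace by (simp add: mod_hom_def mod_hom_axioms_def vectorspace.axioms)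

lemma Comp_zero_right:
  assumes "X \<in> Ob T" "Y \<in> Ob T" "Z \<in> Ob T" "g \<in> Hom T Y Z"
  shows "g \<cdot> \<zero>\<^bsub>HomSp T X Y\<^esub> = \<zero>\<^bsub>HomSp T X Z\<^esub>"
  by (rule mod_hom.f0_is_0[OF hom_mod_hom[OF _ _ _ _ Comp_linear_right]]) (fact assms)+

lemma Comp_zero_left:
  assumes "X \<in> Ob T" "Y \<in> Ob T" "Z \<in> Ob T" "f \<in> Hom T X Y"
  shows "\<zero>\<^bsub>HomSp T Y Z\<^esub> \<cdot> f = \<zero>\<^bsub>HomSp T X Z\<^esub>"
  by (rule mod_hom.f0_is_0[OF hom_mod_hom[OF _ _ _ _ Comp_linear_left]]) (fact assms)+

lemma sh1_Ob: "X \<in> Ob T \<Longrightarrow> sh1 T X \<in> Ob T"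
  by (rule bij_betw_apply[OF Shift_bij_Ob])

lemma shm_Hom: "\<lbrakk>X \<in> Ob T; Y \<in> Ob T; f \<in> Hom T X Y\<rbrakk> \<Longrightarrow> shm T f \<in> Hom T (sh1 T X) (sh1 T Y)"
  using is_fctr.mmap_in_Hom[OF Shift_fctr] by blast

lemma ex_shm:
  assumes "X \<in> Ob T" "Y \<in> Ob T" "g \<in> Hom T (sh1 T X) (sh1 T Y)"
  obtains f where "f \<in> Hom T X Y" "g = shm T f"
  using bij_betw_imp_surj_on[OF Shift_bij_Hom[OF assms(1,2)]] assms(3) by blast

lemma shm_inj: "\<lbrakk>X \<in> Ob T; Y \<in> Ob T; f \<in> Hom T X Y; g \<in> Hom T X Y; shm T f = shm T g\<rbrakk> \<Longrightarrow> f = g"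
  by (rule inj_onD[OF bij_betw_imp_inj_on[OF Shift_bij_Hom]])

lemma shm_zero:
  assumes "X \<in> Ob T" "Y \<in> Ob T"
  shows "shm T \<zero>\<^bsub>HomSp T X Y\<^esub> = \<zero>\<^bsub>HomSp T (sh1 T X) (sh1 T Y)\<^esub>"
  by (rule mod_hom.f0_is_0[OF hom_mod_hom[OF _ _ _ _ Shift_linear]]) (fact assms sh1_Ob[OF assms(1)] sh1_Ob[OF assms(2)])+

lemma shm_Comp: "\<lbrakk>X \<in> Ob T; Y \<in> Ob T; Z \<in> Ob T; f \<in> Hom T X Y; g \<in> Hom T Y Z\<rbrakk>
    \<Longrightarrow> shm T (g \<cdot> f) = shm T g \<cdot> shm T f"
  using is_fctr.mmap_Comp[OF Shift_fctr] by blast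

lemma shift_0: "shift T 0 X = X"
  by (simp add: shift_def)

lemma unshift_Ob: "X \<in> Ob T \<Longrightarrow> (the_inv_into (Ob T) (sh1 T) ^^ k) X \<in> Ob T"
  by (induction k) (simp_all add: bij_betw_apply[OF bij_betw_the_inv_into[OF Shift_bij_Ob]])

lemma shift_Ob:
  assumes "X \<in> Ob T"
  shows "shift T n X \<in> Ob T"
proof -
  have "(sh1 T ^^ k) X \<in> Ob T" for k using assms by (induction k) (auto simp: sh1_Ob)
  then show ?thesis using assms by (simp add: shift_def unshift_Ob)
qed

lemma shift_Suc:
  assumes X: "X \<in> Ob T"
  shows "shift T (n + 1) X = sh1 T (shift T n X)"
proof (cases "n \<ge> 0")
  case True
  then have "nat (n + 1) = Suc (nat n)" by simp
  then show ?thesis using True by (simp add: shift_def)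
next
  case False
  \<comment> \<open>The number of inverse shifts left after one is cancelled; it is zero at
    \<open>n = - 1\<close>.\<close>
  define k where "k = nat (- n - 1)"
  have k: "nat (- n) = Suc k" using False by (simp add: k_def)
  have "sh1 T (shift T n X) = (the_inv_into (Ob T) (sh1 T) ^^ k) X"
    using False f_the_inv_into_f_bij_betw[OF Shift_bij_Ob, of "(the_inv_into (Ob T) (sh1 T) ^^ k) X"]
      unshift_Ob[OF X, of k] by (simp add: shift_def k)
  moreover have "shift T (n + 1) X = (the_inv_into (Ob T) (sh1 T) ^^ k) X"
  proof (cases "n = - 1")
    case True
    then show ?thesis by (simp add: shift_def k_def)
  next
    case False
    then show ?thesis using \<open>\<not> n \<ge> 0\<close> by (simp add: shift_def k_def)
  qed
  ultimately show ?thesis by simp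
qed

lemma shift_1: "X \<in> Ob T \<Longrightarrow> shift T 1 X = sh1 T X"
  using shift_Suc[of X 0] by (simp add: shift_0)

lemma sh1_inj: "\<lbrakk>X \<in> Ob T; Y \<in> Ob T; sh1 T X = sh1 T Y\<rbrakk> \<Longrightarrow> X = Y"
  by (rule inj_onD[OF bij_betw_imp_inj_on[OF Shift_bij_Ob]])

lemma shift_shift:
  assumes X: "X \<in> Ob T"
  shows "shift T m (shift T n X) = shift T (m + n) X"
proof (induction m rule: int_induct[where k = 0])
  case (step1 i)
  then show ?case
    using shift_Suc[OF shift_Ob[OF X], of i n] shift_Suc[OF X, of "i + n"] by (simp add: algebra_simps)
next
  case (step2 i)
  have "sh1 T (shift T (i - 1) (shift T n X)) = sh1 T (shift T (i - 1 + n) X)"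
    using shift_Suc[OF shift_Ob[OF X], of "i - 1" n] shift_Suc[OF X, of "i - 1 + n"] step2
    by (simp add: algebra_simps)
  then show ?case by (rule sh1_inj[OF shift_Ob[OF shift_Ob[OF X]] shift_Ob[OF X]])
qed (simp add: shift_0)

lemma sh1_unshift: "X \<in> Ob T \<Longrightarrow> sh1 T (shift T (- 1) X) = X"
  using shift_Suc[of X "- 1"] by (simp add: shift_0)

lemma unshift_sh1: "X \<in> Ob T \<Longrightarrow> shift T (- 1) (sh1 T X) = X"
  using shift_shift[of X "- 1" 1] by (simp add: shift_0 shift_1)

lemma zero_space_sh1:
  assumes "X \<in> Ob T" "Y \<in> Ob T"
  shows "zero_space (HomSp T (sh1 T X) (sh1 T Y)) = zero_space (HomSp T X Y)"
proof
  assume z: "zero_space (HomSp T (sh1 T X) (sh1 T Y))"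
  have "f = \<zero>\<^bsub>HomSp T X Y\<^esub>" if "f \<in> Hom T X Y" for f
    using z shm_Hom[OF assms that] shm_zero[OF assms] shm_inj[OF assms that zero_in_Hom[OF assms]]
    by (simp add: zero_space_def)
  then show "zero_space (HomSp T X Y)" using zero_in_Hom[OF assms] unfolding zero_space_def by blast
next
  assume z: "zero_space (HomSp T X Y)"
  have "f = \<zero>\<^bsub>HomSp T (sh1 T X) (sh1 T Y)\<^esub>" if f: "f \<in> Hom T (sh1 T X) (sh1 T Y)" for f
  proof -
    obtain g where g: "g \<in> Hom T X Y" "f = shm T g" by (rule ex_shm[OF assms f])
    then have "g = \<zero>\<^bsub>HomSp T X Y\<^esub>" using z by (simp add: zero_space_def)
    then show ?thesis using g shm_zero[OF assms] by simp
  qed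
  then show "zero_space (HomSp T (sh1 T X) (sh1 T Y))"
    using zero_in_Hom[OF sh1_Ob[OF assms(1)] sh1_Ob[OF assms(2)]] unfolding zero_space_def by blast
qed

lemma zero_space_shift:
  assumes "X \<in> Ob T" "Y \<in> Ob T"
  shows "zero_space (HomSp T (shift T n X) (shift T n Y)) = zero_space (HomSp T X Y)"
proof (induction n rule: int_induct[where k = 0])
  case (step1 i)
  then show ?case using zero_space_sh1[OF shift_Ob shift_Ob] assms by (simp add: shift_Suc)
next
  case (step2 i)
  then show ?case
    using zero_space_sh1[OF shift_Ob shift_Ob, of X Y "i - 1" "i - 1"] shift_Suc[of _ "i - 1"] assms by simp
qed (simp add: shift_0)

lemma ex_zero_space_object: "\<exists>Z\<in>Ob T. \<forall>X\<in>Ob T. zero_space (HomSp T X Z) \<and> zero_space (HomSp T Z X)"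
  using ex_zero_object unfolding zero_object_def Hom_zero_def zero_space_def by blast

text \<open>Comparison with the trivial triangle on \<open>X\<close> makes
  \<open>g \<cdot> f\<close> factor through a zero object.\<close>

lemma Dist_Comp_zero:
  assumes D: "Dist T X Y Z f g h"
  shows "g \<cdot> f = \<zero>\<^bsub>HomSp T X Z\<^esub>"
proof -
  have o: "X \<in> Ob T" "Y \<in> Ob T" "Z \<in> Ob T" "f \<in> Hom T X Y" using Dist_typed[OF D] by blast+
  obtain N where N: "zero_object T N" using ex_zero_object by blast
  then have No: "N \<in> Ob T" by (simp add: zero_object_def)
  obtain c where "c \<in> Hom T N Z" "c \<cdot> \<zero>\<^bsub>HomSp T X N\<^esub> = g \<cdot> f"
    using Dist_morphism[OF Dist_Id[OF o(1) N] D Id_in_Hom[OF o(1)] o(4) refl] by blast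
  then show ?thesis using Comp_zero_right[OF o(1) No o(3)] by simp
qed

lemma Dist_rot:
  assumes D: "Dist T X Y Z f g h"
  shows "Dist T Y Z (sh1 T X) g h (\<ominus>\<^bsub>HomSp T (sh1 T X) (sh1 T Y)\<^esub> shm T f)"
proof -
  have o: "X \<in> Ob T" "Y \<in> Ob T" "Z \<in> Ob T" "f \<in> Hom T X Y" "g \<in> Hom T Y Z" "h \<in> Hom T Z (sh1 T X)"
    using Dist_typed[OF D] by blast+
  show ?thesis using D unfolding Dist_rotate[OF o] .
qed

lemma ex_Dist_rot':
  assumes D: "Dist T X Y Z f g h"
  shows "\<exists>h'. Dist T (shift T (- 1) Z) X Y h' f g"
proof -
  have o: "X \<in> Ob T" "Y \<in> Ob T" "Z \<in> Ob T" "f \<in> Hom T X Y" "g \<in> Hom T Y Z" "h \<in> Hom T Z (sh1 T X)"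
    using Dist_typed[OF D] by blast+
  let ?A = "shift T (- 1) Z"
  have A: "?A \<in> Ob T" "sh1 T ?A = Z" by (simp_all add: shift_Ob sh1_unshift o)
  interpret H: vectorspace K "HomSp T Z (sh1 T X)" by (rule Hom_vectorspace[OF o(3) sh1_Ob[OF o(1)]])
  \<comment> \<open>\<open>h'\<close> desuspends minus \<open>h\<close>, so that the sign in the
    rotation axiom restores \<open>h\<close>.\<close>
  obtain h' where h': "h' \<in> Hom T ?A X" "\<ominus>\<^bsub>HomSp T Z (sh1 T X)\<^esub> h = shm T h'"
    using ex_shm[OF A(1) o(1)] o(6) by (metis A(2) H.M.a_inv_closed)
  have "h = \<ominus>\<^bsub>HomSp T (sh1 T ?A) (sh1 T X)\<^esub> shm T h'"
    using o(6) A(2) by (simp add: h'(2)[symmetric])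
  then show ?thesis
    using Dist_rotate[OF A(1) o(1,2) h'(1) o(4), of g] D o(5) A(2) by auto
qed

text \<open>The rotated trivial triangle on \<open>W\<close> maps to the rotated given one by
  \<open>u\<close> and zero; the third component \<open>W[1] \<rightarrow> X[1]\<close> desuspends
  to \<open>v\<close>. The rotation signs on both sides cancel.\<close>

lemma Dist_exact:
  assumes D: "Dist T X Y Z f g h" and W: "W \<in> Ob T" and u: "u \<in> Hom T W Y"
    and gu: "g \<cdot> u = \<zero>\<^bsub>HomSp T W Z\<^esub>"
  shows "\<exists>v\<in>Hom T W X. u = f \<cdot> v"
proof -
  have o: "X \<in> Ob T" "Y \<in> Ob T" "Z \<in> Ob T" "f \<in> Hom T X Y" "g \<in> Hom T Y Z" "h \<in> Hom T Z (sh1 T X)"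
    using Dist_typed[OF D] by blast+
  obtain N where N: "zero_object T N" using ex_zero_object by blast
  then have No: "N \<in> Ob T" by (simp add: zero_object_def)
  note so = sh1_Ob[OF W] sh1_Ob[OF o(1)] sh1_Ob[OF o(2)]
  have "\<zero>\<^bsub>HomSp T N Z\<^esub> \<cdot> \<zero>\<^bsub>HomSp T W N\<^esub> = g \<cdot> u"
    using gu Comp_zero_left[OF W No o(3) zero_in_Hom[OF W No]] by simp
  then obtain c where c: "c \<in> Hom T (sh1 T W) (sh1 T X)"
    and eq: "shm T u \<cdot> (\<ominus>\<^bsub>HomSp T (sh1 T W) (sh1 T W)\<^esub> shm T (Id T W)) =
      (\<ominus>\<^bsub>HomSp T (sh1 T X) (sh1 T Y)\<^esub> shm T f) \<cdot> c"
    using Dist_morphism[OF Dist_rot[OF Dist_Id[OF W N]] Dist_rot[OF D] u zero_in_Hom[OF No o(3)]] by blast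
  have su: "shm T u \<in> Hom T (sh1 T W) (sh1 T Y)" and sf: "shm T f \<in> Hom T (sh1 T X) (sh1 T Y)"
    using shm_Hom W o u by blast+
  interpret R: mod_hom K "HomSp T (sh1 T W) (sh1 T W)" "HomSp T (sh1 T W) (sh1 T Y)" "\<lambda>f. shm T u \<cdot> f"
    by (rule hom_mod_hom[OF _ _ _ _ Comp_linear_right]) (fact so su)+
  interpret L: mod_hom K "HomSp T (sh1 T X) (sh1 T Y)" "HomSp T (sh1 T W) (sh1 T Y)" "\<lambda>g. g \<cdot> c"
    by (rule hom_mod_hom[OF _ _ _ _ Comp_linear_left]) (fact so c)+
  have Id: "shm T (Id T W) = Id T (sh1 T W)" by (rule is_fctr.mmap_Id[OF Shift_fctr W])
  have "\<ominus>\<^bsub>HomSp T (sh1 T W) (sh1 T Y)\<^esub> shm T u = \<ominus>\<^bsub>HomSp T (sh1 T W) (sh1 T Y)\<^esub> (shm T f \<cdot> c)"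
    using eq R.f_neg[OF Id_in_Hom[OF so(1)]] L.f_neg[OF sf] Comp_Id_right[OF so(1,3) su] by (simp add: Id)
  then have "shm T u = shm T f \<cdot> c"
    using su Comp_in_Hom[OF so c sf] R.N.M.minus_minus by metis
  moreover obtain v where v: "v \<in> Hom T W X" "c = shm T v" using ex_shm[OF W o(1) c] by blast
  ultimately have "shm T u = shm T (f \<cdot> v)" using shm_Comp[OF W o(1,2) v(1) o(4)] by simp
  then have "u = f \<cdot> v" by (rule shm_inj[OF W o(2) u Comp_in_Hom[OF W o(1,2) v(1) o(4)]])
  then show ?thesis using v(1) by blast
qed

text \<open>The given triangle maps by zero and \<open>u\<close> to the trivial triangle on
  \<open>W\<close> rotated backwards; the third component is \<open>v\<close>.\<close>

lemma Dist_exact':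
  assumes D: "Dist T X Y Z f g h" and W: "W \<in> Ob T" and u: "u \<in> Hom T Y W"
    and uf: "u \<cdot> f = \<zero>\<^bsub>HomSp T X W\<^esub>"
  shows "\<exists>v\<in>Hom T Z W. u = v \<cdot> g"
proof -
  have o: "X \<in> Ob T" "Y \<in> Ob T" "Z \<in> Ob T" "f \<in> Hom T X Y" "g \<in> Hom T Y Z" "h \<in> Hom T Z (sh1 T X)"
    using Dist_typed[OF D] by blast+
  obtain N where N: "zero_object T N" using ex_zero_object by blast
  then have No: "N \<in> Ob T" by (simp add: zero_object_def)
  let ?A = "shift T (- 1) N"
  have A: "?A \<in> Ob T" by (simp add: shift_Ob No)
  obtain a where D': "Dist T ?A W W a (Id T W) \<zero>\<^bsub>HomSp T W N\<^esub>"
    using ex_Dist_rot'[OF Dist_Id[OF W N]] by blast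
  then have a: "a \<in> Hom T ?A W" using Dist_typed by blast
  have "u \<cdot> f = a \<cdot> \<zero>\<^bsub>HomSp T X ?A\<^esub>" using uf Comp_zero_right[OF o(1) A W a] by simp
  then obtain c where "c \<in> Hom T Z W" "c \<cdot> g = Id T W \<cdot> u"
    using Dist_morphism[OF D D' zero_in_Hom[OF o(1) A] u] by blast
  then show ?thesis using Comp_Id_left[OF o(2) W u] by auto
qed

lemma ex_Dist_unshift:
  assumes D: "Dist T (sh1 T X) Y (sh1 T Z) f g h" and o: "X \<in> Ob T" "Z \<in> Ob T"
  shows "\<exists>f' g' h'. Dist T X (shift T (- 1) Y) Z f' g' h'"
proof -
  obtain h' where "Dist T Z (sh1 T X) Y h' f g" using ex_Dist_rot'[OF D] o by (auto simp: unshift_sh1)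
  from ex_Dist_rot'[OF this] obtain g' where "Dist T (shift T (- 1) Y) Z (sh1 T X) g' h' f" by blast
  from ex_Dist_rot'[OF this] show ?thesis using o by (auto simp: unshift_sh1)
qed

section \<open>The triangulated category satisfies the abstract axioms\<close>

definition dist_tri :: "'o \<Rightarrow> 'o \<Rightarrow> 'o \<Rightarrow> 'm \<Rightarrow> 'm \<Rightarrow> bool"
  where "dist_tri X Y Z f g \<longleftrightarrow> (\<exists>h. Dist T X Y Z f g h)"

lemma tri_hom_dist:
  assumes fin: "hom_finite K T"
  shows "tri_hom K (Ob T) (HomSp T) (Comp T) (Id T) (shift T) dist_tri"
proof (unfold dist_tri_def[abs_def], intro tri_hom.intro tri_hom_axioms.intro field_axioms, goal_cases)
  case 1
  then show ?case by (rule Id_in_Hom)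
next
  case 2
  then show ?case by (rule Comp_Id_right)
next
  case 3
  then show ?case by (rule Comp_Id_left)
next
  case 4
  then show ?case by (rule Comp_assoc)
next
  case 5
  then show ?case by (rule Hom_vectorspace)
next
  case 6
  then show ?case using fin by (simp add: hom_finite_def)
next
  case 7
  then show ?case by (rule Comp_linear_right)
next
  case 8
  then show ?case by (rule Comp_linear_left)
next
  case 9
  then show ?case by (rule shift_Ob)
next
  case 10
  show ?case by (rule shift_0)
next
  case 11
  then show ?case by (rule shift_shift)
next
  case 12
  then show ?case by (rule zero_space_shift)
next
  case 13
  show ?case by (rule ex_zero_space_object)
next
  case (14 X Y)
  then obtain W where "direct_sum_of T X Y W" using ex_direct_sum by blast
  then show ?case unfolding direct_sum_of_def by blast
next
  case (15 X Y Z f g)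
  then show ?case using Dist_typed by blast
next
  case (16 X Y Z f g)
  then show ?case using Dist_Comp_zero by blast
next
  case (17 X Y Z f g)
  then obtain h where D: "Dist T X Y Z f g h" by blast
  then show ?case using Dist_rot[OF D] Dist_typed[OF D] by (auto simp: shift_1)
next
  case (18 X Y Z f g)
  then show ?case using ex_Dist_rot' by blast
next
  case (19 X Y Z f g W u)
  then show ?case using Dist_exact by blast
next
  case (20 X Y Z f g W u)
  then show ?case using Dist_exact' by blast
next
  case (21 X Y f)
  then show ?case using Dist_cone by blast
next
  case (22 Y Z g)
  then show ?case using Dist_cone ex_Dist_rot' by blast
next
  case (23 X Y C f c Z D g d)
  then obtain c' d' where 1: "Dist T X Y C f c c'" "Dist T Y Z D g d d'" by blast
  then have "X \<in> Ob T" "Z \<in> Ob T" "g \<cdot> f \<in> Hom T X Z"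
    using Dist_typed[OF 1(1)] Dist_typed[OF 1(2)] Comp_in_Hom by blast+
  then obtain E e e' where 2: "Dist T X Z E (g \<cdot> f) e e'" using Dist_cone by blast
  then show ?case using Dist_octahedron[OF 1 2] by blast
next
  case (24 A X Y a f B Z b g)
  then obtain a' b' where 1: "Dist T A X Y a f a'" "Dist T B Y Z b g b'" by blast
  then have o: "A \<in> Ob T" "B \<in> Ob T" "X \<in> Ob T" "Z \<in> Ob T" "g \<cdot> f \<in> Hom T X Z"
    using Dist_typed[OF 1(1)] Dist_typed[OF 1(2)] Comp_in_Hom by blast+
  then obtain E e e' where 2: "Dist T X Z E (g \<cdot> f) e e'" using Dist_cone by blast
  \<comment> \<open>The fibre version: rotation turns fibres into shifted cones, the axiom for cones
    applies, and the resulting triangle is shifted back.\<close>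
  from Dist_octahedron[OF Dist_rot[OF 1(1)] Dist_rot[OF 1(2)] 2]
  obtain u v w where "Dist T (sh1 T A) E (sh1 T B) u v w" by blast
  from ex_Dist_unshift[OF this o(1,2)] ex_Dist_rot'[OF 2] show ?case by blast
qed

section \<open>Thick subcategories through extensions and retracts\<close>

text \<open>The cone of \<open>X \<rightarrow> Y\<close> is an extension of \<open>X[1]\<close> by
  \<open>Y\<close>; isomorphic objects and direct summands are retracts.\<close>

lemma thick_sub_if_closed:
  assumes "P \<subseteq> Ob T" "M \<in> P" "\<And>n X. X \<in> P \<Longrightarrow> shift T n X \<in> P"
    and ext: "\<And>X Y Z f g. \<exists>h. Dist T X Y Z f g h \<Longrightarrow> X \<in> P \<Longrightarrow> Z \<in> P \<Longrightarrow> Y \<in> P"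
    and ret: "\<And>X Y i p. \<lbrakk>X \<in> Ob T; Y \<in> P; i \<in> Hom T X Y; p \<in> Hom T Y X; p \<cdot> i = Id T X\<rbrakk> \<Longrightarrow> X \<in> P"
  shows "thick_sub T P"
  unfolding thick_sub_def triangulated_sub_def
proof (intro conjI ballI allI impI)
  show "Y \<in> P" if "X \<in> P" "Y \<in> Ob T" "iso_in T X Y f" for X Y f
    using that ret[of Y X] unfolding iso_in_def by blast
  show "Z \<in> P" if D: "Dist T X Y Z f g h" and "X \<in> P" "Y \<in> P" for X Y Z f g h
    using ext[of Y Z "sh1 T X" g h] Dist_rot[OF D] Dist_typed[OF D] assms(3)[OF \<open>X \<in> P\<close>, of 1] that
    by (auto simp: shift_1)
  show "X \<in> P" "Y \<in> P" if "direct_sum_of T X Y W" "W \<in> P" for X Y W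
    using that ret[of X W] ret[of Y W] unfolding direct_sum_of_def by blast+
qed (use assms in auto)

text \<open>\<open>Y\<close> is the cone of a map \<open>Z[-1] \<rightarrow> X\<close>.\<close>

lemma thick_ext:
  assumes A: "thick_sub T A" and D: "Dist T X Y Z f g h" and XZ: "X \<in> A" "Z \<in> A"
  shows "Y \<in> A"
proof -
  obtain h' where D': "Dist T (shift T (- 1) Z) X Y h' f g" using ex_Dist_rot'[OF D] by blast
  have "shift T (- 1) Z \<in> A" using A XZ unfolding thick_sub_def triangulated_sub_def by blast
  then show ?thesis using A XZ D' unfolding thick_sub_def triangulated_sub_def by blast
qed

text \<open>Thickness is defined by direct sums, so a retract needs a complement: the cone
  \<open>C\<close> of the split monomorphism \<open>i\<close>.\<close>

lemma retract_direct_sum: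
  assumes o: "X \<in> Ob T" "Y \<in> Ob T" and i: "i \<in> Hom T X Y" and p: "p \<in> Hom T Y X" and pi: "p \<cdot> i = Id T X"
  shows "\<exists>C. direct_sum_of T X C Y"
proof -
  obtain C q h where D: "Dist T X Y C i q h" using Dist_cone[OF o i] by blast
  then have C: "C \<in> Ob T" and q: "q \<in> Hom T Y C" and h: "h \<in> Hom T C (sh1 T X)"
    using Dist_typed by blast+
  note so = sh1_Ob[OF o(1)] sh1_Ob[OF o(2)]
  have si: "shm T i \<in> Hom T (sh1 T X) (sh1 T Y)" and sp: "shm T p \<in> Hom T (sh1 T Y) (sh1 T X)"
    using shm_Hom o i p by blast+
  have qi: "q \<cdot> i = \<zero>\<^bsub>HomSp T X C\<^esub>" by (rule Dist_Comp_zero[OF D])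
  have "shm T p \<cdot> shm T i = Id T (sh1 T X)"
    using shm_Comp[OF o(1,2,1) i p] pi is_fctr.mmap_Id[OF Shift_fctr o(1)] by simp
  moreover have "shm T i \<cdot> h = \<zero>\<^bsub>HomSp T C (sh1 T Y)\<^esub>"
  proof -
    interpret L: mod_hom K "HomSp T (sh1 T X) (sh1 T Y)" "HomSp T C (sh1 T Y)" "\<lambda>g. g \<cdot> h"
      by (rule hom_mod_hom[OF _ _ _ _ Comp_linear_left]) (fact so C h)+
    have "\<ominus>\<^bsub>HomSp T C (sh1 T Y)\<^esub> (shm T i \<cdot> h) = \<zero>\<^bsub>HomSp T C (sh1 T Y)\<^esub>"
      using Dist_Comp_zero[OF Dist_rot[OF Dist_rot[OF D]]] L.f_neg[OF si] by simp
    then show ?thesis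
      using Comp_in_Hom[OF C so h si] by simp
  qed
  \<comment> \<open>The shifted \<open>i\<close> is still a split monomorphism and kills
    \<open>h\<close> by composition, so \<open>h\<close> is zero and \<open>q\<close> acquires a
    section \<open>j\<close>.\<close>
  ultimately have "h = \<zero>\<^bsub>HomSp T C (sh1 T X)\<^esub>"
    using Comp_assoc[OF C so(1,2,1) h si sp] Comp_Id_left[OF C so(1) h] Comp_zero_right[OF C so(2,1) sp]
    by simp
  then have "h \<cdot> Id T C = \<zero>\<^bsub>HomSp T C (sh1 T X)\<^esub>" using Comp_Id_right[OF C so(1) h] by simp
  then obtain j where j: "j \<in> Hom T C Y" "Id T C = q \<cdot> j"
    using Dist_exact[OF Dist_rot[OF D] C Id_in_Hom[OF C]] by blast
  have pj: "p \<cdot> j \<in> Hom T C X" by (rule Comp_in_Hom[OF C o(2,1) j(1) p])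
  have ipj: "i \<cdot> (p \<cdot> j) \<in> Hom T C Y" by (rule Comp_in_Hom[OF C o(1,2) pj i])
  \<comment> \<open>The section is corrected so that its composite with \<open>p\<close> is
    zero.\<close>
  define k where "k = j \<ominus>\<^bsub>HomSp T C Y\<^esub> i \<cdot> (p \<cdot> j)"
  interpret CY: vectorspace K "HomSp T C Y" by (rule Hom_vectorspace[OF C o(2)])
  have k: "k \<in> Hom T C Y" unfolding k_def by (rule CY.M.minus_closed[OF j(1) ipj])
  have pk: "p \<cdot> k = \<zero>\<^bsub>HomSp T C X\<^esub>"
  proof -
    interpret P: mod_hom K "HomSp T C Y" "HomSp T C X" "\<lambda>g. p \<cdot> g"
      by (rule hom_mod_hom[OF _ _ _ _ Comp_linear_right]) (fact o C p)+
    have "p \<cdot> (i \<cdot> (p \<cdot> j)) = p \<cdot> j"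
      using Comp_assoc[OF C o(1,2,1) pj i p] pi Comp_Id_left[OF C o(1) pj] by simp
    then show ?thesis
      unfolding k_def using P.f_minus[OF j(1) ipj] pj by (simp add: a_minus_def P.N.M.r_neg)
  qed
  have qk: "q \<cdot> k = Id T C"
  proof -
    interpret Q: mod_hom K "HomSp T C Y" "HomSp T C C" "\<lambda>g. q \<cdot> g"
      by (rule hom_mod_hom[OF _ _ _ _ Comp_linear_right]) (fact o C q)+
    have "q \<cdot> (i \<cdot> (p \<cdot> j)) = \<zero>\<^bsub>HomSp T C C\<^esub>"
      using Comp_assoc[OF C o(1,2) C pj i q] qi Comp_zero_left[OF C o(1) C pj] by simp
    then show ?thesis
      unfolding k_def using Q.f_minus[OF j(1) ipj] j(2) Id_in_Hom[OF C] by (simp add: a_minus_def)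
  qed
  have ip: "i \<cdot> p \<in> Hom T Y Y" and kq: "k \<cdot> q \<in> Hom T Y Y"
    using Comp_in_Hom[OF o(2,1,2) p i] Comp_in_Hom[OF o(2) C o(2) q k] by blast+
  interpret YY: vectorspace K "HomSp T Y Y" by (rule Hom_vectorspace[OF o(2,2)])
  \<comment> \<open>The defect of the decomposition: \<open>q\<close> kills it, so it factors
    through \<open>i\<close>, and \<open>p\<close> kills it, so that factor is zero.\<close>
  define d where "d = Id T Y \<ominus>\<^bsub>HomSp T Y Y\<^esub> (i \<cdot> p \<oplus>\<^bsub>HomSp T Y Y\<^esub> k \<cdot> q)"
  have s: "i \<cdot> p \<oplus>\<^bsub>HomSp T Y Y\<^esub> k \<cdot> q \<in> Hom T Y Y" using ip kq by (rule YY.M.a_closed)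
  have d: "d \<in> Hom T Y Y" unfolding d_def by (rule YY.M.minus_closed[OF Id_in_Hom[OF o(2)] s])
  have qd: "q \<cdot> d = \<zero>\<^bsub>HomSp T Y C\<^esub>"
  proof -
    interpret Q: mod_hom K "HomSp T Y Y" "HomSp T Y C" "\<lambda>g. q \<cdot> g"
      by (rule hom_mod_hom[OF _ _ _ _ Comp_linear_right]) (fact o C q)+
    have "q \<cdot> (i \<cdot> p) = \<zero>\<^bsub>HomSp T Y C\<^esub>"
      using Comp_assoc[OF o(2,1,2) C p i q] qi Comp_zero_left[OF o(2,1) C p] by simp
    moreover have "q \<cdot> (k \<cdot> q) = q"
      using Comp_assoc[OF o(2) C o(2) C q k q] qk Comp_Id_left[OF o(2) C q] by simp
    ultimately show ?thesis
      unfolding d_def using Q.f_minus[OF Id_in_Hom[OF o(2)] s] Q.f_add[OF ip kq]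
        Comp_Id_right[OF o(2) C q] q by (simp add: a_minus_def Q.N.M.r_neg)
  qed
  have pd: "p \<cdot> d = \<zero>\<^bsub>HomSp T Y X\<^esub>"
  proof -
    interpret P: mod_hom K "HomSp T Y Y" "HomSp T Y X" "\<lambda>g. p \<cdot> g"
      by (rule hom_mod_hom[OF _ _ _ _ Comp_linear_right]) (fact o p)+
    have "p \<cdot> (k \<cdot> q) = \<zero>\<^bsub>HomSp T Y X\<^esub>"
      using Comp_assoc[OF o(2) C o(2,1) q k p] pk Comp_zero_left[OF o(2) C o(1) q] by simp
    moreover have "p \<cdot> (i \<cdot> p) = p"
      using Comp_assoc[OF o(2,1,2,1) p i p] pi Comp_Id_left[OF o(2,1) p] by simp
    ultimately show ?thesis
      unfolding d_def using P.f_minus[OF Id_in_Hom[OF o(2)] s] P.f_add[OF ip kq]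
        Comp_Id_right[OF o(2,1) p] p by (simp add: a_minus_def P.N.M.r_neg)
  qed
  obtain w where w: "w \<in> Hom T Y X" "d = i \<cdot> w" using Dist_exact[OF D o(2) d qd] by blast
  have "w = p \<cdot> d" using Comp_assoc[OF o(2,1,2,1) w(1) i p] pi Comp_Id_left[OF o(2,1) w(1)] w(2) by simp
  then have "d = \<zero>\<^bsub>HomSp T Y Y\<^esub>" using w pd Comp_zero_right[OF o(2,1,2) i] by simp
  then have "i \<cdot> p \<oplus>\<^bsub>HomSp T Y Y\<^esub> k \<cdot> q = Id T Y"
    unfolding d_def using YY.M.minus_other_side[OF Id_in_Hom[OF o(2)] s] by simp
  then have "direct_sum_of T X C Y"
    unfolding direct_sum_of_def using o C i k p q pi qk pk qi by blast
  then show ?thesis by blast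
qed

lemma thick_retract:
  assumes A: "thick_sub T A" and X: "X \<in> Ob T" and Y: "Y \<in> A"
    and ip: "i \<in> Hom T X Y" "p \<in> Hom T Y X" "p \<cdot> i = Id T X"
  shows "X \<in> A"
proof -
  have "Y \<in> Ob T" using A Y unfolding thick_sub_def triangulated_sub_def by blast
  then obtain C where "direct_sum_of T X C Y" using retract_direct_sum X ip by blast
  then show ?thesis using A Y unfolding thick_sub_def by blast
qed

section \<open>From the Serre isomorphism to the trace form\<close>

lemma serre_pair_if_serre_iso:
  assumes fin: "hom_finite K T" and H: "H \<in> Ob T" and Z: "Z \<in> Ob T"
    and phi: "\<And>Y. Y \<in> Ob T \<Longrightarrow> \<phi> Y \<in> module_hom K (dual_space K (HomSp T H Y)) (HomSp T Y Z)"
      "\<And>Y. Y \<in> Ob T \<Longrightarrow> bij_betw (\<phi> Y) (carrier (dual_space K (HomSp T H Y))) (Hom T Y Z)"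
    and nat: "\<And>Y Y' b \<xi>. \<lbrakk>Y \<in> Ob T; Y' \<in> Ob T; b \<in> Hom T Y' Y; \<xi> \<in> carrier (dual_space K (HomSp T H Y))\<rbrakk>
      \<Longrightarrow> \<phi> Y' (\<lambda>f\<in>Hom T H Y'. \<xi> (b \<cdot> f)) = \<phi> Y \<xi> \<cdot> b"
  shows "\<exists>t. tri_hom.serre_pair K (Ob T) (HomSp T) (Comp T) H Z t"
proof -
  interpret A: tri_hom K "Ob T" "HomSp T" "Comp T" "Id T" "shift T" dist_tri
    by (rule tri_hom_dist[OF fin])
  have dual: "carrier (dual_space K V) = module_hom K V (scalars K) \<inter> extensional (carrier V)" for V :: "('a, 'm) module"
    by (simp add: dual_space_def)
  have dual_plus: "\<xi> \<oplus>\<^bsub>dual_space K V\<^esub> \<chi> = (\<lambda>v\<in>carrier V. \<xi> v \<oplus>\<^bsub>K\<^esub> \<chi> v)" for V :: "('a, 'm) module" and \<xi> \<chi>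
    by (simp add: dual_space_def func_space_def)
  have dual_smult: "c \<odot>\<^bsub>dual_space K V\<^esub> \<xi> = (\<lambda>v\<in>carrier V. c \<otimes>\<^bsub>K\<^esub> \<xi> v)" for V :: "('a, 'm) module" and \<xi> c
    by (simp add: dual_space_def func_space_def)
  have restr: "(\<lambda>v\<in>carrier V. l v) \<in> carrier (dual_space K V)"
    if "vectorspace K V" "l \<in> module_hom K V (scalars K)" for V :: "('a, 'm) module" and l
  proof -
    interpret vectorspace K V by fact
    show ?thesis using that(2) by (auto simp: dual dual_iff)
  qed
  \<comment> \<open>The trace: \<open>g\<close> is read as a functional on Hom(H, H) and evaluated
    at the identity.\<close>
  define t where "t g = the_inv_into (carrier (dual_space K (HomSp T H H))) (\<phi> H) g (Id T H)" for g
  note I = Id_in_Hom[OF H]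
  have t_phi: "t (\<phi> H \<xi>) = \<xi> (Id T H)" if "\<xi> \<in> carrier (dual_space K (HomSp T H H))" for \<xi>
    using the_inv_into_f_f[OF bij_betw_imp_inj_on[OF phi(2)[OF H]] that] by (simp add: t_def)
  have ex_phi: "\<exists>\<xi>\<in>carrier (dual_space K (HomSp T H Y)). g = \<phi> Y \<xi>" if "Y \<in> Ob T" "g \<in> Hom T Y Z" for Y g
    using bij_betw_imp_surj_on[OF phi(2)[OF that(1)]] that(2) by blast
  \<comment> \<open>A Yoneda argument: naturality along \<open>f : H \<rightarrow> Y\<close> moves
    \<open>f\<close> into the functional, which is then evaluated at the identity.\<close>
  have pairing: "t (\<phi> Y \<xi> \<cdot> f) = \<xi> f"
    if Y: "Y \<in> Ob T" and xi: "\<xi> \<in> carrier (dual_space K (HomSp T H Y))" and f: "f \<in> Hom T H Y" for Y \<xi> f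
  proof -
    have "\<xi> \<in> module_hom K (HomSp T H Y) (scalars K)" using xi by (simp add: dual)
    then have "(\<lambda>g\<in>Hom T H H. \<xi> (f \<cdot> g)) \<in> carrier (dual_space K (HomSp T H H))"
      by (intro restr Hom_vectorspace H dual_comp[OF Comp_linear_right[OF H H Y f]])
    then show ?thesis
      using t_phi nat[OF Y H f xi] I Comp_Id_right[OF H Y f] by (metis restrict_apply')
  qed
  have phi_add: "\<exists>\<xi>\<in>carrier (dual_space K (HomSp T H Y)). g \<oplus>\<^bsub>HomSp T Y Z\<^esub> g' = \<phi> Y \<xi> \<and> \<xi> f = \<chi> f \<oplus>\<^bsub>K\<^esub> \<chi>' f"
    if "Y \<in> Ob T" "\<chi> \<in> carrier (dual_space K (HomSp T H Y))" "\<chi>' \<in> carrier (dual_space K (HomSp T H Y))"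
      "g = \<phi> Y \<chi>" "g' = \<phi> Y \<chi>'" "f \<in> Hom T H Y" for Y g g' \<chi> \<chi>' f
  proof (intro bexI[of _ "\<chi> \<oplus>\<^bsub>dual_space K (HomSp T H Y)\<^esub> \<chi>'"] conjI)
    show "\<chi> \<oplus>\<^bsub>dual_space K (HomSp T H Y)\<^esub> \<chi>' \<in> carrier (dual_space K (HomSp T H Y))"
      unfolding dual_plus using that(2,3)
      by (intro restr dual_add[OF field_axioms] Hom_vectorspace H that(1)) (simp_all add: dual)
    show "g \<oplus>\<^bsub>HomSp T Y Z\<^esub> g' = \<phi> Y (\<chi> \<oplus>\<^bsub>dual_space K (HomSp T H Y)\<^esub> \<chi>')"
      using module_hom_add[OF phi(1)[OF that(1)] that(2,3)] that(4,5) by simp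
    show "(\<chi> \<oplus>\<^bsub>dual_space K (HomSp T H Y)\<^esub> \<chi>') f = \<chi> f \<oplus>\<^bsub>K\<^esub> \<chi>' f"
      using that(6) by (simp add: dual_plus)
  qed
  have phi_zero: "g = \<zero>\<^bsub>HomSp T Y Z\<^esub>"
    if Y: "Y \<in> Ob T" and g: "g \<in> Hom T Y Z" and z: "\<And>f. f \<in> Hom T H Y \<Longrightarrow> t (g \<cdot> f) = \<zero>\<^bsub>K\<^esub>" for Y g
  proof -
    interpret YZ: vectorspace K "HomSp T Y Z" by (rule Hom_vectorspace[OF Y Z])
    obtain \<xi> where xi: "\<xi> \<in> carrier (dual_space K (HomSp T H Y))" "g = \<phi> Y \<xi>" using ex_phi[OF Y g] by blast
    have "\<xi> f = \<zero>\<^bsub>K\<^esub>" if "f \<in> Hom T H Y" for f using pairing[OF Y xi(1) that] z[OF that] xi(2) by simp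
    \<comment> \<open>A vanishing \<open>\<xi>\<close> equals its own double; additivity carries
      this to \<open>g\<close>, which is therefore zero.\<close>
    then have "\<xi> \<oplus>\<^bsub>dual_space K (HomSp T H Y)\<^esub> \<xi> = \<xi>"
      unfolding dual_plus using xi(1) by (intro ext) (auto simp: dual restrict_def extensional_def)
    then have "g \<oplus>\<^bsub>HomSp T Y Z\<^esub> g = g"
      using module_hom_add[OF phi(1)[OF Y] xi(1,1)] xi(2) by simp
    then show ?thesis using g by (metis YZ.M.add.r_cancel_one')
  qed
  have t: "t \<in> module_hom K (HomSp T H Z) (scalars K)"
    unfolding dual_iff
  proof (intro conjI ballI)
    show "t \<in> Hom T H Z \<rightarrow> carrier K"
    proof
      fix g assume "g \<in> Hom T H Z"
      then obtain \<xi> where xi: "\<xi> \<in> carrier (dual_space K (HomSp T H H))" "g = \<phi> H \<xi>"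
        using ex_phi[OF H] by blast
      then show "t g \<in> carrier K" using t_phi dual_closed[of \<xi> K "HomSp T H H"] I by (simp add: dual)
    qed
    fix g g' assume "g \<in> Hom T H Z" "g' \<in> Hom T H Z"
    then obtain \<xi> \<xi>' where xi: "\<xi> \<in> carrier (dual_space K (HomSp T H H))" "g = \<phi> H \<xi>"
        "\<xi>' \<in> carrier (dual_space K (HomSp T H H))" "g' = \<phi> H \<xi>'"
      using ex_phi[OF H] by metis
    then show "t (g \<oplus>\<^bsub>HomSp T H Z\<^esub> g') = t g \<oplus>\<^bsub>K\<^esub> t g'"
      using phi_add[OF H xi(1,3,2,4) I] t_phi by metis
  next
    fix c g assume c: "c \<in> carrier K" and "g \<in> Hom T H Z"
    then obtain \<xi> where xi: "\<xi> \<in> carrier (dual_space K (HomSp T H H))" "g = \<phi> H \<xi>"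
      using ex_phi[OF H] by blast
    let ?V = "dual_space K (HomSp T H H)"
    have "(\<lambda>v. c \<otimes>\<^bsub>K\<^esub> \<xi> v) \<in> module_hom K (HomSp T H H) (scalars K)"
    proof -
      have "\<xi> \<in> module_hom K (HomSp T H H) (scalars K)" using xi(1) by (simp add: dual)
      then show ?thesis using c unfolding dual_iff by (simp add: Pi_iff r_distr m_lcomm)
    qed
    then have "c \<odot>\<^bsub>?V\<^esub> \<xi> \<in> carrier ?V" unfolding dual_smult by (intro restr Hom_vectorspace H)
    moreover have "c \<odot>\<^bsub>HomSp T H Z\<^esub> g = \<phi> H (c \<odot>\<^bsub>?V\<^esub> \<xi>)"
      using module_hom_smult[OF phi(1)[OF H] c xi(1)] xi(2) by simp
    ultimately show "t (c \<odot>\<^bsub>HomSp T H Z\<^esub> g) = c \<otimes>\<^bsub>K\<^esub> t g"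
      using t_phi xi I by (simp add: dual_smult)
  qed
  have "A.serre_pair H Z t"
    unfolding A.serre_pair_def
  proof (intro conjI ballI t)
    fix Y l assume Y: "Y \<in> Ob T" and l: "l \<in> module_hom K (HomSp T Y Z) (scalars K)"
    \<comment> \<open>By \<open>phi_zero\<close> the pairing has no kernel in Hom(Y, Z), so Hom(H,
      Y) represents all functionals on it.\<close>
    show "\<exists>h\<in>Hom T H Y. \<forall>g\<in>Hom T Y Z. l g = t (g \<cdot> h)"
    proof (rule functional_representable[OF Hom_vectorspace[OF H Y] Hom_vectorspace[OF Y Z] _ _ _ _ l])
      show "vectorspace.fin_dim K (HomSp T H Y)" using fin H Y by (simp add: hom_finite_def)
      show "(\<lambda>h. t (g \<cdot> h)) \<in> module_hom K (HomSp T H Y) (scalars K)" if "g \<in> Hom T Y Z" for g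
        by (rule dual_comp[OF Comp_linear_right[OF H Y Z that] t])
      show "(\<lambda>g. t (g \<cdot> h)) \<in> module_hom K (HomSp T Y Z) (scalars K)" if "h \<in> Hom T H Y" for h
        by (rule dual_comp[OF Comp_linear_left[OF H Y Z that] t])
    qed (rule phi_zero[OF Y])
  next
    fix Y l assume Y: "Y \<in> Ob T" and l: "l \<in> module_hom K (HomSp T H Y) (scalars K)"
    have r: "(\<lambda>f\<in>Hom T H Y. l f) \<in> carrier (dual_space K (HomSp T H Y))"
      by (rule restr[OF Hom_vectorspace[OF H Y] l])
    then have "\<phi> Y (\<lambda>f\<in>Hom T H Y. l f) \<in> Hom T Y Z" by (rule bij_betw_apply[OF phi(2)[OF Y]])
    moreover have "l f = t (\<phi> Y (\<lambda>f\<in>Hom T H Y. l f) \<cdot> f)" if "f \<in> Hom T H Y" for f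
      using pairing[OF Y r that] that by simp
    ultimately show "\<exists>z\<in>Hom T Y Z. \<forall>f\<in>Hom T H Y. l f = t (z \<cdot> f)" by blast
  qed
  then show ?thesis by blast
qed

lemma ex_serre_pair:
  assumes fin: "hom_finite K T" and S: "serre_duality K T A S" and H: "H \<in> A" "A \<subseteq> Ob T" "omap S H \<in> Ob T"
  shows "\<exists>t. tri_hom.serre_pair K (Ob T) (HomSp T) (Comp T) H (omap S H) t"
proof -
  obtain \<phi> where
    1: "\<forall>X\<in>A. \<forall>Y\<in>Ob T. \<phi> X Y \<in> module_hom K (dual_space K (HomSp T X Y)) (HomSp T Y (omap S X)) \<and>
      bij_betw (\<phi> X Y) (carrier (dual_space K (HomSp T X Y))) (Hom T Y (omap S X))" and
    2: "\<forall>X\<in>A. \<forall>Y\<in>Ob T. \<forall>Y'\<in>Ob T. \<forall>b\<in>Hom T Y' Y. \<forall>\<xi>\<in>carrier (dual_space K (HomSp T X Y)).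
      \<phi> X Y' (\<lambda>f\<in>Hom T X Y'. \<xi> (b \<cdot> f)) = \<phi> X Y \<xi> \<cdot> b"
    using S unfolding serre_duality_def by blast
  show ?thesis
    by (rule serre_pair_if_serre_iso[OF fin _ H(3), where \<phi> = "\<phi> H"]) (use 1 2 H in blast)+
qed

end

section \<open>The equivalence and the restriction of \<open>S\<close> to the hearts\<close>

theorem theorem4p9:
  fixes K :: "'a ring"
    and T :: "('o, 'm, 'a) tri_cat"
    and Tfd :: "'o set"
    and S :: "('o, 'm, 'o, 'm) fctr"
    and M :: 'o
  assumes "triangulated_cat K T"
    and "hom_finite K T"
    and "thick_sub T Tfd"
    and "cat_equivalence (full_sub T Tfd) (full_sub T Tfd) S"
    and "serre_duality K T Tfd S"
    and "silting T M"
  shows "((right_adjacent_t_structure T M \<and> right_perp T (pos_shifts T M) \<subseteq> Tfd) \<longleftrightarrow>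
         (left_adjacent_t_structure T M \<and> left_perp T (neg_shifts T M) \<subseteq> Tfd)) \<and>
         (right_adjacent_t_structure T M \<and> right_perp T (pos_shifts T M) \<subseteq> Tfd \<longrightarrow>
         omap S ` left_perp T (neg_shifts T M) \<subseteq> right_perp T (neg_shifts T M) \<and>
         (\<forall>S'. quasi_inverse (full_sub T Tfd) (full_sub T Tfd) S S' \<longrightarrow>
               omap S' ` right_perp T (pos_shifts T M) \<subseteq> left_perp T (pos_shifts T M)) \<and>
         cat_equivalence
           (full_sub T (heart (left_perp T (neg_shifts T M)) (left_perp T (pos_shifts T M))))
           (full_sub T (heart (right_perp T (neg_shifts T M)) (right_perp T (pos_shifts T M))))
           S)"
proof -
  interpret triangulated_cat K T by fact
  note fin = assms(2) and thick = assms(3)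
  have fdOb: "Tfd \<subseteq> Ob T" using thick unfolding thick_sub_def triangulated_sub_def by blast
  interpret A: tri_hom K "Ob T" "HomSp T" "Comp T" "Id T" "shift T" dist_tri
    by (rule tri_hom_dist[OF fin])
  have S_Ob: "omap S X \<in> Tfd" if "X \<in> Tfd" for X
    using assms(4) that is_fctr.omap_in_Ob[of "full_sub T Tfd" "full_sub T Tfd" S X]
    unfolding cat_equivalence_def quasi_inverse_def by auto
  have pair: "\<exists>t. A.serre_pair X (omap S X) t" if "X \<in> Tfd" for X
    using ex_serre_pair[OF fin assms(5) that fdOb] S_Ob[OF that] fdOb by blast
  have pair': "omap S' Z \<in> Tfd \<and> (\<exists>t. A.serre_pair (omap S' Z) Z t)"
    if q: "quasi_inverse (full_sub T Tfd) (full_sub T Tfd) S S'" and Z: "Z \<in> Tfd" for S' Z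
  proof -
    have H: "omap S' Z \<in> Tfd"
      using q Z is_fctr.omap_in_Ob[of "full_sub T Tfd" "full_sub T Tfd" S' Z]
      unfolding quasi_inverse_def by auto
    have "naturally_iso (full_sub T Tfd) (full_sub T Tfd) (comp_fctr S S') id_fctr"
      using q unfolding quasi_inverse_def by blast
    then obtain a where "iso_in T (omap S (omap S' Z)) Z a"
      using Z unfolding naturally_iso_def by (auto simp: comp_fctr_def id_fctr_def)
    then obtain b where ab: "a \<in> Hom T (omap S (omap S' Z)) Z" "b \<in> Hom T Z (omap S (omap S' Z))"
      "b \<cdot>\<^bsub>T\<^esub> a = Id T (omap S (omap S' Z))" "a \<cdot>\<^bsub>T\<^esub> b = Id T Z"
      unfolding iso_in_def by blast
    obtain t where t: "A.serre_pair (omap S' Z) (omap S (omap S' Z)) t" using pair[OF H] by blast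
    \<comment> \<open>The trace form is transported along the isomorphism from
      \<open>S (S' Z)\<close> to \<open>Z\<close>.\<close>
    have "A.serre_pair (omap S' Z) Z (\<lambda>g. t (b \<cdot>\<^bsub>T\<^esub> g))"
      by (rule A.serre_pair_iso[OF t _ _ _ ab]) (use fdOb H S_Ob[OF H] Z in blast)+
    then show ?thesis using H by blast
  qed
  have M: "M \<in> Ob T" "\<And>i. i > 0 \<Longrightarrow> zero_space (HomSp T M (shift T i M))" "thick_closure T M = Ob T"
    using assms(6) unfolding silting_def Hom_zero_def zero_space_def by blast+
  interpret A: tri_serre K "Ob T" "HomSp T" "Comp T" "Id T" "shift T" dist_tri M Tfd
  proof (intro tri_serre.intro tri_silting.intro tri_hom_dist[OF fin] tri_silting_axioms.intro
      tri_serre_axioms.intro M(1) fdOb, goal_cases)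
    case (1 i)
    then show ?case by (rule M(2))
  next
    case (2 P)
    have "thick_sub T P"
      by (rule thick_sub_if_closed[OF 2(1,2,3)]) (use 2(4,5) in \<open>auto simp: dist_tri_def\<close>)
    then have "Ob T \<subseteq> P" using 2(2) M(3) unfolding thick_closure_def by blast
    then show ?case using 2(1) by blast
  next
    case 3
    show ?case using thick unfolding thick_sub_def triangulated_sub_def by blast
  next
    case (4 X n)
    then show ?case using thick unfolding thick_sub_def triangulated_sub_def by blast
  next
    case (5 X Y Z f g)
    then show ?case using thick_ext[OF thick] by (auto simp: dist_tri_def)
  next
    case (6 X Y i p)
    then show ?case by (rule thick_retract[OF thick])
  next
    case (7 H)
    then show ?case using pair S_Ob by blast
  next
    case (8 Z)
    obtain S' where "quasi_inverse (full_sub T Tfd) (full_sub T Tfd) S S'"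
      using assms(4) unfolding cat_equivalence_def by blast
    then show ?case using pair' 8 by blast
  qed
  have zero: "Hom_zero T X Y \<longleftrightarrow> zero_space (HomSp T X Y)" for X Y
    by (simp add: Hom_zero_def zero_space_def)
  have perps: "right_perp T (neg_shifts T M) = A.Rlt 0" "right_perp T (pos_shifts T M) = A.Rgt 0"
    "left_perp T (neg_shifts T M) = A.Llt 0" "left_perp T (pos_shifts T M) = A.Lgt 0"
    unfolding right_perp_def left_perp_def neg_shifts_def pos_shifts_def zero
      A.Rlt_def A.Rgt_def A.Llt_def A.Lgt_def by blast+
  have tri: "(\<exists>f g h. Dist T X Y Z f g h) \<longleftrightarrow> (\<exists>f g. dist_tri X Y Z f g)" for X Y Z
    by (simp add: dist_tri_def)
  have t_iff: "t_structure T U V \<longleftrightarrow> U \<subseteq> Ob T \<and> V \<subseteq> Ob T \<and> shift T (- 1) ` V \<subseteq> V \<and>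
      U = left_perp T (shift T (- 1) ` V) \<and> shift T (- 1) ` V = right_perp T U \<and>
      (\<forall>X\<in>Ob T. \<exists>X'\<in>U. \<exists>X''\<in>shift T (- 1) ` V. \<exists>f g h. Dist T X' X X'' f g h)" for U V
    by (simp only: t_structure_def Let_def)
  \<comment> \<open>One direction reads off the truncation triangles; the other rebuilds both
    orthogonality clauses from \<open>right_perp_eq\<close>.\<close>
  have right: "right_adjacent_t_structure T M \<and> A.Rgt 0 \<subseteq> Tfd \<longleftrightarrow> A.right_cond"
  proof
    assume r: "right_adjacent_t_structure T M \<and> A.Rgt 0 \<subseteq> Tfd"
    then have "\<forall>X\<in>Ob T. \<exists>X'\<in>A.Rlt 0. \<exists>X''\<in>A.Rgt (- 1). \<exists>f g. dist_tri X' X X'' f g"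
      unfolding right_adjacent_t_structure_def t_iff perps A.sh_image_Rgt tri by (elim conjE)
    then show "A.right_cond" using r A.right_condI[of 0] by simp
  next
    assume r: "A.right_cond"
    have "A.Rlt 0 = left_perp T (A.Rgt (- 1))" "A.Rgt (- 1) = right_perp T (A.Rlt 0)"
      using A.right_perp_eq[OF r, of 0] unfolding left_perp_def right_perp_def zero by simp_all
    moreover have "\<forall>X\<in>Ob T. \<exists>X'\<in>A.Rlt 0. \<exists>X''\<in>A.Rgt (- 1). \<exists>f g. dist_tri X' X X'' f g"
      and "A.Rgt 0 \<subseteq> Tfd"
      using r[unfolded A.right_cond_def] by (auto dest: spec[of _ "0 :: int"])
    moreover have "A.Rgt (- 1) \<subseteq> A.Rgt 0" "A.Rlt 0 \<subseteq> Ob T" "A.Rgt 0 \<subseteq> Ob T"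
      by (auto simp: A.Rgt_def A.Rlt_def)
    ultimately show "right_adjacent_t_structure T M \<and> A.Rgt 0 \<subseteq> Tfd"
      unfolding right_adjacent_t_structure_def t_iff perps A.sh_image_Rgt tri by blast
  qed
  have left: "left_adjacent_t_structure T M \<and> A.Llt 0 \<subseteq> Tfd \<longleftrightarrow> A.left_cond"
  proof
    assume l: "left_adjacent_t_structure T M \<and> A.Llt 0 \<subseteq> Tfd"
    then have "\<forall>X\<in>Ob T. \<exists>X'\<in>A.Llt 0. \<exists>X''\<in>A.Lgt (- 1). \<exists>f g. dist_tri X' X X'' f g"
      unfolding left_adjacent_t_structure_def t_iff perps A.sh_image_Lgt tri by (elim conjE)
    then show "A.left_cond" using l A.left_condI by blast
  next
    assume l: "A.left_cond"
    have "A.Llt 0 = left_perp T (A.Lgt (- 1))" "A.Lgt (- 1) = right_perp T (A.Llt 0)"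
      using A.left_perp_eq[OF l, of 0] unfolding left_perp_def right_perp_def zero by simp_all
    moreover have "\<forall>X\<in>Ob T. \<exists>X'\<in>A.Llt 0. \<exists>X''\<in>A.Lgt (- 1). \<exists>f g. dist_tri X' X X'' f g"
      and "A.Llt 0 \<subseteq> Tfd"
      using l[unfolded A.left_cond_def] by (auto dest: spec[of _ "0 :: int"])
    moreover have "A.Lgt (- 1) \<subseteq> A.Lgt 0" "A.Llt 0 \<subseteq> Ob T" "A.Lgt 0 \<subseteq> Ob T"
      by (auto simp: A.Lgt_def A.Llt_def)
    ultimately show "left_adjacent_t_structure T M \<and> A.Llt 0 \<subseteq> Tfd"
      unfolding left_adjacent_t_structure_def t_iff perps A.sh_image_Lgt tri by blast
  qed
  have "omap S ` A.Llt 0 \<subseteq> A.Rlt 0 \<and>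
      (\<forall>S'. quasi_inverse (full_sub T Tfd) (full_sub T Tfd) S S' \<longrightarrow> omap S' ` A.Rgt 0 \<subseteq> A.Lgt 0) \<and>
      cat_equivalence (full_sub T (A.Llt 0 \<inter> A.Lgt 0)) (full_sub T (A.Rlt 0 \<inter> A.Rgt 0)) S"
    if r: "A.right_cond"
  proof -
    have fd: "A.Rgt 0 \<subseteq> Tfd" "A.Llt 0 \<subseteq> Tfd"
      using r A.right_cond_iff_left_cond unfolding A.right_cond_def A.left_cond_def by blast+
    \<comment> \<open>Serre duality exchanges maps from \<open>X\<close> to \<open>M[i]\<close> with
      maps from \<open>M[i]\<close> to \<open>S X\<close>, degree by degree.\<close>
    have S_zero: "zero_space (HomSp T (shift T i M) (omap S X))"
      if X: "X \<in> Tfd" "zero_space (HomSp T X (shift T i M))" for X i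
      using pair[OF X(1)] A.serre_zero'[OF _ _ _ shift_Ob[OF M(1)] X(2)] fdOb X(1) S_Ob[OF X(1)] by blast
    have S'_zero: "zero_space (HomSp T (omap S' Z) (shift T i M))"
      if q: "quasi_inverse (full_sub T Tfd) (full_sub T Tfd) S S'"
        and Z: "Z \<in> Tfd" "zero_space (HomSp T (shift T i M) Z)" for S' Z i
      using pair'[OF q Z(1)] A.serre_zero[OF _ _ _ shift_Ob[OF M(1)] Z(2)] fdOb Z(1) by blast
    have S_lt: "omap S X \<in> A.Rlt 0" if "X \<in> A.Llt 0" for X
      using S_zero S_Ob that fd(2) fdOb unfolding A.Rlt_def A.Llt_def by blast
    have S_gt: "omap S X \<in> A.Rgt 0" if "X \<in> A.Lgt 0" "X \<in> Tfd" for X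
      using S_zero S_Ob that fdOb unfolding A.Rgt_def A.Lgt_def by blast
    have S'_gt: "omap S' Z \<in> A.Lgt 0"
      if "quasi_inverse (full_sub T Tfd) (full_sub T Tfd) S S'" "Z \<in> A.Rgt 0" for S' Z
      using S'_zero pair' that fd(1) fdOb unfolding A.Rgt_def A.Lgt_def by blast
    have S'_lt: "omap S' Z \<in> A.Llt 0"
      if "quasi_inverse (full_sub T Tfd) (full_sub T Tfd) S S'" "Z \<in> A.Rlt 0" "Z \<in> Tfd" for S' Z
      using S'_zero pair' that fdOb unfolding A.Rlt_def A.Llt_def by blast
    obtain S' where q: "quasi_inverse (full_sub T Tfd) (full_sub T Tfd) S S'"
      using assms(4) unfolding cat_equivalence_def by blast
    \<comment> \<open>Both hearts lie in \<open>Tfd\<close>, so \<open>S\<close> restricts together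
      with its quasi-inverse.\<close>
    have "quasi_inverse (full_sub T (A.Llt 0 \<inter> A.Lgt 0)) (full_sub T (A.Rlt 0 \<inter> A.Rgt 0)) S S'"
      by (rule quasi_inverse_restrict[OF q])
        (use fd S_lt S_gt S'_gt[OF q] S'_lt[OF q] in blast)+
    then show ?thesis using S_lt S'_gt unfolding cat_equivalence_def by blast
  qed
  then show ?thesis
    unfolding perps heart_def right left using A.right_cond_iff_left_cond by blast
qed

end
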